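(* Let - (MUC): $(\exists \Omega^{3})(\forall \varphi^{2})(\forall f^{1},g^{1}\leq_1 1)[\overline f\,\Omega(\varphi)=\overline g\,\Omega(\varphi)\to \varphi(f)=\varphi(g)]$; - (MPC): $(\exists\Delta^3)(\forall\varphi^2)(\forall f^1,g^1\le_11)[\overline f\Delta(\varphi,f)=\overline g\Delta(\varphi,f)\to\varphi(f)=\varphi(g)]$; - UFAN$_2$: there is $\Phi^3$ such that for all binary trees $T^1\le_11$ and all $g^2$, $(\forall\alpha^1\le_11)(\overline\alpha g(\alpha)\notin T)\to(\forall\alpha^1\le_11)(\exists n^0\le\Phi(g,T))(\overline\alpha n\notin T)$. Then $\mathrm{RCA}_0^\omega$ proves $[\mathrm{UFAN}_2+\mathrm{MPC}]\leftrightarrow\mathrm{MUC}$. The same equivalence holds relative to `st' in $\mathrm{RCA}_0^\Omega$, i.e. $\mathrm{RCA}_0^\Omega$ proves $[\mathrm{UFAN}_2^{\mathrm{st}}+\mathrm{MPC}^{\mathrm{st}}]\leftrightarrow\mathrm{MUC}^{\mathrm{st}}$.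
   Context: Types: $0$ is the type of natural numbers, $\sigma\to\tau$ that of functionals from type $\sigma$ to type $\tau$; $1:=0\to0$, $2:=1\to0$, $3:=2\to0$. Superscripts indicate types; finitely many arguments or values are combined by standard currying/coding (so a functional taking arguments of type $2$ and $1$ to type $0$ is also given type $3$). For $f,g$ of type $1$, $f\le_1g$ means $(\forall n^0)(f(n)\le g(n))$; `$f\le_11$' says that $f$ is a $0/1$-sequence (an element of Cantor space); $\overline fn$ is (the code of) $\langle f(0),\dots,f(n-1)\rangle$; $\sigma*00\dots$ extends the finite sequence $\sigma$ by zeros. Sets and trees are given by characteristic functions. $\mathrm{RCA}_0^\omega$ (Kohlenbach) is $\mathrm{E\text{-}PRA}^\omega+\mathrm{QF\text{-}AC}^{1,0}$. Here $\mathrm{E\text{-}PRA}^\omega$ is classical arithmetic in all finite types with primitive equality $=_0$ only at type $0$ (at higher type, $x=_\tau y$ is defined as $xz_1\dots z_k=_0yz_1\dots z_k$ for all $z_i$), constants for zero, successor, the combinators and primitive recursion with values of type $0$, quantifier-free induction, and the extensionality axiom $x=_\rho y\to\varphi(x)=_\tau\varphi(y)$ for all $\varphi^{\rho\to\tau}$. $\mathrm{QF\text{-}AC}^{\sigma,0}$ is the schema $(\forall x^\sigma)(\exists n^0)A_0(x,n)\to(\exists F^{\sigma\to0})(\forall x^\sigma)A_0(x,F(x))$ for quantifier-free $A_0$. $\mathrm{RCA}_0^\Omega$ is $\mathrm{E\text{-}PRA}^{\omega*}_{\mathrm{st}}+\mathrm{QF\text{-}AC}^{1,0}+\mathrm I+\mathrm{HAC}_{\mathrm{int}}+\mathrm{PF\text{-}TP}_\forall$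 plus the constant axioms below. The language adds a type $\sigma^*$ of finite sequences of objects of type $\sigma$ and, for each type, a predicate $\mathrm{st}(x)$ (`$x$ is standard'). $(\forall^{\mathrm{st}}x)\Phi$ is $(\forall x)(\mathrm{st}(x)\to\Phi)$ and $(\exists^{\mathrm{st}}x)\Phi$ is $(\exists x)(\mathrm{st}(x)\wedge\Phi)$. A formula is internal if `st' does not occur in it; $A^{\mathrm{st}}$ is obtained from $A$ by appending `st' to all quantifiers except bounded number quantifiers. Basic axioms of $\mathrm{E\text{-}PRA}^{\omega*}_{\mathrm{st}}$: $\mathrm{st}(x)\wedge x=y\to\mathrm{st}(y)$; $\mathrm{st}(t)$ for closed terms $t$; $\mathrm{st}(f)\wedge\mathrm{st}(x)\to\mathrm{st}(f(x))$; numbers below a standard number are standard. I (for internal $\varphi$): $(\forall^{\mathrm{st}}x^{\sigma^*})(\exists y^\tau)(\forall z^\sigma\in x)\varphi(z,y)\to(\exists y^\tau)(\forall^{\mathrm{st}}x^\sigma)\varphi(x,y)$. $\mathrm{HAC}_{\mathrm{int}}$ (for internal $\varphi$): $(\forall^{\mathrm{st}}x^\rho)(\exists^{\mathrm{st}}y^\tau)\varphi(x,y)\to(\exists^{\mathrm{st}}F^{\rho\to\tau^*})(\forall^{\mathrm{st}}x^\rho)(\exists y^\tau\in F(x))\varphi(x,y)$. $\mathrm{PF\text{-}TP}_\forall$: $(\forall^{\mathrm{st}}x^\tau)\varphi(x)\to(\forall x^\tau)\varphi(x)$ for internal $\varphi(x)$ with no parameters other than $x$. Constant axioms: (i) there is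 a constant $\Omega_0$ with $\mathrm{st}(\Omega_0)\wedge(\forall^{\mathrm{st}}\Xi^3)[M^{\mathrm{st}}(\Xi)\to(\forall^{\mathrm{st}}\varphi^2)(\Omega_0(\varphi)=\Xi(\varphi))]$, where $M(\Xi)$ says that for all $\varphi^2$, $\Xi(\varphi)$ is the least $n$ with $(\forall f,g\le_11)(\overline fn=\overline gn\to\varphi(f)=\varphi(g))$; and analogous constants and axioms for other functionals uniquely defined by a parameter-free internal formula; (ii) there is a constant $\Lambda_0^3$ with $\mathrm{st}(\Lambda_0)$ and $(\forall^{\mathrm{st}}\Upsilon^3)[K^{\mathrm{st}}(\Upsilon)\to(\forall^{\mathrm{st}}\varphi^2,f^1\le_11)(\Xi(\varphi,\Upsilon(\varphi,\cdot))(\overline f\Lambda_0(\varphi,f))=\varphi(f)+1)]$, where $K(\Upsilon)$ is $(\forall\varphi^2,f^1,g^1\le_11)(\overline f\Upsilon(\varphi,f)=\overline g\Upsilon(\varphi,f)\to\varphi(f)=\varphi(g))$ and $\Xi(\varphi,\omega)$ is the associate of $\varphi$ computed from a modulus $\omega$: $\Xi(\varphi,\omega)(\sigma)=\varphi(\sigma*00\dots)+1$ if $\omega(\sigma*00\dots)\le|\sigma|$, and $0$ otherwise. *)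

theory Defs
  imports Main
begin

section \<open>Finite types, terms and formulas\<close>

datatype ty = N | Fun ty ty (infixr "\<Rrightarrow>" 60) | Seq ty

abbreviation T1 :: ty where "T1 \<equiv> N \<Rrightarrow> N"
abbreviation T2 :: ty where "T2 \<equiv> T1 \<Rrightarrow> N"

text \<open>A functional of type 3 with arguments of types 2 and 1 has the curried type
  \<open>T2 \<Rrightarrow> T1 \<Rrightarrow> N\<close>.\<close>

abbreviation T3 :: ty where "T3 \<equiv> T2 \<Rrightarrow> N"
abbreviation T3' :: ty where "T3' \<equiv> T2 \<Rrightarrow> T1 \<Rrightarrow> N"

fun star_free :: "ty \<Rightarrow> bool" where
  "star_free N = True"
| "star_free (\<sigma> \<Rrightarrow> \<tau>) = (star_free \<sigma> \<and> star_free \<tau>)"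
| "star_free (Seq \<sigma>) = False"

text \<open>The syntax is locally nameless: a free variable \<open>Fr (x, \<tau>)\<close> carries its name and its type,
  a bound variable \<open>Bd n\<close> is a de Bruijn index counting the quantifiers. Terms contain no binders.
  The parameter \<open>'c\<close> is the type of constants.\<close>

type_synonym var = "string \<times> ty"

datatype 'c tm = Bd nat | Fr var | Cn 'c | Ap "'c tm" "'c tm" (infixl "\<cdot>" 110)

text \<open>The only equality symbol \<open>FEq\<close> is that of type 0; \<open>FSt\<close> is the standardness predicate.
  Bounded number quantifiers are a syntactic category of their own because relativization
  to \<open>FSt\<close> skips them: \<open>FBAll t A\<close> is \<open>\<forall>n \<le> t. A\<close> and \<open>FBEx t A\<close> is \<open>\<exists>n \<le> t. A\<close>, where \<open>n\<close> is
  \<open>Bd 0\<close> in \<open>A\<close> and \<open>t\<close> is outside the scope of \<open>n\<close>.\<close>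

datatype 'c fm =
    FEq "'c tm" "'c tm" (infix "\<^bold>=" 50)
  | FSt "'c tm"
  | FBot
  | FImp "'c fm" "'c fm" (infixr "\<^bold>\<longrightarrow>" 25)
  | FAnd "'c fm" "'c fm" (infixr "\<^bold>\<and>" 35)
  | FOr "'c fm" "'c fm" (infixr "\<^bold>\<or>" 30)
  | FAll ty "'c fm"
  | FEx ty "'c fm"
  | FBAll "'c tm" "'c fm"
  | FBEx "'c tm" "'c fm"

abbreviation FNot :: "'c fm \<Rightarrow> 'c fm" ("\<^bold>\<not> _" [40] 40) where "\<^bold>\<not> A \<equiv> A \<^bold>\<longrightarrow> FBot"
abbreviation FIff :: "'c fm \<Rightarrow> 'c fm \<Rightarrow> 'c fm" (infix "\<^bold>\<longleftrightarrow>" 25) where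
  "A \<^bold>\<longleftrightarrow> B \<equiv> (A \<^bold>\<longrightarrow> B) \<^bold>\<and> (B \<^bold>\<longrightarrow> A)"

text \<open>Combinators and recursor: \<open>cK \<sigma> \<tau>\<close> is \<open>\<Pi>\<close>, \<open>cS \<rho> \<sigma> \<tau>\<close> is \<open>\<Sigma>\<close>, and \<open>cRec\<close> is primitive recursion
  with values of type 0. The finite sequences of type \<open>Seq \<sigma>\<close> come with length, components,
  and \<open>cMk \<sigma>\<close>, which maps \<open>f\<close> and \<open>n\<close> to \<open>\<langle>f 0, \<dots>, f (n - 1)\<rangle>\<close>; the other operations on sequences
  (empty sequence, concatenation, \<dots>) are explicitly definable from these three.
  \<open>cDef \<tau> M\<close> is the constant for the functional of type \<open>\<tau>\<close> defined by the formula \<open>M\<close>,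
  where \<open>Bd 0\<close> stands for the object being defined.\<close>

datatype cn =
    cZero | cSucc
  | cK ty ty
  | cS ty ty ty
  | cRec
  | cLen ty | cProj ty | cMk ty
  | cOmega0 | cLambda0
  | cDef ty "cn fm"

fun cty :: "cn \<Rightarrow> ty" where
  "cty cZero = N"
| "cty cSucc = N \<Rrightarrow> N"
| "cty (cK \<sigma> \<tau>) = \<sigma> \<Rrightarrow> \<tau> \<Rrightarrow> \<sigma>"
| "cty (cS \<rho> \<sigma> \<tau>) = (\<rho> \<Rrightarrow> \<sigma> \<Rrightarrow> \<tau>) \<Rrightarrow> (\<rho> \<Rrightarrow> \<sigma>) \<Rrightarrow> \<rho> \<Rrightarrow> \<tau>"
| "cty cRec = N \<Rrightarrow> N \<Rrightarrow> (N \<Rrightarrow> N \<Rrightarrow> N) \<Rrightarrow> N"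
| "cty (cLen \<sigma>) = Seq \<sigma> \<Rrightarrow> N"
| "cty (cProj \<sigma>) = Seq \<sigma> \<Rrightarrow> N \<Rrightarrow> \<sigma>"
| "cty (cMk \<sigma>) = (N \<Rrightarrow> \<sigma>) \<Rrightarrow> N \<Rrightarrow> Seq \<sigma>"
| "cty cOmega0 = T3"
| "cty cLambda0 = T3'"
| "cty (cDef \<tau> M) = \<tau>"

subsection \<open>Variables and substitution\<close>

primrec fv_tm :: "'c tm \<Rightarrow> var set" where
  "fv_tm (Bd n) = {}"
| "fv_tm (Fr v) = {v}"
| "fv_tm (Cn c) = {}"
| "fv_tm (s \<cdot> t) = fv_tm s \<union> fv_tm t"

primrec fv :: "'c fm \<Rightarrow> var set" where
  "fv (s \<^bold>= t) = fv_tm s \<union> fv_tm t"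
| "fv (FSt t) = fv_tm t"
| "fv FBot = {}"
| "fv (A \<^bold>\<longrightarrow> B) = fv A \<union> fv B"
| "fv (A \<^bold>\<and> B) = fv A \<union> fv B"
| "fv (A \<^bold>\<or> B) = fv A \<union> fv B"
| "fv (FAll \<tau> A) = fv A"
| "fv (FEx \<tau> A) = fv A"
| "fv (FBAll t A) = fv_tm t \<union> fv A"
| "fv (FBEx t A) = fv_tm t \<union> fv A"

text \<open>\<open>opn k u\<close> replaces the dangling index \<open>k\<close> by the term \<open>u\<close> (which has no dangling indices);
  \<open>cls k v\<close> replaces the free variable \<open>v\<close> by the index \<open>k\<close>.\<close>

primrec opn_tm :: "nat \<Rightarrow> 'c tm \<Rightarrow> 'c tm \<Rightarrow> 'c tm" where
  "opn_tm k u (Bd n) = (if n = k then u else Bd n)"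
| "opn_tm k u (Fr v) = Fr v"
| "opn_tm k u (Cn c) = Cn c"
| "opn_tm k u (s \<cdot> t) = opn_tm k u s \<cdot> opn_tm k u t"

primrec opn :: "nat \<Rightarrow> 'c tm \<Rightarrow> 'c fm \<Rightarrow> 'c fm" where
  "opn k u (s \<^bold>= t) = (opn_tm k u s \<^bold>= opn_tm k u t)"
| "opn k u (FSt t) = FSt (opn_tm k u t)"
| "opn k u FBot = FBot"
| "opn k u (A \<^bold>\<longrightarrow> B) = (opn k u A \<^bold>\<longrightarrow> opn k u B)"
| "opn k u (A \<^bold>\<and> B) = (opn k u A \<^bold>\<and> opn k u B)"
| "opn k u (A \<^bold>\<or> B) = (opn k u A \<^bold>\<or> opn k u B)"
| "opn k u (FAll \<tau> A) = FAll \<tau> (opn (Suc k) u A)"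
| "opn k u (FEx \<tau> A) = FEx \<tau> (opn (Suc k) u A)"
| "opn k u (FBAll t A) = FBAll (opn_tm k u t) (opn (Suc k) u A)"
| "opn k u (FBEx t A) = FBEx (opn_tm k u t) (opn (Suc k) u A)"

primrec cls_tm :: "nat \<Rightarrow> var \<Rightarrow> 'c tm \<Rightarrow> 'c tm" where
  "cls_tm k v (Bd n) = Bd n"
| "cls_tm k v (Fr w) = (if w = v then Bd k else Fr w)"
| "cls_tm k v (Cn c) = Cn c"
| "cls_tm k v (s \<cdot> t) = cls_tm k v s \<cdot> cls_tm k v t"

primrec cls :: "nat \<Rightarrow> var \<Rightarrow> 'c fm \<Rightarrow> 'c fm" where
  "cls k v (s \<^bold>= t) = (cls_tm k v s \<^bold>= cls_tm k v t)"
| "cls k v (FSt t) = FSt (cls_tm k v t)"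
| "cls k v FBot = FBot"
| "cls k v (A \<^bold>\<longrightarrow> B) = (cls k v A \<^bold>\<longrightarrow> cls k v B)"
| "cls k v (A \<^bold>\<and> B) = (cls k v A \<^bold>\<and> cls k v B)"
| "cls k v (A \<^bold>\<or> B) = (cls k v A \<^bold>\<or> cls k v B)"
| "cls k v (FAll \<tau> A) = FAll \<tau> (cls (Suc k) v A)"
| "cls k v (FEx \<tau> A) = FEx \<tau> (cls (Suc k) v A)"
| "cls k v (FBAll t A) = FBAll (cls_tm k v t) (cls (Suc k) v A)"
| "cls k v (FBEx t A) = FBEx (cls_tm k v t) (cls (Suc k) v A)"

text \<open>Quantifiers over named variables. In the bounded ones \<open>v\<close> has type \<open>N\<close> and does not occur
  in the bound.\<close>

definition all :: "var \<Rightarrow> 'c fm \<Rightarrow> 'c fm" where "all v A = FAll (snd v) (cls 0 v A)"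
definition ex :: "var \<Rightarrow> 'c fm \<Rightarrow> 'c fm" where "ex v A = FEx (snd v) (cls 0 v A)"
definition ball :: "var \<Rightarrow> 'c tm \<Rightarrow> 'c fm \<Rightarrow> 'c fm" where "ball v t A = FBAll t (cls 0 v A)"
definition bex :: "var \<Rightarrow> 'c tm \<Rightarrow> 'c fm \<Rightarrow> 'c fm" where "bex v t A = FBEx t (cls 0 v A)"

definition all_st :: "var \<Rightarrow> 'c fm \<Rightarrow> 'c fm" where "all_st v A = all v (FSt (Fr v) \<^bold>\<longrightarrow> A)"
definition ex_st :: "var \<Rightarrow> 'c fm \<Rightarrow> 'c fm" where "ex_st v A = ex v (FSt (Fr v) \<^bold>\<and> A)"

definition subst :: "var \<Rightarrow> 'c tm \<Rightarrow> 'c fm \<Rightarrow> 'c fm" where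
  "subst v t A = opn 0 t (cls 0 v A)"

primrec lift :: "'c tm \<Rightarrow> 'c tm" where
  "lift (Bd n) = Bd (Suc n)"
| "lift (Fr v) = Fr v"
| "lift (Cn c) = Cn c"
| "lift (s \<cdot> t) = lift s \<cdot> lift t"

primrec internal :: "'c fm \<Rightarrow> bool" where
  "internal (s \<^bold>= t) = True"
| "internal (FSt t) = False"
| "internal FBot = True"
| "internal (A \<^bold>\<longrightarrow> B) = (internal A \<and> internal B)"
| "internal (A \<^bold>\<and> B) = (internal A \<and> internal B)"
| "internal (A \<^bold>\<or> B) = (internal A \<and> internal B)"
| "internal (FAll \<tau> A) = internal A"
| "internal (FEx \<tau> A) = internal A"
| "internal (FBAll t A) = internal A"
| "internal (FBEx t A) = internal A"

text \<open>Quantifier-free formulas are in particular internal.\<close>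

primrec qf :: "'c fm \<Rightarrow> bool" where
  "qf (s \<^bold>= t) = True"
| "qf (FSt t) = False"
| "qf FBot = True"
| "qf (A \<^bold>\<longrightarrow> B) = (qf A \<and> qf B)"
| "qf (A \<^bold>\<and> B) = (qf A \<and> qf B)"
| "qf (A \<^bold>\<or> B) = (qf A \<and> qf B)"
| "qf (FAll \<tau> A) = False"
| "qf (FEx \<tau> A) = False"
| "qf (FBAll t A) = False"
| "qf (FBEx t A) = False"

text \<open>Relativization \<open>A\<^sup>s\<^sup>t\<close>.\<close>

primrec rel_st :: "'c fm \<Rightarrow> 'c fm" where
  "rel_st (s \<^bold>= t) = (s \<^bold>= t)"
| "rel_st (FSt t) = FSt t"
| "rel_st FBot = FBot"
| "rel_st (A \<^bold>\<longrightarrow> B) = (rel_st A \<^bold>\<longrightarrow> rel_st B)"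
| "rel_st (A \<^bold>\<and> B) = (rel_st A \<^bold>\<and> rel_st B)"
| "rel_st (A \<^bold>\<or> B) = (rel_st A \<^bold>\<or> rel_st B)"
| "rel_st (FAll \<tau> A) = FAll \<tau> (FSt (Bd 0) \<^bold>\<longrightarrow> rel_st A)"
| "rel_st (FEx \<tau> A) = FEx \<tau> (FSt (Bd 0) \<^bold>\<and> rel_st A)"
| "rel_st (FBAll t A) = FBAll t (rel_st A)"
| "rel_st (FBEx t A) = FBEx t (rel_st A)"

subsection \<open>The two languages\<close>

text \<open>\<open>Base\<close> is the language of arithmetic in all finite types; \<open>Full\<close> adds the types \<open>Seq \<sigma>\<close>, the
  predicate \<open>FSt\<close> and the remaining constants. The list argument of \<open>has_ty\<close> and \<open>wff\<close> gives the types
  of the dangling indices.\<close>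

datatype lang = Base | Full

primrec ty_in :: "lang \<Rightarrow> ty \<Rightarrow> bool" where
  "ty_in Base \<tau> = star_free \<tau>"
| "ty_in Full \<tau> = True"

primrec has_ty :: "lang \<Rightarrow> ty list \<Rightarrow> cn tm \<Rightarrow> ty \<Rightarrow> bool" where
  "has_ty L \<Delta> (Bd n) \<tau> = (n < length \<Delta> \<and> \<Delta> ! n = \<tau>)"
| "has_ty L \<Delta> (Fr v) \<tau> = (snd v = \<tau> \<and> ty_in L \<tau>)"
| "has_ty L \<Delta> (Cn c) \<tau> = (cty c = \<tau>)"
| "has_ty L \<Delta> (s \<cdot> t) \<tau> = (\<exists>\<sigma>. has_ty L \<Delta> s (\<sigma> \<Rrightarrow> \<tau>) \<and> has_ty L \<Delta> t \<sigma>)"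

primrec wff :: "lang \<Rightarrow> ty list \<Rightarrow> cn fm \<Rightarrow> bool" where
  "wff L \<Delta> (s \<^bold>= t) = (has_ty L \<Delta> s N \<and> has_ty L \<Delta> t N)"
| "wff L \<Delta> (FSt t) = (L = Full \<and> (\<exists>\<tau>. has_ty L \<Delta> t \<tau>))"
| "wff L \<Delta> FBot = True"
| "wff L \<Delta> (A \<^bold>\<longrightarrow> B) = (wff L \<Delta> A \<and> wff L \<Delta> B)"
| "wff L \<Delta> (A \<^bold>\<and> B) = (wff L \<Delta> A \<and> wff L \<Delta> B)"
| "wff L \<Delta> (A \<^bold>\<or> B) = (wff L \<Delta> A \<and> wff L \<Delta> B)"
| "wff L \<Delta> (FAll \<tau> A) = (ty_in L \<tau> \<and> wff L (\<tau> # \<Delta>) A)"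
| "wff L \<Delta> (FEx \<tau> A) = (ty_in L \<tau> \<and> wff L (\<tau> # \<Delta>) A)"
| "wff L \<Delta> (FBAll t A) = (has_ty L \<Delta> t N \<and> wff L (N # \<Delta>) A)"
| "wff L \<Delta> (FBEx t A) = (has_ty L \<Delta> t N \<and> wff L (N # \<Delta>) A)"

text \<open>There is a constant \<open>cDef \<tau> M\<close> for every internal formula \<open>M\<close> of the full language whose only
  variable not bound by a quantifier is the one for the object of type \<open>\<tau>\<close> being defined.\<close>

inductive cn_in :: "lang \<Rightarrow> cn \<Rightarrow> bool" where
  "cn_in L cZero"
| "cn_in L cSucc"
| "ty_in L \<sigma> \<Longrightarrow> ty_in L \<tau> \<Longrightarrow> cn_in L (cK \<sigma> \<tau>)"
| "ty_in L \<rho> \<Longrightarrow> ty_in L \<sigma> \<Longrightarrow> ty_in L \<tau> \<Longrightarrow> cn_in L (cS \<rho> \<sigma> \<tau>)"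
| "cn_in L cRec"
| "cn_in Full (cLen \<sigma>)"
| "cn_in Full (cProj \<sigma>)"
| "cn_in Full (cMk \<sigma>)"
| "cn_in Full cOmega0"
| "cn_in Full cLambda0"
| "wff Full [\<tau>] M \<Longrightarrow> \<forall>c\<in>set_fm M. cn_in Full c \<Longrightarrow> internal M \<Longrightarrow> fv M = {} \<Longrightarrow> cn_in Full (cDef \<tau> M)"

definition is_tm :: "lang \<Rightarrow> cn tm \<Rightarrow> ty \<Rightarrow> bool" where
  "is_tm L t \<tau> \<longleftrightarrow> has_ty L [] t \<tau> \<and> (\<forall>c\<in>set_tm t. cn_in L c)"

definition is_fm :: "lang \<Rightarrow> cn fm \<Rightarrow> bool" where
  "is_fm L A \<longleftrightarrow> wff L [] A \<and> (\<forall>c\<in>set_fm A. cn_in L c)"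


section \<open>Some closed terms\<close>

text \<open>\<open>lam v t\<close> is the term \<open>\<lambda>v. t\<close> defined by bracket abstraction. It is only used for terms \<open>t\<close>
  without dangling indices, and only to build closed terms.\<close>

primrec typeof :: "cn tm \<Rightarrow> ty" where
  "typeof (Bd n) = N"
| "typeof (Fr v) = snd v"
| "typeof (Cn c) = cty c"
| "typeof (s \<cdot> t) = (case typeof s of \<sigma> \<Rrightarrow> \<tau> \<Rightarrow> \<tau> | _ \<Rightarrow> N)"

definition const_lam :: "var \<Rightarrow> cn tm \<Rightarrow> cn tm" where
  "const_lam v t = Cn (cK (typeof t) (snd v)) \<cdot> t"

definition id_lam :: "ty \<Rightarrow> cn tm" where
  "id_lam \<tau> = Cn (cS \<tau> (\<tau> \<Rrightarrow> \<tau>) \<tau>) \<cdot> Cn (cK \<tau> (\<tau> \<Rrightarrow> \<tau>)) \<cdot> Cn (cK \<tau> \<tau>)"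

primrec lam :: "var \<Rightarrow> cn tm \<Rightarrow> cn tm" where
  "lam v (Bd n) = const_lam v (Bd n)"
| "lam v (Fr w) = (if w = v then id_lam (snd v) else const_lam v (Fr w))"
| "lam v (Cn c) = const_lam v (Cn c)"
| "lam v (s \<cdot> t) =
     (if v \<notin> fv_tm (s \<cdot> t) then const_lam v (s \<cdot> t)
      else Cn (cS (snd v) (typeof t) (typeof (s \<cdot> t))) \<cdot> lam v s \<cdot> lam v t)"

abbreviation zero :: "cn tm" where "zero \<equiv> Cn cZero"
abbreviation suc :: "cn tm \<Rightarrow> cn tm" where "suc t \<equiv> Cn cSucc \<cdot> t"
abbreviation one :: "cn tm" where "one \<equiv> suc zero"
abbreviation rcs :: "cn tm \<Rightarrow> cn tm \<Rightarrow> cn tm \<Rightarrow> cn tm" where "rcs n a h \<equiv> Cn cRec \<cdot> n \<cdot> a \<cdot> h"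

abbreviation va :: var where "va \<equiv> (''a'', N)"
abbreviation vb :: var where "vb \<equiv> (''b'', N)"
abbreviation vc :: var where "vc \<equiv> (''c'', N)"
abbreviation vi :: var where "vi \<equiv> (''i'', N)"
abbreviation vk :: var where "vk \<equiv> (''k'', N)"
abbreviation vm :: var where "vm \<equiv> (''m'', N)"
abbreviation vn :: var where "vn \<equiv> (''n'', N)"
abbreviation vs :: var where "vs \<equiv> (''s'', N)"
abbreviation vu :: var where "vu \<equiv> (''u'', N)"
abbreviation vf :: var where "vf \<equiv> (''f'', T1)"
abbreviation vg :: var where "vg \<equiv> (''g'', T1)"
abbreviation vT :: var where "vT \<equiv> (''T'', T1)"
abbreviation vphi :: var where "vphi \<equiv> (''phi'', T2)"
abbreviation vomega :: var where "vomega \<equiv> (''omega'', T2)"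

subsection \<open>Arithmetic\<close>

text \<open>The recursor passes the previous value first: \<open>rcs (suc n) a h = h (rcs n a h) n\<close>.\<close>

definition predC :: "cn tm" where
  "predC = lam va (rcs (Fr va) zero (lam vu (lam vi (Fr vi))))"
abbreviation pre :: "cn tm \<Rightarrow> cn tm" where "pre t \<equiv> predC \<cdot> t"

definition addC :: "cn tm" where
  "addC = lam va (lam vb (rcs (Fr vb) (Fr va) (lam vu (lam vi (suc (Fr vu))))))"
abbreviation add :: "cn tm \<Rightarrow> cn tm \<Rightarrow> cn tm" where "add s t \<equiv> addC \<cdot> s \<cdot> t"

definition monusC :: "cn tm" where
  "monusC = lam va (lam vb (rcs (Fr vb) (Fr va) (lam vu (lam vi (pre (Fr vu))))))"
abbreviation monus :: "cn tm \<Rightarrow> cn tm \<Rightarrow> cn tm" where "monus s t \<equiv> monusC \<cdot> s \<cdot> t"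

text \<open>\<open>ifz c a b\<close> is \<open>a\<close> if \<open>c = 0\<close> and \<open>b\<close> otherwise.\<close>

definition ifzC :: "cn tm" where
  "ifzC = lam vc (lam va (lam vb (rcs (Fr vc) (Fr va) (lam vu (lam vi (Fr vb))))))"
abbreviation ifz :: "cn tm \<Rightarrow> cn tm \<Rightarrow> cn tm \<Rightarrow> cn tm" where "ifz c a b \<equiv> ifzC \<cdot> c \<cdot> a \<cdot> b"

definition Le :: "cn tm \<Rightarrow> cn tm \<Rightarrow> cn fm" (infix "\<^bold>\<le>" 50) where "s \<^bold>\<le> t = (monus s t \<^bold>= zero)"
definition Lt :: "cn tm \<Rightarrow> cn tm \<Rightarrow> cn fm" (infix "\<^bold><" 50) where "s \<^bold>< t = (suc s \<^bold>\<le> t)"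

subsection \<open>Coding of pairs and finite sequences of numbers\<close>

text \<open>Cantor pairing \<open>\<langle>a, b\<rangle> = tri (a + b) + a\<close> with \<open>tri n = 0 + 1 + \<dots> + n\<close>; \<open>root z\<close> is the largest
  \<open>n\<close> with \<open>tri n \<le> z\<close>.\<close>

definition triC :: "cn tm" where
  "triC = lam va (rcs (Fr va) zero (lam vu (lam vi (add (Fr vu) (suc (Fr vi))))))"

definition pairC :: "cn tm" where
  "pairC = lam va (lam vb (add (triC \<cdot> add (Fr va) (Fr vb)) (Fr va)))"

definition rootC :: "cn tm" where
  "rootC = lam va (rcs (Fr va) zero (lam vu (lam vi
     (ifz (monus (triC \<cdot> suc (Fr vu)) (suc (Fr vi))) (suc (Fr vu)) (Fr vu)))))"

definition fstC :: "cn tm" where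
  "fstC = lam va (monus (Fr va) (triC \<cdot> (rootC \<cdot> Fr va)))"

definition sndC :: "cn tm" where
  "sndC = lam va (monus (rootC \<cdot> Fr va) (fstC \<cdot> Fr va))"

text \<open>The empty sequence has code 0 and \<open>\<sigma> * \<langle>a\<rangle>\<close> has code \<open>\<langle>\<sigma>, a\<rangle> + 1\<close>. This is a bijection
  between finite sequences and numbers.\<close>

definition snocC :: "cn tm" where
  "snocC = lam vs (lam va (suc (pairC \<cdot> Fr vs \<cdot> Fr va)))"
definition butlastC :: "cn tm" where
  "butlastC = lam vs (fstC \<cdot> pre (Fr vs))"
definition lastC :: "cn tm" where
  "lastC = lam vs (sndC \<cdot> pre (Fr vs))"

text \<open>\<open>bar f n\<close> is the code of \<open>\<langle>f 0, \<dots>, f (n - 1)\<rangle>\<close>.\<close>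

definition barC :: "cn tm" where
  "barC = lam vf (lam vn (rcs (Fr vn) zero (lam vu (lam vi (snocC \<cdot> Fr vu \<cdot> (Fr vf \<cdot> Fr vi))))))"
abbreviation bar :: "cn tm \<Rightarrow> cn tm \<Rightarrow> cn tm" where "bar f n \<equiv> barC \<cdot> f \<cdot> n"

text \<open>\<open>dropC \<cdot> s \<cdot> k\<close> removes the last \<open>k\<close> entries of \<open>s\<close>. The length of \<open>s\<close> is the number of \<open>k < s\<close> for
  which the result is not empty; \<open>s\<close> is large enough as a bound, since a code is at least the
  length of the sequence.\<close>

definition dropC :: "cn tm" where
  "dropC = lam vs (lam vk (rcs (Fr vk) (Fr vs) (lam vu (lam vi (butlastC \<cdot> Fr vu)))))"

definition lhC :: "cn tm" where
  "lhC = lam vs (rcs (Fr vs) zero (lam vu (lam vi (ifz (dropC \<cdot> Fr vs \<cdot> Fr vi) (Fr vu) (suc (Fr vu))))))"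
abbreviation lh :: "cn tm \<Rightarrow> cn tm" where "lh s \<equiv> lhC \<cdot> s"

text \<open>\<open>pad s\<close> is \<open>s * 00\<dots>\<close>, of type 1.\<close>

definition padC :: "cn tm" where
  "padC = lam vs (lam vi (ifz (monus (suc (Fr vi)) (lh (Fr vs)))
     (lastC \<cdot> (dropC \<cdot> Fr vs \<cdot> monus (lh (Fr vs)) (suc (Fr vi)))) zero))"
abbreviation pad :: "cn tm \<Rightarrow> cn tm" where "pad s \<equiv> padC \<cdot> s"

text \<open>\<open>assocC \<cdot> \<phi> \<cdot> \<omega>\<close> is the associate of \<open>\<phi>\<close> computed from the modulus \<open>\<omega>\<close>.\<close>

definition assocC :: "cn tm" where
  "assocC = lam vphi (lam vomega (lam vs
     (ifz (monus (Fr vomega \<cdot> pad (Fr vs)) (lh (Fr vs))) (suc (Fr vphi \<cdot> pad (Fr vs))) zero)))"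


section \<open>Defined formulas\<close>

subsection \<open>Equality at higher types\<close>

text \<open>Sequences are equal if they have the same length and equal entries.\<close>

primrec eq :: "ty \<Rightarrow> cn tm \<Rightarrow> cn tm \<Rightarrow> cn fm" where
  "eq N s t = (s \<^bold>= t)"
| "eq (\<sigma> \<Rrightarrow> \<tau>) s t = FAll \<sigma> (eq \<tau> (lift s \<cdot> Bd 0) (lift t \<cdot> Bd 0))"
| "eq (Seq \<sigma>) s t =
     ((Cn (cLen \<sigma>) \<cdot> s \<^bold>= Cn (cLen \<sigma>) \<cdot> t) \<^bold>\<and>
      FBAll (Cn (cLen \<sigma>) \<cdot> s) (Bd 0 \<^bold>< Cn (cLen \<sigma>) \<cdot> lift s \<^bold>\<longrightarrow>
        eq \<sigma> (Cn (cProj \<sigma>) \<cdot> lift s \<cdot> Bd 0) (Cn (cProj \<sigma>) \<cdot> lift t \<cdot> Bd 0)))"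

text \<open>\<open>mem \<sigma> z s\<close> is \<open>z \<in> s\<close> for \<open>s\<close> of type \<open>Seq \<sigma>\<close>.\<close>

definition mem :: "ty \<Rightarrow> cn tm \<Rightarrow> cn tm \<Rightarrow> cn fm" where
  "mem \<sigma> z s = FBEx (Cn (cLen \<sigma>) \<cdot> s)
     (Bd 0 \<^bold>< Cn (cLen \<sigma>) \<cdot> lift s \<^bold>\<and> eq \<sigma> (lift z) (Cn (cProj \<sigma>) \<cdot> lift s \<cdot> Bd 0))"

subsection \<open>Continuity and the fan functional\<close>

text \<open>The definitions with term arguments use the named bound variables displayed;
  they are only applied to terms not containing these.\<close>

definition le1 :: "cn tm \<Rightarrow> cn fm" where
  "le1 f = all vn (f \<cdot> Fr vn \<^bold>\<le> one)"

abbreviation vOmega :: var where "vOmega \<equiv> (''Omega'', T3)"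
abbreviation vXi :: var where "vXi \<equiv> (''Xi'', T3)"
abbreviation vDelta :: var where "vDelta \<equiv> (''Delta'', T3')"
abbreviation vUpsilon :: var where "vUpsilon \<equiv> (''Upsilon'', T3')"
abbreviation vPhi :: var where "vPhi \<equiv> (''Phi'', T3')"
abbreviation vG :: var where "vG \<equiv> (''g'', T2)"

text \<open>\<open>n\<close> is a modulus of uniform continuity for \<open>\<phi>\<close> on Cantor space.\<close>

definition uc_mod :: "cn tm \<Rightarrow> cn tm \<Rightarrow> cn fm" where
  "uc_mod \<phi> n = all vf (le1 (Fr vf) \<^bold>\<longrightarrow> all vg (le1 (Fr vg) \<^bold>\<longrightarrow>
     (bar (Fr vf) n \<^bold>= bar (Fr vg) n) \<^bold>\<longrightarrow> (\<phi> \<cdot> Fr vf \<^bold>= \<phi> \<cdot> Fr vg)))"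

definition MUC :: "cn fm" where
  "MUC = ex vOmega (all vphi (uc_mod (Fr vphi) (Fr vOmega \<cdot> Fr vphi)))"

text \<open>\<open>is_pc_mod \<Upsilon>\<close> is the formula \<open>K(\<Upsilon>)\<close>.\<close>

definition is_pc_mod :: "cn tm \<Rightarrow> cn fm" where
  "is_pc_mod \<Upsilon> = all vphi (all vf (le1 (Fr vf) \<^bold>\<longrightarrow> all vg (le1 (Fr vg) \<^bold>\<longrightarrow>
     (bar (Fr vf) (\<Upsilon> \<cdot> Fr vphi \<cdot> Fr vf) \<^bold>= bar (Fr vg) (\<Upsilon> \<cdot> Fr vphi \<cdot> Fr vf)) \<^bold>\<longrightarrow>
     (Fr vphi \<cdot> Fr vf \<^bold>= Fr vphi \<cdot> Fr vg))))"

definition MPC :: "cn fm" where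
  "MPC = ex vDelta (is_pc_mod (Fr vDelta))"

text \<open>\<open>is_least_mod \<Xi>\<close> is the formula \<open>M(\<Xi>)\<close>.\<close>

definition is_least_mod :: "cn tm \<Rightarrow> cn fm" where
  "is_least_mod \<Xi> = all vphi (uc_mod (Fr vphi) (\<Xi> \<cdot> Fr vphi) \<^bold>\<and>
     ball vm (\<Xi> \<cdot> Fr vphi) (Fr vm \<^bold>< \<Xi> \<cdot> Fr vphi \<^bold>\<longrightarrow> \<^bold>\<not> uc_mod (Fr vphi) (Fr vm)))"

abbreviation In :: "cn tm \<Rightarrow> cn tm \<Rightarrow> cn fm" (infix "\<^bold>\<in>" 50) where "s \<^bold>\<in> T \<equiv> T \<cdot> s \<^bold>= one"

text \<open>\<open>T\<close> is (the characteristic function of) a set of finite 0/1-sequences closed under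
  initial segments.\<close>

definition is_bintree :: "cn tm \<Rightarrow> cn fm" where
  "is_bintree T = (le1 T \<^bold>\<and> all vs (Fr vs \<^bold>\<in> T \<^bold>\<longrightarrow>
     ball vi (lh (Fr vs)) (Fr vi \<^bold>< lh (Fr vs) \<^bold>\<longrightarrow> pad (Fr vs) \<cdot> Fr vi \<^bold>\<le> one) \<^bold>\<and>
     ball vk (lh (Fr vs)) (bar (pad (Fr vs)) (Fr vk) \<^bold>\<in> T)))"

definition UFAN2 :: "cn fm" where
  "UFAN2 = ex vPhi (all vT (all vG (is_bintree (Fr vT) \<^bold>\<longrightarrow>
     all vf (le1 (Fr vf) \<^bold>\<longrightarrow> \<^bold>\<not> bar (Fr vf) (Fr vG \<cdot> Fr vf) \<^bold>\<in> Fr vT) \<^bold>\<longrightarrow>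
     all vf (le1 (Fr vf) \<^bold>\<longrightarrow>
       bex vn (Fr vPhi \<cdot> Fr vG \<cdot> Fr vT) (\<^bold>\<not> bar (Fr vf) (Fr vn) \<^bold>\<in> Fr vT)))))"


section \<open>Derivability\<close>

text \<open>Natural deduction for classical many-sorted predicate logic, confined to the formulas of the
  language \<open>L\<close>. The hypotheses \<open>\<Gamma>\<close> are subject to the eigenvariable conditions, the axioms \<open>X\<close> are not:
  free variables in axioms are understood as universally quantified.\<close>

inductive deriv :: "lang \<Rightarrow> cn fm set \<Rightarrow> cn fm set \<Rightarrow> cn fm \<Rightarrow> bool" for L X where
  Axm: "A \<in> X \<Longrightarrow> is_fm L A \<Longrightarrow> deriv L X \<Gamma> A"
| Hyp: "A \<in> \<Gamma> \<Longrightarrow> is_fm L A \<Longrightarrow> deriv L X \<Gamma> A"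
| Raa: "is_fm L A \<Longrightarrow> deriv L X (insert (\<^bold>\<not> A) \<Gamma>) FBot \<Longrightarrow> deriv L X \<Gamma> A"
| ImpI: "is_fm L A \<Longrightarrow> deriv L X (insert A \<Gamma>) B \<Longrightarrow> deriv L X \<Gamma> (A \<^bold>\<longrightarrow> B)"
| ImpE: "deriv L X \<Gamma> (A \<^bold>\<longrightarrow> B) \<Longrightarrow> deriv L X \<Gamma> A \<Longrightarrow> deriv L X \<Gamma> B"
| AndI: "deriv L X \<Gamma> A \<Longrightarrow> deriv L X \<Gamma> B \<Longrightarrow> deriv L X \<Gamma> (A \<^bold>\<and> B)"
| AndE1: "deriv L X \<Gamma> (A \<^bold>\<and> B) \<Longrightarrow> deriv L X \<Gamma> A"
| AndE2: "deriv L X \<Gamma> (A \<^bold>\<and> B) \<Longrightarrow> deriv L X \<Gamma> B"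
| OrI1: "deriv L X \<Gamma> A \<Longrightarrow> is_fm L B \<Longrightarrow> deriv L X \<Gamma> (A \<^bold>\<or> B)"
| OrI2: "deriv L X \<Gamma> B \<Longrightarrow> is_fm L A \<Longrightarrow> deriv L X \<Gamma> (A \<^bold>\<or> B)"
| OrE: "deriv L X \<Gamma> (A \<^bold>\<or> B) \<Longrightarrow> deriv L X (insert A \<Gamma>) C \<Longrightarrow> deriv L X (insert B \<Gamma>) C \<Longrightarrow>
    deriv L X \<Gamma> C"
| AllI: "deriv L X \<Gamma> (opn 0 (Fr v) A) \<Longrightarrow> ty_in L (snd v) \<Longrightarrow> v \<notin> fv A \<Longrightarrow> (\<And>C. C \<in> \<Gamma> \<Longrightarrow> v \<notin> fv C) \<Longrightarrow>
    deriv L X \<Gamma> (FAll (snd v) A)"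
| AllE: "deriv L X \<Gamma> (FAll \<tau> A) \<Longrightarrow> is_tm L t \<tau> \<Longrightarrow> deriv L X \<Gamma> (opn 0 t A)"
| ExI: "is_fm L (FEx \<tau> A) \<Longrightarrow> is_tm L t \<tau> \<Longrightarrow> deriv L X \<Gamma> (opn 0 t A) \<Longrightarrow> deriv L X \<Gamma> (FEx \<tau> A)"
| ExE: "deriv L X \<Gamma> (FEx (snd v) A) \<Longrightarrow> deriv L X (insert (opn 0 (Fr v) A) \<Gamma>) B \<Longrightarrow>
    v \<notin> fv A \<Longrightarrow> v \<notin> fv B \<Longrightarrow> (\<And>C. C \<in> \<Gamma> \<Longrightarrow> v \<notin> fv C) \<Longrightarrow> deriv L X \<Gamma> B"
| BAllI: "is_fm L (FBAll t A) \<Longrightarrow> deriv L X \<Gamma> (FAll N (Bd 0 \<^bold>\<le> t \<^bold>\<longrightarrow> A)) \<Longrightarrow> deriv L X \<Gamma> (FBAll t A)"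
| BAllE: "deriv L X \<Gamma> (FBAll t A) \<Longrightarrow> deriv L X \<Gamma> (FAll N (Bd 0 \<^bold>\<le> t \<^bold>\<longrightarrow> A))"
| BExI: "is_fm L (FBEx t A) \<Longrightarrow> deriv L X \<Gamma> (FEx N (Bd 0 \<^bold>\<le> t \<^bold>\<and> A)) \<Longrightarrow> deriv L X \<Gamma> (FBEx t A)"
| BExE: "deriv L X \<Gamma> (FBEx t A) \<Longrightarrow> deriv L X \<Gamma> (FEx N (Bd 0 \<^bold>\<le> t \<^bold>\<and> A))"


section \<open>The axiom systems\<close>

text \<open>The axiom schemes range over all types and formulas of the full language; \<open>deriv L\<close> only uses the instances that are
  formulas of \<open>L\<close>. The axioms for sequences thus only concern \<open>Full\<close>.\<close>

abbreviation V :: "string \<Rightarrow> ty \<Rightarrow> cn tm" where "V x \<tau> \<equiv> Fr (x, \<tau>)"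

inductive_set EPRA :: "cn fm set" where
  eq_refl: "(V ''x'' N \<^bold>= V ''x'' N) \<in> EPRA"
| eq_sym: "((V ''x'' N \<^bold>= V ''y'' N) \<^bold>\<longrightarrow> (V ''y'' N \<^bold>= V ''x'' N)) \<in> EPRA"
| eq_trans: "((V ''x'' N \<^bold>= V ''y'' N) \<^bold>\<longrightarrow> (V ''y'' N \<^bold>= V ''z'' N) \<^bold>\<longrightarrow> (V ''x'' N \<^bold>= V ''z'' N)) \<in> EPRA"
| suc_inj: "((suc (V ''x'' N) \<^bold>= suc (V ''y'' N)) \<^bold>\<longrightarrow> (V ''x'' N \<^bold>= V ''y'' N)) \<in> EPRA"
| suc_nz: "(\<^bold>\<not> suc (V ''x'' N) \<^bold>= zero) \<in> EPRA"
| comb_K: "(eq \<sigma> (Cn (cK \<sigma> \<tau>) \<cdot> V ''x'' \<sigma> \<cdot> V ''y'' \<tau>) (V ''x'' \<sigma>)) \<in> EPRA"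
| comb_S: "(eq \<tau> (Cn (cS \<rho> \<sigma> \<tau>) \<cdot> V ''x'' (\<rho> \<Rrightarrow> \<sigma> \<Rrightarrow> \<tau>) \<cdot> V ''y'' (\<rho> \<Rrightarrow> \<sigma>) \<cdot> V ''z'' \<rho>)
    (V ''x'' (\<rho> \<Rrightarrow> \<sigma> \<Rrightarrow> \<tau>) \<cdot> V ''z'' \<rho> \<cdot> (V ''y'' (\<rho> \<Rrightarrow> \<sigma>) \<cdot> V ''z'' \<rho>))) \<in> EPRA"
| rec_0: "(rcs zero (V ''y'' N) (V ''z'' (N \<Rrightarrow> N \<Rrightarrow> N)) \<^bold>= V ''y'' N) \<in> EPRA"
| rec_suc: "(rcs (suc (V ''x'' N)) (V ''y'' N) (V ''z'' (N \<Rrightarrow> N \<Rrightarrow> N)) \<^bold>=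
    V ''z'' (N \<Rrightarrow> N \<Rrightarrow> N) \<cdot> rcs (V ''x'' N) (V ''y'' N) (V ''z'' (N \<Rrightarrow> N \<Rrightarrow> N)) \<cdot> V ''x'' N) \<in> EPRA"
| extensionality: "(eq \<rho> (V ''x'' \<rho>) (V ''y'' \<rho>) \<^bold>\<longrightarrow>
    eq \<tau> (V ''f'' (\<rho> \<Rrightarrow> \<tau>) \<cdot> V ''x'' \<rho>) (V ''f'' (\<rho> \<Rrightarrow> \<tau>) \<cdot> V ''y'' \<rho>)) \<in> EPRA"
| qf_induction: "is_fm Full A \<Longrightarrow> qf A \<Longrightarrow>
    (subst (x, N) zero A \<^bold>\<and> all (x, N) (A \<^bold>\<longrightarrow> subst (x, N) (suc (V x N)) A) \<^bold>\<longrightarrow> all (x, N) A) \<in> EPRA"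
| len_mk: "(Cn (cLen \<sigma>) \<cdot> (Cn (cMk \<sigma>) \<cdot> V ''f'' (N \<Rrightarrow> \<sigma>) \<cdot> V ''n'' N) \<^bold>= V ''n'' N) \<in> EPRA"
| proj_mk: "(V ''i'' N \<^bold>< V ''n'' N \<^bold>\<longrightarrow>
    eq \<sigma> (Cn (cProj \<sigma>) \<cdot> (Cn (cMk \<sigma>) \<cdot> V ''f'' (N \<Rrightarrow> \<sigma>) \<cdot> V ''n'' N) \<cdot> V ''i'' N)
      (V ''f'' (N \<Rrightarrow> \<sigma>) \<cdot> V ''i'' N)) \<in> EPRA"

text \<open>In the schemes below, \<open>A\<close> may contain parameters other than the variables displayed.\<close>

definition QF_AC10 :: "cn fm set" where
  "QF_AC10 = {all (x, T1) (ex (n, N) A) \<^bold>\<longrightarrow>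
     ex (F, T2) (all (x, T1) (subst (n, N) (V F T2 \<cdot> V x T1) A)) | x n F A.
     is_fm Full A \<and> qf A \<and> (F, T2) \<notin> fv A}"

definition RCA0_omega :: "cn fm set" where
  "RCA0_omega = EPRA \<union> QF_AC10"

definition RCA0_omega_proves :: "cn fm \<Rightarrow> bool" where
  "RCA0_omega_proves A \<longleftrightarrow> deriv Base RCA0_omega {} A"

inductive_set ST :: "cn fm set" where
  st_eq: "(FSt (V ''x'' \<tau>) \<^bold>\<and> eq \<tau> (V ''x'' \<tau>) (V ''y'' \<tau>) \<^bold>\<longrightarrow> FSt (V ''y'' \<tau>)) \<in> ST"
| st_closed: "is_tm Full t \<tau> \<Longrightarrow> fv_tm t = {} \<Longrightarrow> (FSt t) \<in> ST"
| st_app: "(FSt (V ''f'' (\<sigma> \<Rrightarrow> \<tau>)) \<^bold>\<and> FSt (V ''x'' \<sigma>) \<^bold>\<longrightarrow> FSt (V ''f'' (\<sigma> \<Rrightarrow> \<tau>) \<cdot> V ''x'' \<sigma>)) \<in> ST"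
| st_le: "(FSt (V ''n'' N) \<^bold>\<and> V ''m'' N \<^bold>\<le> V ''n'' N \<^bold>\<longrightarrow> FSt (V ''m'' N)) \<in> ST"

definition Idealization :: "cn fm set" where
  "Idealization = {
     all_st (x, Seq \<sigma>) (ex (y, \<tau>) (all (z, \<sigma>) (mem \<sigma> (V z \<sigma>) (V x (Seq \<sigma>)) \<^bold>\<longrightarrow> A))) \<^bold>\<longrightarrow>
     ex (y, \<tau>) (all_st (z, \<sigma>) A) | x y z \<sigma> \<tau> A.
     is_fm Full A \<and> internal A \<and> (x, Seq \<sigma>) \<notin> fv A \<and> (x, Seq \<sigma>) \<noteq> (y, \<tau>) \<and> (y, \<tau>) \<noteq> (z, \<sigma>)}"

definition HAC_int :: "cn fm set" where
  "HAC_int = {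
     all_st (x, \<rho>) (ex_st (y, \<tau>) A) \<^bold>\<longrightarrow>
     ex_st (F, \<rho> \<Rrightarrow> Seq \<tau>) (all_st (x, \<rho>)
       (ex (y, \<tau>) (mem \<tau> (V y \<tau>) (V F (\<rho> \<Rrightarrow> Seq \<tau>) \<cdot> V x \<rho>) \<^bold>\<and> A))) | x y F \<rho> \<tau> A.
     is_fm Full A \<and> internal A \<and> (x, \<rho>) \<noteq> (y, \<tau>) \<and> (F, \<rho> \<Rrightarrow> Seq \<tau>) \<notin> fv A}"

definition PF_TP :: "cn fm set" where
  "PF_TP = {all_st (x, \<tau>) A \<^bold>\<longrightarrow> all (x, \<tau>) A | x \<tau> A.
     is_fm Full A \<and> internal A \<and> fv A \<subseteq> {(x, \<tau>)}}"

text \<open>In the axiom for \<open>cDef \<tau> M\<close>, the requirement that \<open>M\<close> defines its object uniquely is the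
  premise that any two standard objects satisfying \<open>M\<close> (relative to \<open>FSt\<close>) are equal
  (relative to \<open>FSt\<close>). For \<open>cOmega0\<close> this is provable, so it does not appear.\<close>

inductive_set Const_axioms :: "cn fm set" where
  Omega0: "(FSt (Cn cOmega0) \<^bold>\<and>
    all_st vXi (rel_st (is_least_mod (Fr vXi)) \<^bold>\<longrightarrow>
      all_st vphi (Cn cOmega0 \<cdot> Fr vphi \<^bold>= Fr vXi \<cdot> Fr vphi))) \<in> Const_axioms"
| Def: "cn_in Full (cDef \<tau> M) \<Longrightarrow>
    (FSt (Cn (cDef \<tau> M)) \<^bold>\<and>
    (all_st (''x'', \<tau>) (all_st (''y'', \<tau>)
       (rel_st (opn 0 (V ''x'' \<tau>) M) \<^bold>\<and> rel_st (opn 0 (V ''y'' \<tau>) M) \<^bold>\<longrightarrow>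
        rel_st (eq \<tau> (V ''x'' \<tau>) (V ''y'' \<tau>)))) \<^bold>\<longrightarrow>
     all_st (''x'', \<tau>) (rel_st (opn 0 (V ''x'' \<tau>) M) \<^bold>\<longrightarrow>
       rel_st (eq \<tau> (Cn (cDef \<tau> M)) (V ''x'' \<tau>))))) \<in> Const_axioms"
| Lambda0: "(FSt (Cn cLambda0) \<^bold>\<and>
    all_st vUpsilon (rel_st (is_pc_mod (Fr vUpsilon)) \<^bold>\<longrightarrow>
      all_st vphi (all_st vf (le1 (Fr vf) \<^bold>\<longrightarrow>
        (assocC \<cdot> Fr vphi \<cdot> (Fr vUpsilon \<cdot> Fr vphi) \<cdot> bar (Fr vf) (Cn cLambda0 \<cdot> Fr vphi \<cdot> Fr vf) \<^bold>=
         suc (Fr vphi \<cdot> Fr vf)))))) \<in> Const_axioms"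

definition RCA0_Omega :: "cn fm set" where
  "RCA0_Omega = EPRA \<union> ST \<union> QF_AC10 \<union> Idealization \<union> HAC_int \<union> PF_TP \<union> Const_axioms"

definition RCA0_Omega_proves :: "cn fm \<Rightarrow> bool" where
  "RCA0_Omega_proves A \<longleftrightarrow> deriv Full RCA0_Omega {} A"

end

theory Submission
  imports Defs "HOL-Library.Countable"
begin

text \<open>By a Henkin completeness theorem for the calculus it suffices to argue in an arbitrary model of
  the axioms. Factoring by extensional equality at the types without \<open>Seq\<close> turns the equality of
  type 0 into the identity. In \<open>RCA0_Omega\<close> one restricts the factor structure to its standard
  elements; extensionality may then fail, but the combinator equations survive as identities and
  quantifier-free induction is inherited because numbers below a standard number are standard.

  In a model, let \<open>\<Omega>\<close> witness MUC. If \<open>M = \<Omega>(\<phi>)\<close> for \<open>\<phi>(\<alpha>) = \<alpha>(g(\<alpha>) + \<Omega>(g))\<close>, then \<open>M\<close> bounds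
  \<open>g\<close> on Cantor space, which gives UFAN\<open>\<^sub>2\<close>. Conversely, let \<open>\<Delta>\<close> witness MPC and put
  \<open>\<omega> = \<Delta>(\<phi>, \<cdot>)\<close>. The tree of the \<open>\<sigma>\<close> such that \<open>\<omega>(\<tau> * 00\<dots>) > |\<tau>|\<close> for all initial segments \<open>\<tau>\<close>
  of \<open>\<sigma>\<close> is barred by \<open>g(\<alpha>) = \<Delta>(\<omega>, \<alpha>) + \<omega>(\<alpha>)\<close>, and the bound \<open>\<Phi>(g, T)\<close> is a modulus of uniform
  continuity of \<open>\<phi>\<close>.\<close>

section \<open>Syntax\<close>

text \<open>A direct derivation would have to carry every functional of the argument as a term, with
  all substitutions into it. In a model functionals are elements and \<lambda>-terms are simply
  evaluated. The price is that both theories must be brought to one notion of model, weak enough to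
  hold for the standard part as well.

  On the way to MUC the difficulty is that a tree can only ask for \<omega> at finite sequences
  extended by zeros, whereas the modulus at \<alpha> is \<omega>(\<alpha>). This is why MPC is
  applied a second time, to \<omega> itself: from length \<Delta>(\<omega>, \<alpha>) on, the
  extended initial segments of \<alpha> have the same \<omega>-value as \<alpha>, and as soon as the
  length also reaches \<omega>(\<alpha>), the segment has left the tree.

  In the other direction the summand \<Omega>(g) moves the entry that \<phi> inspects beyond the
  modulus of g. Changing this entry then does not change which entry is inspected.\<close>

instance ty :: countable by countable_datatype
instance tm :: (countable) countable by countable_datatype
instance fm :: (countable) countable by countable_datatype
instance cn :: countable by countable_datatype

lemma finite_fv_tm [simp]: "finite (fv_tm t)" by (induction t) auto
lemma finite_fv [simp]: "finite (fv A)" by (induction A) auto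

lemma infinite_vars_of_type: "infinite {v :: var. snd v = \<tau>}"
proof -
  have "(\<lambda>x. (x, \<tau>)) ` (UNIV :: string set) \<subseteq> {v. snd v = \<tau>}" by auto
  moreover have "infinite ((\<lambda>x. (x, \<tau>)) ` (UNIV :: string set))"
    by (subst finite_image_iff) (auto simp: inj_on_def infinite_UNIV_listI)
  ultimately show ?thesis using finite_subset by blast
qed

lemma fresh_var: "finite S \<Longrightarrow> \<exists>v :: var. snd v = \<tau> \<and> v \<notin> S"
  using infinite_vars_of_type[of \<tau>] by (metis (mono_tags, lifting) finite_subset mem_Collect_eq subsetI)

section \<open>Typing of terms and formulas\<close>

lemma has_ty_unique: "has_ty L \<Delta> t \<sigma> \<Longrightarrow> has_ty L \<Delta> t \<tau> \<Longrightarrow> \<sigma> = \<tau>"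
  by (induction t arbitrary: \<sigma> \<tau>) auto

lemma is_tm_unique: "is_tm L t \<sigma> \<Longrightarrow> is_tm L t \<tau> \<Longrightarrow> \<sigma> = \<tau>"
  by (auto simp: is_tm_def intro: has_ty_unique)

lemma is_tm_iff: "is_tm L t \<sigma> \<Longrightarrow> is_tm L t \<tau> \<longleftrightarrow> \<tau> = \<sigma>"
  using is_tm_unique by blast

lemma is_tm_simps [simp]:
  "is_tm L (Bd n) \<tau> = False"
  "is_tm L (Fr v) \<tau> = (snd v = \<tau> \<and> ty_in L (snd v))"
  "is_tm L (Cn c) \<tau> = (cty c = \<tau> \<and> cn_in L c)"
  "is_tm L (s \<cdot> t) \<tau> = (\<exists>\<sigma>. is_tm L s (\<sigma> \<Rrightarrow> \<tau>) \<and> is_tm L t \<sigma>)"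
  by (auto simp: is_tm_def)

lemma is_fm_simps [simp]:
  "is_fm L (s \<^bold>= t) = (is_tm L s N \<and> is_tm L t N)"
  "is_fm L FBot"
  "is_fm L (A \<^bold>\<longrightarrow> B) = (is_fm L A \<and> is_fm L B)"
  "is_fm L (A \<^bold>\<and> B) = (is_fm L A \<and> is_fm L B)"
  "is_fm L (A \<^bold>\<or> B) = (is_fm L A \<and> is_fm L B)"
  by (auto simp: is_fm_def is_tm_def)

lemma is_fm_FSt [simp]: "is_fm L (FSt t) = (L = Full \<and> (\<exists>\<tau>. is_tm L t \<tau>))"
  by (auto simp: is_fm_def is_tm_def)

lemma cn_in_simps [simp]: "cn_in L cZero" "cn_in L cSucc" "cn_in L cRec"
  "cn_in L (cK \<sigma> \<tau>) = (ty_in L \<sigma> \<and> ty_in L \<tau>)"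
  "cn_in L (cS \<rho> \<sigma> \<tau>) = (ty_in L \<rho> \<and> ty_in L \<sigma> \<and> ty_in L \<tau>)"
  "cn_in Full cOmega0" "cn_in Full cLambda0"
  by (auto intro: cn_in.intros elim: cn_in.cases)

lemma ty_in_simps [simp]: "ty_in L N" "ty_in L (\<sigma> \<Rrightarrow> \<tau>) = (ty_in L \<sigma> \<and> ty_in L \<tau>)"
  by (cases L; simp)+

lemma star_free_ty_in [simp]: "star_free \<tau> \<Longrightarrow> ty_in L \<tau>"
  by (cases L) auto

lemma ty_in_cty: "cn_in L c \<Longrightarrow> ty_in L (cty c)"
  by (cases L) (auto elim: cn_in.cases)

lemma is_tm_ty_in: "is_tm L t \<tau> \<Longrightarrow> ty_in L \<tau>"
  by (induction t arbitrary: \<tau>) (auto simp: ty_in_cty, force)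

lemma cn_in_mono: "cn_in Base c \<Longrightarrow> cn_in L c"
  by (cases L) (auto elim!: cn_in.cases)

lemma typeof_is_tm: "is_tm L t \<tau> \<Longrightarrow> typeof t = \<tau>"
  by (induction t arbitrary: \<tau>) force+

lemma is_tm_lam:
  assumes "is_tm L t \<tau>" "ty_in L (snd v)"
  shows "is_tm L (lam v t) (snd v \<Rrightarrow> \<tau>)"
  using assms
proof (induction t arbitrary: \<tau>)
  case (Ap s t)
  then obtain \<sigma> where st: "is_tm L s (\<sigma> \<Rrightarrow> \<tau>)" "is_tm L t \<sigma>" by auto
  then have "typeof s = \<sigma> \<Rrightarrow> \<tau>" "typeof t = \<sigma>" by (auto dest: typeof_is_tm)
  then show ?case
    using Ap.IH(1)[OF st(1)] Ap.IH(2)[OF st(2)] Ap.prems st is_tm_ty_in[OF st(1)]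
    by (auto simp: const_lam_def)
qed (auto simp: const_lam_def id_lam_def ty_in_cty)

lemma fv_lam [simp]: "fv_tm (lam v t) = fv_tm t - {v}"
  by (induction t) (auto simp: const_lam_def id_lam_def)

declare lam.simps [simp del]

lemma fv_closed_terms [simp]:
  "fv_tm predC = {}" "fv_tm addC = {}" "fv_tm monusC = {}" "fv_tm ifzC = {}" "fv_tm triC = {}"
  "fv_tm pairC = {}" "fv_tm rootC = {}" "fv_tm fstC = {}" "fv_tm sndC = {}" "fv_tm snocC = {}"
  "fv_tm butlastC = {}" "fv_tm lastC = {}" "fv_tm barC = {}" "fv_tm dropC = {}" "fv_tm lhC = {}"
  "fv_tm padC = {}"
proof -
  show [simp]: "fv_tm predC = {}" by (auto simp: predC_def)
  show [simp]: "fv_tm addC = {}" by (auto simp: addC_def)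
  show [simp]: "fv_tm monusC = {}" by (auto simp: monusC_def)
  show [simp]: "fv_tm ifzC = {}" by (auto simp: ifzC_def)
  show [simp]: "fv_tm triC = {}" by (auto simp: triC_def)
  show [simp]: "fv_tm pairC = {}" by (auto simp: pairC_def)
  show [simp]: "fv_tm rootC = {}" by (auto simp: rootC_def)
  show [simp]: "fv_tm fstC = {}" by (auto simp: fstC_def)
  show [simp]: "fv_tm sndC = {}" by (auto simp: sndC_def)
  show [simp]: "fv_tm snocC = {}" by (auto simp: snocC_def)
  show [simp]: "fv_tm butlastC = {}" by (auto simp: butlastC_def)
  show [simp]: "fv_tm lastC = {}" by (auto simp: lastC_def)
  show [simp]: "fv_tm barC = {}" by (auto simp: barC_def)
  show [simp]: "fv_tm dropC = {}" by (auto simp: dropC_def)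
  show [simp]: "fv_tm lhC = {}" by (auto simp: lhC_def)
  show "fv_tm padC = {}" by (auto simp: padC_def)
qed

lemma is_tm_closed_terms:
  "is_tm L predC (N \<Rrightarrow> N)" "is_tm L addC (N \<Rrightarrow> N \<Rrightarrow> N)" "is_tm L monusC (N \<Rrightarrow> N \<Rrightarrow> N)"
  "is_tm L ifzC (N \<Rrightarrow> N \<Rrightarrow> N \<Rrightarrow> N)" "is_tm L triC (N \<Rrightarrow> N)" "is_tm L pairC (N \<Rrightarrow> N \<Rrightarrow> N)"
  "is_tm L rootC (N \<Rrightarrow> N)" "is_tm L fstC (N \<Rrightarrow> N)" "is_tm L sndC (N \<Rrightarrow> N)"
  "is_tm L snocC (N \<Rrightarrow> N \<Rrightarrow> N)" "is_tm L butlastC (N \<Rrightarrow> N)" "is_tm L lastC (N \<Rrightarrow> N)"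
  "is_tm L barC (T1 \<Rrightarrow> N \<Rrightarrow> N)" "is_tm L dropC (N \<Rrightarrow> N \<Rrightarrow> N)" "is_tm L lhC (N \<Rrightarrow> N)"
  "is_tm L padC (N \<Rrightarrow> N \<Rrightarrow> N)"
proof -
  have lamI: "is_tm L t \<tau> \<Longrightarrow> ty_in L \<sigma> \<Longrightarrow> is_tm L (lam (x, \<sigma>) t) (\<sigma> \<Rrightarrow> \<tau>)" for t \<tau> x \<sigma>
    using is_tm_lam[of L t \<tau> "(x, \<sigma>)"] by simp
  have apI: "is_tm L s (\<sigma> \<Rrightarrow> \<tau>) \<Longrightarrow> is_tm L t \<sigma> \<Longrightarrow> is_tm L (s \<cdot> t) \<tau>" for s t \<sigma> \<tau> by auto
  have [intro]: "is_tm L zero N" "is_tm L (Cn cSucc) (N \<Rrightarrow> N)"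
    "is_tm L (Cn cRec) (N \<Rrightarrow> N \<Rrightarrow> (N \<Rrightarrow> N \<Rrightarrow> N) \<Rrightarrow> N)" by simp_all
  have frI: "is_tm L (Fr (x, N)) N" "is_tm L (Fr (x, T1)) T1" for x by simp_all
  note [intro] = lamI apI frI ty_in_simps(1)
  show [intro]: "is_tm L predC (N \<Rrightarrow> N)" unfolding predC_def by (intro lamI ty_in_simps(1)) blast
  show [intro]: "is_tm L addC (N \<Rrightarrow> N \<Rrightarrow> N)" unfolding addC_def by (intro lamI ty_in_simps(1)) blast
  show [intro]: "is_tm L monusC (N \<Rrightarrow> N \<Rrightarrow> N)" unfolding monusC_def by (intro lamI ty_in_simps(1)) blast
  show [intro]: "is_tm L ifzC (N \<Rrightarrow> N \<Rrightarrow> N \<Rrightarrow> N)" unfolding ifzC_def by (intro lamI ty_in_simps(1)) blast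
  show [intro]: "is_tm L triC (N \<Rrightarrow> N)" unfolding triC_def by (intro lamI ty_in_simps(1)) blast
  show [intro]: "is_tm L pairC (N \<Rrightarrow> N \<Rrightarrow> N)" unfolding pairC_def by (intro lamI ty_in_simps(1)) blast
  show [intro]: "is_tm L rootC (N \<Rrightarrow> N)" unfolding rootC_def by (intro lamI ty_in_simps(1)) blast
  show [intro]: "is_tm L fstC (N \<Rrightarrow> N)" unfolding fstC_def by (intro lamI ty_in_simps(1)) blast
  show [intro]: "is_tm L sndC (N \<Rrightarrow> N)" unfolding sndC_def by (intro lamI ty_in_simps(1)) blast
  show [intro]: "is_tm L snocC (N \<Rrightarrow> N \<Rrightarrow> N)" unfolding snocC_def by (intro lamI ty_in_simps(1)) blast
  show [intro]: "is_tm L butlastC (N \<Rrightarrow> N)" unfolding butlastC_def by (intro lamI ty_in_simps(1)) blast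
  show [intro]: "is_tm L lastC (N \<Rrightarrow> N)" unfolding lastC_def by (intro lamI ty_in_simps(1)) blast
  show "is_tm L barC (T1 \<Rrightarrow> N \<Rrightarrow> N)" unfolding barC_def
    by (intro lamI ty_in_simps(1)) (blast, simp)
  show [intro]: "is_tm L dropC (N \<Rrightarrow> N \<Rrightarrow> N)" unfolding dropC_def by (intro lamI ty_in_simps(1)) blast
  show [intro]: "is_tm L lhC (N \<Rrightarrow> N)" unfolding lhC_def by (intro lamI ty_in_simps(1)) blast
  show "is_tm L padC (N \<Rrightarrow> N \<Rrightarrow> N)" unfolding padC_def by (intro lamI ty_in_simps(1)) blast
qed

lemmas is_tm_closed_terms_iff [simp] = is_tm_closed_terms[THEN is_tm_iff]

lemma is_fm_Le [simp]: "is_fm L (s \<^bold>\<le> t) = (is_tm L s N \<and> is_tm L t N)"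
  by (auto simp: Le_def)

lemma opn_tm_lc: "has_ty L \<Delta> t \<tau> \<Longrightarrow> length \<Delta> \<le> k \<Longrightarrow> opn_tm k u t = t"
  by (induction t arbitrary: \<tau>) auto

lemma is_tm_opn: "is_tm L t \<tau> \<Longrightarrow> opn_tm k u t = t"
  by (auto simp: is_tm_def intro: opn_tm_lc)

lemma opn_closed_terms [simp]: "opn_tm k u predC = predC" "opn_tm k u monusC = monusC"
  by (rule is_tm_opn[OF is_tm_closed_terms(1)] is_tm_opn[OF is_tm_closed_terms(3)])+

lemma opn_Le [simp]: "opn k u (s \<^bold>\<le> t) = (opn_tm k u s \<^bold>\<le> opn_tm k u t)"
  by (simp add: Le_def)

lemma has_ty_append: "has_ty L \<Delta> t \<tau> \<Longrightarrow> has_ty L (\<Delta> @ \<Delta>') t \<tau>"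
  by (induction t arbitrary: \<tau>) (auto simp: nth_append)

lemma has_ty_closed: "has_ty L [] t \<tau> \<Longrightarrow> has_ty L \<Delta> t \<tau>"
  using has_ty_append[of L "[]"] by fastforce

lemma has_ty_opn:
  "has_ty L (\<Delta> @ [\<sigma>]) t \<tau> \<Longrightarrow> has_ty L [] u \<sigma> \<Longrightarrow> has_ty L \<Delta> (opn_tm (length \<Delta>) u t) \<tau>"
  by (induction t arbitrary: \<tau>) (auto simp: nth_append has_ty_closed split: if_splits)

lemma wff_opn: "wff L (\<Delta> @ [\<sigma>]) A \<Longrightarrow> has_ty L [] u \<sigma> \<Longrightarrow> wff L \<Delta> (opn (length \<Delta>) u A)"
proof (induction A arbitrary: \<Delta>)
  case (FAll \<tau> A)
  then show ?case using FAll.IH[of "\<tau> # \<Delta>"] by simp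
next
  case (FEx \<tau> A)
  then show ?case using FEx.IH[of "\<tau> # \<Delta>"] by simp
next
  case (FBAll t A)
  then show ?case using FBAll.IH[of "N # \<Delta>"] by (auto intro: has_ty_opn)
next
  case (FBEx t A)
  then show ?case using FBEx.IH[of "N # \<Delta>"] by (auto intro: has_ty_opn)
next
  case (FSt t)
  then show ?case by (auto intro: has_ty_opn)
qed (auto simp: has_ty_opn)

lemma set_tm_opn: "set_tm (opn_tm k u t) \<subseteq> set_tm t \<union> set_tm u"
  by (induction t) auto

lemma set_fm_opn: "set_fm (opn k u A) \<subseteq> set_fm A \<union> set_tm u"
  by (induction A arbitrary: k) (use set_tm_opn in fastforce)+

lemma is_fm_FAll: "is_fm L (FAll \<tau> A) \<longleftrightarrow> ty_in L \<tau> \<and> wff L [\<tau>] A \<and> (\<forall>c\<in>set_fm A. cn_in L c)"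
  by (auto simp: is_fm_def)
lemma is_fm_FEx: "is_fm L (FEx \<tau> A) \<longleftrightarrow> is_fm L (FAll \<tau> A)"
  by (auto simp: is_fm_def)
lemma is_fm_FBAll: "is_fm L (FBAll t A) \<longleftrightarrow> is_tm L t N \<and> is_fm L (FAll N A)"
  by (auto simp: is_fm_def is_tm_def)
lemma is_fm_FBEx: "is_fm L (FBEx t A) \<longleftrightarrow> is_tm L t N \<and> is_fm L (FAll N A)"
  by (auto simp: is_fm_def is_tm_def)

lemma is_fm_opn: "is_fm L (FAll \<tau> A) \<Longrightarrow> is_tm L t \<tau> \<Longrightarrow> is_fm L (opn 0 t A)"
  using wff_opn[of L "[]" \<tau> A t] set_fm_opn[of 0 t A] by (auto simp: is_fm_FAll is_tm_def is_fm_def)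

lemma wff_Le_Bd0: "is_tm L t N \<Longrightarrow> wff L [N] (Bd 0 \<^bold>\<le> t)"
  using is_tm_closed_terms(3)[of L]
  by (auto simp: Le_def is_tm_def has_ty_closed intro!: exI[of _ N])

lemma set_fm_Le: "set_fm (s \<^bold>\<le> t) = set_tm monusC \<union> set_tm s \<union> set_tm t \<union> {cZero}"
  by (auto simp: Le_def)

lemma is_fm_FAll_Le:
  "is_fm L (FBAll t A) \<Longrightarrow> is_fm L (FAll N (Bd 0 \<^bold>\<le> t \<^bold>\<longrightarrow> A))"
  "is_fm L (FBEx t A) \<Longrightarrow> is_fm L (FEx N (Bd 0 \<^bold>\<le> t \<^bold>\<and> A))"
proof -
  have "\<forall>c\<in>set_tm monusC. cn_in L c"
    using is_tm_closed_terms(3)[of L] by (simp add: is_tm_def)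
  then show "is_fm L (FBAll t A) \<Longrightarrow> is_fm L (FAll N (Bd 0 \<^bold>\<le> t \<^bold>\<longrightarrow> A))"
    "is_fm L (FBEx t A) \<Longrightarrow> is_fm L (FEx N (Bd 0 \<^bold>\<le> t \<^bold>\<and> A))"
    by (auto simp: is_fm_FBAll is_fm_FBEx is_fm_FEx is_fm_FAll wff_Le_Bd0 set_fm_Le)
       (auto simp: is_tm_def)
qed

subsection \<open>Parallel substitution\<close>

primrec psub_tm :: "(var \<Rightarrow> 'c tm) \<Rightarrow> 'c tm \<Rightarrow> 'c tm" where
  "psub_tm e (Bd n) = Bd n"
| "psub_tm e (Fr v) = e v"
| "psub_tm e (Cn c) = Cn c"
| "psub_tm e (s \<cdot> t) = psub_tm e s \<cdot> psub_tm e t"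

primrec psub :: "(var \<Rightarrow> 'c tm) \<Rightarrow> 'c fm \<Rightarrow> 'c fm" where
  "psub e (s \<^bold>= t) = (psub_tm e s \<^bold>= psub_tm e t)"
| "psub e (FSt t) = FSt (psub_tm e t)"
| "psub e FBot = FBot"
| "psub e (A \<^bold>\<longrightarrow> B) = (psub e A \<^bold>\<longrightarrow> psub e B)"
| "psub e (A \<^bold>\<and> B) = (psub e A \<^bold>\<and> psub e B)"
| "psub e (A \<^bold>\<or> B) = (psub e A \<^bold>\<or> psub e B)"
| "psub e (FAll \<tau> A) = FAll \<tau> (psub e A)"
| "psub e (FEx \<tau> A) = FEx \<tau> (psub e A)"
| "psub e (FBAll t A) = FBAll (psub_tm e t) (psub e A)"
| "psub e (FBEx t A) = FBEx (psub_tm e t) (psub e A)"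

lemma psub_tm_Fr [simp]: "psub_tm Fr t = t" by (induction t) auto
lemma psub_Fr [simp]: "psub Fr A = A" by (induction A) auto

lemma psub_tm_cong: "(\<And>v. v \<in> fv_tm t \<Longrightarrow> e v = e' v) \<Longrightarrow> psub_tm e t = psub_tm e' t"
  by (induction t) auto
lemma psub_cong: "(\<And>v. v \<in> fv A \<Longrightarrow> e v = e' v) \<Longrightarrow> psub e A = psub e' A"
  by (induction A) (auto intro: psub_tm_cong)

lemma psub_tm_closed: "fv_tm t = {} \<Longrightarrow> psub_tm e t = t"
  using psub_tm_cong[of t e Fr] by simp
lemma psub_closed: "fv A = {} \<Longrightarrow> psub e A = A"
  using psub_cong[of A e Fr] by simp

lemma psub_Le [simp]: "psub e (s \<^bold>\<le> t) = (psub_tm e s \<^bold>\<le> psub_tm e t)"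
  by (simp add: Le_def psub_tm_closed)

text \<open>Only variables whose type belongs to the language are constrained. These substitutions
  are also the environments of the term structure, where evaluation is substitution.\<close>

definition env :: "lang \<Rightarrow> (var \<Rightarrow> cn tm) \<Rightarrow> bool" where
  "env L e \<longleftrightarrow> (\<forall>v. ty_in L (snd v) \<longrightarrow> is_tm L (e v) (snd v))"

lemma env_upd: "env L e \<Longrightarrow> is_tm L t (snd v) \<Longrightarrow> env L (e(v := t))"
  by (cases v) (auto simp: env_def)

lemma has_ty_psub: "has_ty L \<Delta> t \<tau> \<Longrightarrow> env L e \<Longrightarrow> has_ty L \<Delta> (psub_tm e t) \<tau>"
proof (induction t arbitrary: \<tau>)
  case (Fr v)
  then have "is_tm L (e v) \<tau>" unfolding env_def by (metis has_ty.simps(2))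
  then show ?case by (simp add: is_tm_def has_ty_closed)
qed auto

lemma wff_psub: "wff L \<Delta> A \<Longrightarrow> env L e \<Longrightarrow> wff L \<Delta> (psub e A)"
  by (induction A arbitrary: \<Delta>) (auto simp: has_ty_psub intro: has_ty_psub)

lemma set_tm_psub: "has_ty L \<Delta> t \<tau> \<Longrightarrow> env L e \<Longrightarrow> \<forall>c\<in>set_tm t. cn_in L c \<Longrightarrow>
    \<forall>c\<in>set_tm (psub_tm e t). cn_in L c"
  by (induction t arbitrary: \<tau>) (auto simp: env_def is_tm_def)

lemma set_fm_psub: "wff L \<Delta> A \<Longrightarrow> env L e \<Longrightarrow> \<forall>c\<in>set_fm A. cn_in L c \<Longrightarrow>
    \<forall>c\<in>set_fm (psub e A). cn_in L c"
proof (induction A arbitrary: \<Delta>)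
  case (FEq s t)
  then show ?case using set_tm_psub[of L \<Delta> s N e] set_tm_psub[of L \<Delta> t N e] by auto
next
  case (FSt t)
  then show ?case using set_tm_psub[of L \<Delta> t _ e] by auto
next
  case (FBAll t A)
  then show ?case using set_tm_psub[of L \<Delta> t N e] by auto
next
  case (FBEx t A)
  then show ?case using set_tm_psub[of L \<Delta> t N e] by auto
qed auto

lemma is_tm_psub: "is_tm L t \<tau> \<Longrightarrow> env L e \<Longrightarrow> is_tm L (psub_tm e t) \<tau>"
  unfolding is_tm_def using has_ty_psub set_tm_psub by blast

lemma is_fm_psub: "is_fm L A \<Longrightarrow> env L e \<Longrightarrow> is_fm L (psub e A)"
  unfolding is_fm_def using wff_psub set_fm_psub by blast

lemma has_ty_fv: "has_ty L \<Delta> t \<tau> \<Longrightarrow> v \<in> fv_tm t \<Longrightarrow> ty_in L (snd v)"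
  by (induction t arbitrary: \<tau>) auto
lemma wff_fv: "wff L \<Delta> A \<Longrightarrow> v \<in> fv A \<Longrightarrow> ty_in L (snd v)"
  by (induction A arbitrary: \<Delta>) (auto dest: has_ty_fv)
lemma is_fm_fv: "is_fm L A \<Longrightarrow> v \<in> fv A \<Longrightarrow> ty_in L (snd v)"
  unfolding is_fm_def using wff_fv by blast

text \<open>The terms put in must have no dangling indices, otherwise opening would act inside them
  as well.\<close>

lemma psub_opn_tm: "(\<And>v k u. v \<in> fv_tm t \<Longrightarrow> opn_tm k u (e v) = e v) \<Longrightarrow>
    psub_tm e (opn_tm k u t) = opn_tm k (psub_tm e u) (psub_tm e t)"
  by (induction t) auto

lemma psub_opn: "(\<And>v k u. v \<in> fv A \<Longrightarrow> opn_tm k u (e v) = e v) \<Longrightarrow>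
    psub e (opn k u A) = opn k (psub_tm e u) (psub e A)"
  by (induction A arbitrary: k) (auto simp: psub_opn_tm)

section \<open>Henkin sets\<close>

text \<open>Weakening fails for \<open>deriv L X\<close> when the axioms in \<open>X\<close> have free variables: they cannot be
  generalized in a context in which these variables are free. It holds for \<open>X = {}\<close>, and the
  universal closures of the axioms can be used as hypotheses there.\<close>

lemma deriv_rename:
  assumes "deriv L {} \<Gamma> A"
  shows "finite \<Delta> \<Longrightarrow> (\<And>v. snd (\<rho> v) = snd v) \<Longrightarrow> psub (\<lambda>v. Fr (\<rho> v)) ` \<Gamma> \<subseteq> \<Delta> \<Longrightarrow>
    deriv L {} \<Delta> (psub (\<lambda>v. Fr (\<rho> v)) A)"
  using assms
proof (induction arbitrary: \<Delta> \<rho> rule: deriv.induct)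
  case (Hyp A \<Gamma>)
  have "env L (\<lambda>v. Fr (\<rho> v))" by (simp add: env_def Hyp.prems)
  with Hyp show ?case by (auto intro!: deriv.Hyp is_fm_psub)
next
  case (Raa A \<Gamma>)
  have e: "env L (\<lambda>v. Fr (\<rho> v))" by (simp add: env_def Raa.prems)
  from Raa.IH[of "insert (\<^bold>\<not> psub (\<lambda>v. Fr (\<rho> v)) A) \<Delta>" \<rho>] Raa.prems
  have "deriv L {} (insert (\<^bold>\<not> psub (\<lambda>v. Fr (\<rho> v)) A) \<Delta>) FBot" by auto
  then show ?case using is_fm_psub[OF Raa.hyps(1) e] by (rule deriv.Raa[rotated])
next
  case (ImpI A \<Gamma> B)
  have e: "env L (\<lambda>v. Fr (\<rho> v))" by (simp add: env_def ImpI.prems)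
  from ImpI.IH[of "insert (psub (\<lambda>v. Fr (\<rho> v)) A) \<Delta>" \<rho>] ImpI.prems
  have "deriv L {} (insert (psub (\<lambda>v. Fr (\<rho> v)) A) \<Delta>) (psub (\<lambda>v. Fr (\<rho> v)) B)" by auto
  then show ?case using is_fm_psub[OF ImpI.hyps(1) e] by (auto intro: deriv.ImpI)
next
  case (ImpE \<Gamma> A B)
  then show ?case by (metis deriv.ImpE psub.simps(4))
next
  case (AndI \<Gamma> A B)
  then show ?case by (simp add: deriv.AndI)
next
  case (AndE1 \<Gamma> A B)
  then show ?case by (metis deriv.AndE1 psub.simps(5))
next
  case (AndE2 \<Gamma> A B)
  then show ?case by (metis deriv.AndE2 psub.simps(5))
next
  case (OrI1 \<Gamma> A B)
  have "env L (\<lambda>v. Fr (\<rho> v))" by (simp add: env_def OrI1.prems)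
  with OrI1 show ?case by (simp add: deriv.OrI1 is_fm_psub)
next
  case (OrI2 \<Gamma> B A)
  have "env L (\<lambda>v. Fr (\<rho> v))" by (simp add: env_def OrI2.prems)
  with OrI2 show ?case by (simp add: deriv.OrI2 is_fm_psub)
next
  case (OrE \<Gamma> A B C)
  let ?s = "psub (\<lambda>v. Fr (\<rho> v))"
  have "deriv L {} \<Delta> (?s A \<^bold>\<or> ?s B)" using OrE.IH(1)[OF OrE.prems] by simp
  moreover have "deriv L {} (insert (?s A) \<Delta>) (?s C)" "deriv L {} (insert (?s B) \<Delta>) (?s C)"
    using OrE.IH(2)[of "insert (?s A) \<Delta>" \<rho>] OrE.IH(3)[of "insert (?s B) \<Delta>" \<rho>] OrE.prems by auto
  ultimately show ?case by (rule deriv.OrE)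
next
  case (AllI \<Gamma> v A)
  let ?s = "psub (\<lambda>v. Fr (\<rho> v))"
  \<comment> \<open>The eigenvariable may occur in the enlarged context, so it is sent to a variable
    fresh for that context. The induction hypothesis covers all renamings, in particular this
    modified one. A fresh variable exists because the context is finite.\<close>
  have "finite (fv (?s A) \<union> \<Union> (fv ` \<Delta>))" using AllI.prems(1) by simp
  then obtain w where w: "snd w = snd v" "w \<notin> fv (?s A)" "\<And>C. C \<in> \<Delta> \<Longrightarrow> w \<notin> fv C"
    using fresh_var[of "fv (?s A) \<union> \<Union> (fv ` \<Delta>)" "snd v"] by auto
  let ?r = "\<rho>(v := w)" let ?s' = "psub (\<lambda>v. Fr (?r v))"
  have eq: "?s' C = ?s C" if "v \<notin> fv C" for C
    by (rule psub_cong) (use that in auto)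
  have "?s' ` \<Gamma> = ?s ` \<Gamma>" by (rule image_cong) (use AllI.hyps(4) eq in auto)
  then have "deriv L {} \<Delta> (?s' (opn 0 (Fr v) A))"
    by (intro AllI.IH) (use AllI.prems w in auto)
  then have "deriv L {} \<Delta> (opn 0 (Fr w) (?s A))"
    using eq[OF AllI.hyps(3)] by (simp add: psub_opn)
  then have "deriv L {} \<Delta> (FAll (snd w) (?s A))"
    by (rule deriv.AllI) (use w AllI.hyps in auto)
  then show ?case by (simp add: w)
next
  case (AllE \<Gamma> \<tau> A t)
  have e: "env L (\<lambda>v. Fr (\<rho> v))" by (simp add: env_def AllE.prems)
  from AllE.IH[OF AllE.prems] is_tm_psub[OF AllE.hyps(2) e]
  show ?case by (simp add: psub_opn deriv.AllE)
next
  case (ExI \<tau> A t \<Gamma>)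
  have e: "env L (\<lambda>v. Fr (\<rho> v))" by (simp add: env_def ExI.prems)
  from ExI.IH[OF ExI.prems] is_tm_psub[OF ExI.hyps(2) e] is_fm_psub[OF ExI.hyps(1) e]
  show ?case by (simp add: psub_opn deriv.ExI)
next
  case (ExE \<Gamma> v A B)
  let ?s = "psub (\<lambda>v. Fr (\<rho> v))"
  let ?S = "fv (?s A) \<union> fv (?s B) \<union> \<Union> (fv ` \<Delta>)"
  have "finite ?S" using ExE.prems(1) by simp
  then obtain w where w: "snd w = snd v" "w \<notin> fv (?s A)" "w \<notin> fv (?s B)" "\<And>C. C \<in> \<Delta> \<Longrightarrow> w \<notin> fv C"
    using fresh_var[of ?S "snd v"] by auto
  let ?r = "\<rho>(v := w)" let ?s' = "psub (\<lambda>v. Fr (?r v))"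
  have eq: "?s' C = ?s C" if "v \<notin> fv C" for C
    by (rule psub_cong) (use that in auto)
  have "deriv L {} (insert (opn 0 (Fr w) (?s A)) \<Delta>) (?s' B)"
  proof (rule ExE.IH(2))
    show "finite (insert (opn 0 (Fr w) (?s A)) \<Delta>)" using ExE.prems by simp
    have "?s' ` \<Gamma> = ?s ` \<Gamma>" by (rule image_cong) (use ExE.hyps(5) eq in auto)
    moreover have "?s' (opn 0 (Fr v) A) = opn 0 (Fr w) (?s A)"
      using eq[OF ExE.hyps(3)] by (simp add: psub_opn)
    ultimately show "?s' ` insert (opn 0 (Fr v) A) \<Gamma> \<subseteq> insert (opn 0 (Fr w) (?s A)) \<Delta>"
      using ExE.prems(3) by auto
  qed (use ExE.prems w in auto)
  then have 2: "deriv L {} (insert (opn 0 (Fr w) (?s A)) \<Delta>) (?s B)"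
    using eq[OF ExE.hyps(4)] by simp
  have 1: "deriv L {} \<Delta> (FEx (snd w) (?s A))"
    using ExE.IH(1)[OF ExE.prems] by (simp add: w)
  show ?case by (rule deriv.ExE[OF 1 2]) (use w in auto)
next
  case (BAllI t A \<Gamma>)
  have e: "env L (\<lambda>v. Fr (\<rho> v))" by (simp add: env_def BAllI.prems)
  from BAllI.IH[OF BAllI.prems] is_fm_psub[OF BAllI.hyps(1) e]
  show ?case by (simp add: deriv.BAllI)
next
  case (BAllE \<Gamma> t A)
  from BAllE.IH[OF BAllE.prems] show ?case by (simp add: deriv.BAllE)
next
  case (BExI t A \<Gamma>)
  have e: "env L (\<lambda>v. Fr (\<rho> v))" by (simp add: env_def BExI.prems)
  from BExI.IH[OF BExI.prems] is_fm_psub[OF BExI.hyps(1) e]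
  show ?case by (simp add: deriv.BExI)
next
  case (BExE \<Gamma> t A)
  from BExE.IH[OF BExE.prems] show ?case by (simp add: deriv.BExE)
qed simp

lemma deriv_weaken: "deriv L {} \<Gamma> A \<Longrightarrow> finite \<Delta> \<Longrightarrow> \<Gamma> \<subseteq> \<Delta> \<Longrightarrow> deriv L {} \<Delta> A"
  using deriv_rename[of L \<Gamma> A \<Delta> "\<lambda>v. v"] by simp

lemma deriv_mono_axioms:
  assumes "deriv L X \<Gamma> A" "X \<subseteq> Y"
  shows "deriv L Y \<Gamma> A"
  using assms(1)
proof (induction rule: deriv.induct)
  case (Axm A \<Gamma>)
  then show ?case using assms(2) by (intro deriv.Axm) auto
next
  case Hyp
  show ?case by (rule deriv.Hyp) (fact Hyp)+
next
  case Raa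
  show ?case by (rule deriv.Raa) (fact Raa)+
next
  case ImpI
  show ?case by (rule deriv.ImpI) (fact ImpI)+
next
  case ImpE
  show ?case by (rule deriv.ImpE) (fact ImpE)+
next
  case AndI
  show ?case by (rule deriv.AndI) (fact AndI)+
next
  case AndE1
  show ?case by (rule deriv.AndE1) (fact AndE1)+
next
  case AndE2
  show ?case by (rule deriv.AndE2) (fact AndE2)+
next
  case OrI1
  show ?case by (rule deriv.OrI1) (fact OrI1)+
next
  case OrI2
  show ?case by (rule deriv.OrI2) (fact OrI2)+
next
  case OrE
  show ?case by (rule deriv.OrE) (fact OrE)+
next
  case AllI
  show ?case by (rule deriv.AllI) (fact AllI)+
next
  case AllE
  show ?case by (rule deriv.AllE) (fact AllE)+
next
  case ExI
  show ?case by (rule deriv.ExI) (fact ExI)+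
next
  case ExE
  show ?case by (rule deriv.ExE) (fact ExE)+
next
  case BAllI
  show ?case by (rule deriv.BAllI) (fact BAllI)+
next
  case BAllE
  show ?case by (rule deriv.BAllE) (fact BAllE)+
next
  case BExI
  show ?case by (rule deriv.BExI) (fact BExI)+
next
  case BExE
  show ?case by (rule deriv.BExE) (fact BExE)+
qed

text \<open>Weakening leads only into finite contexts, since an eigenvariable can be renamed away
  from finitely many formulas. Derivability from an infinite set therefore goes through its finite
  subsets.\<close>

definition fin_deriv :: "lang \<Rightarrow> cn fm set \<Rightarrow> cn fm \<Rightarrow> bool" where
  "fin_deriv L H A \<longleftrightarrow> (\<exists>F. finite F \<and> F \<subseteq> H \<and> deriv L {} F A)"

lemma fin_deriv_mono: "fin_deriv L H A \<Longrightarrow> H \<subseteq> K \<Longrightarrow> fin_deriv L K A"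
  unfolding fin_deriv_def by blast

lemma fin_deriv_hyp: "A \<in> H \<Longrightarrow> is_fm L A \<Longrightarrow> fin_deriv L H A"
  unfolding fin_deriv_def by (intro exI[of _ "{A}"]) (auto intro: deriv.Hyp)

lemma fin_deriv_rule1:
  assumes "fin_deriv L H A" "\<And>F. deriv L {} F A \<Longrightarrow> deriv L {} F B"
  shows "fin_deriv L H B"
  using assms unfolding fin_deriv_def by blast

lemma fin_deriv_rule2:
  assumes "fin_deriv L H A" "fin_deriv L H B"
    "\<And>F. deriv L {} F A \<Longrightarrow> deriv L {} F B \<Longrightarrow> deriv L {} F C"
  shows "fin_deriv L H C"
proof -
  from assms obtain F G where "finite F" "F \<subseteq> H" "deriv L {} F A" "finite G" "G \<subseteq> H" "deriv L {} G B"
    unfolding fin_deriv_def by blast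
  moreover from this have "deriv L {} (F \<union> G) A" "deriv L {} (F \<union> G) B"
    using deriv_weaken[of L F A "F \<union> G"] deriv_weaken[of L G B "F \<union> G"] by auto
  ultimately show ?thesis using assms(3) unfolding fin_deriv_def by (intro exI[of _ "F \<union> G"]) auto
qed

text \<open>Puts A into the context even where the given finite subset lacks it, so that
  \<open>ImpI\<close> and \<open>Raa\<close> can discharge it.\<close>

lemma fin_deriv_insertD:
  assumes "fin_deriv L (insert A H) B"
  obtains F where "finite F" "F \<subseteq> H" "deriv L {} (insert A F) B"
proof -
  from assms obtain F where F: "finite F" "F \<subseteq> insert A H" "deriv L {} F B"
    unfolding fin_deriv_def by blast
  have "deriv L {} (insert A (F - {A})) B" by (rule deriv_weaken[of L F B]) (use F in auto)
  with F show ?thesis by (intro that[of "F - {A}"]) auto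
qed

lemma fin_deriv_imp: "fin_deriv L (insert A H) B \<Longrightarrow> is_fm L A \<Longrightarrow> fin_deriv L H (A \<^bold>\<longrightarrow> B)"
  by (erule fin_deriv_insertD) (unfold fin_deriv_def, blast intro: deriv.ImpI)

lemma fin_deriv_mp: "fin_deriv L H (A \<^bold>\<longrightarrow> B) \<Longrightarrow> fin_deriv L H A \<Longrightarrow> fin_deriv L H B"
  by (rule fin_deriv_rule2[of L H "A \<^bold>\<longrightarrow> B" A]) (assumption | rule deriv.ImpE)+

lemma fin_deriv_raa: "fin_deriv L (insert (\<^bold>\<not> A) H) FBot \<Longrightarrow> is_fm L A \<Longrightarrow> fin_deriv L H A"
  by (erule fin_deriv_insertD) (unfold fin_deriv_def, blast intro: deriv.Raa)

lemma fin_deriv_exfalso: "fin_deriv L H FBot \<Longrightarrow> is_fm L A \<Longrightarrow> fin_deriv L H A"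
  by (rule fin_deriv_raa) (auto elim!: fin_deriv_mono)

text \<open>Consistency, maximality and witnesses. The witnesses are free variables of the language
  itself, so no constants have to be added.\<close>

definition henkin :: "lang \<Rightarrow> cn fm set \<Rightarrow> bool" where
  "henkin L H \<longleftrightarrow> (\<forall>A\<in>H. is_fm L A) \<and> \<not> fin_deriv L H FBot \<and>
    (\<forall>A. is_fm L A \<longrightarrow> A \<in> H \<or> fin_deriv L (insert A H) FBot) \<and>
    (\<forall>\<tau> A. FEx \<tau> A \<in> H \<longrightarrow> (\<exists>v. snd v = \<tau> \<and> opn 0 (Fr v) A \<in> H))"

context
  fixes L H
  assumes H: "henkin L H"
begin

lemma henkin_is_fm: "A \<in> H \<Longrightarrow> is_fm L A" using H by (auto simp: henkin_def)

lemma henkin_closed: "fin_deriv L H A \<Longrightarrow> is_fm L A \<Longrightarrow> A \<in> H"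
  using H fin_deriv_imp[of L A H FBot] fin_deriv_mp[of L H A FBot] unfolding henkin_def by blast

lemma henkin_hyp: "A \<in> H \<Longrightarrow> fin_deriv L H A"
  by (auto intro: fin_deriv_hyp henkin_is_fm)

lemma henkin_bot: "FBot \<notin> H"
  using H henkin_hyp by (auto simp: henkin_def)

lemma henkin_neg: "is_fm L A \<Longrightarrow> A \<notin> H \<Longrightarrow> (\<^bold>\<not> A) \<in> H"
  using H by (intro henkin_closed) (auto simp: henkin_def intro: fin_deriv_imp)

lemma henkin_imp: "is_fm L (A \<^bold>\<longrightarrow> B) \<Longrightarrow> (A \<^bold>\<longrightarrow> B) \<in> H \<longleftrightarrow> (A \<in> H \<longrightarrow> B \<in> H)"
proof (intro iffI impI)
  assume "is_fm L (A \<^bold>\<longrightarrow> B)" "(A \<^bold>\<longrightarrow> B) \<in> H" "A \<in> H"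
  then show "B \<in> H" using fin_deriv_mp[OF henkin_hyp henkin_hyp, of A B] by (simp add: henkin_closed)
next
  assume fm: "is_fm L (A \<^bold>\<longrightarrow> B)" and imp: "A \<in> H \<longrightarrow> B \<in> H"
  have "fin_deriv L (insert A H) B"
  proof (cases "A \<in> H")
    case True
    then show ?thesis by (intro fin_deriv_mono[OF henkin_hyp]) (use imp in auto)
  next
    case False
    then have neg: "(\<^bold>\<not> A) \<in> H" using fm henkin_neg by simp
    have "fin_deriv L (insert A H) FBot"
      by (rule fin_deriv_mp[of L _ A, OF fin_deriv_hyp fin_deriv_hyp]) (use fm neg in auto)
    then show ?thesis by (rule fin_deriv_exfalso) (use fm in auto)
  qed
  then have "fin_deriv L H (A \<^bold>\<longrightarrow> B)" by (rule fin_deriv_imp) (use fm in simp)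
  then show "(A \<^bold>\<longrightarrow> B) \<in> H" using fm by (rule henkin_closed)
qed

lemma henkin_and: "is_fm L (A \<^bold>\<and> B) \<Longrightarrow> (A \<^bold>\<and> B) \<in> H \<longleftrightarrow> A \<in> H \<and> B \<in> H"
proof (intro iffI conjI)
  assume fm: "is_fm L (A \<^bold>\<and> B)" and "(A \<^bold>\<and> B) \<in> H"
  then have *: "fin_deriv L H (A \<^bold>\<and> B)" by (intro henkin_hyp)
  have "fin_deriv L H A" by (rule fin_deriv_rule1[OF *]) (rule deriv.AndE1)
  then show "A \<in> H" using fm by (intro henkin_closed) simp_all
  have "fin_deriv L H B" by (rule fin_deriv_rule1[OF *]) (rule deriv.AndE2)
  then show "B \<in> H" using fm by (intro henkin_closed) simp_all
next
  assume fm: "is_fm L (A \<^bold>\<and> B)" and "A \<in> H \<and> B \<in> H"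
  then have "fin_deriv L H A" "fin_deriv L H B" by (auto intro: henkin_hyp)
  then have "fin_deriv L H (A \<^bold>\<and> B)" by (rule fin_deriv_rule2) (rule deriv.AndI)
  then show "(A \<^bold>\<and> B) \<in> H" using fm by (rule henkin_closed)
qed

lemma henkin_or: "is_fm L (A \<^bold>\<or> B) \<Longrightarrow> (A \<^bold>\<or> B) \<in> H \<longleftrightarrow> A \<in> H \<or> B \<in> H"
proof
  assume fm: "is_fm L (A \<^bold>\<or> B)" and "A \<in> H \<or> B \<in> H"
  then have "fin_deriv L H A \<or> fin_deriv L H B" by (auto intro: henkin_hyp)
  then have "fin_deriv L H (A \<^bold>\<or> B)" using fm
    unfolding fin_deriv_def is_fm_simps by (blast intro: deriv.OrI1 deriv.OrI2)
  then show "(A \<^bold>\<or> B) \<in> H" using fm by (rule henkin_closed)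
next
  assume fm: "is_fm L (A \<^bold>\<or> B)" and or: "(A \<^bold>\<or> B) \<in> H"
  show "A \<in> H \<or> B \<in> H"
  proof (rule ccontr)
    assume "\<not> (A \<in> H \<or> B \<in> H)"
    then have neg: "(\<^bold>\<not> A) \<in> H" "(\<^bold>\<not> B) \<in> H" using fm by (auto intro: henkin_neg)
    let ?F = "{A \<^bold>\<or> B, \<^bold>\<not> A, \<^bold>\<not> B}"
    have "deriv L {} ?F FBot"
    proof (rule deriv.OrE)
      show "deriv L {} ?F (A \<^bold>\<or> B)" using fm by (intro deriv.Hyp) auto
      show "deriv L {} (insert A ?F) FBot"
        by (rule deriv.ImpE[of _ _ _ A]; rule deriv.Hyp) (use fm in auto)
      show "deriv L {} (insert B ?F) FBot"
        by (rule deriv.ImpE[of _ _ _ B]; rule deriv.Hyp) (use fm in auto)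
    qed
    then have "fin_deriv L H FBot"
      unfolding fin_deriv_def using or neg by (intro exI[of _ ?F]) auto
    then show False using H by (simp add: henkin_def)
  qed
qed

lemma henkin_all:
  assumes fm: "is_fm L (FAll \<tau> A)"
  shows "FAll \<tau> A \<in> H \<longleftrightarrow> (\<forall>t. is_tm L t \<tau> \<longrightarrow> opn 0 t A \<in> H)"
proof (intro iffI allI impI)
  fix t assume "FAll \<tau> A \<in> H" and t: "is_tm L t \<tau>"
  then have "fin_deriv L H (FAll \<tau> A)" by (auto intro: henkin_hyp)
  then have "fin_deriv L H (opn 0 t A)" by (rule fin_deriv_rule1) (rule deriv.AllE[OF _ t])
  then show "opn 0 t A \<in> H" using is_fm_opn[OF fm t] by (rule henkin_closed)
next
  assume all: "\<forall>t. is_tm L t \<tau> \<longrightarrow> opn 0 t A \<in> H"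
  show "FAll \<tau> A \<in> H"
  proof (rule ccontr)
    assume "FAll \<tau> A \<notin> H"
    then have neg: "(\<^bold>\<not> FAll \<tau> A) \<in> H" using fm by (rule henkin_neg[rotated])
    have fmE: "is_fm L (FEx \<tau> (\<^bold>\<not> A))" using fm by (simp add: is_fm_FEx is_fm_FAll)
    obtain v where v: "snd v = \<tau>" "v \<notin> fv A" using fresh_var[of "fv A" \<tau>] by auto
    have tyv: "is_tm L (Fr v) \<tau>" using v fm by (simp add: is_fm_FAll)
    have fmv: "is_fm L (opn 0 (Fr v) A)" by (rule is_fm_opn[OF fm tyv])
    \<comment> \<open>Witnesses exist only for existential formulas, so the counterexample has to
      come from \<exists> \<not> A. This follows classically from \<not> \<forall> A: denying it
      gives A for the fresh variable v and hence \<forall> A.\<close>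
    let ?G = "{\<^bold>\<not> FEx \<tau> (\<^bold>\<not> A), \<^bold>\<not> FAll \<tau> A}"
    let ?G' = "insert (\<^bold>\<not> opn 0 (Fr v) A) ?G"
    have "deriv L {} ?G' (FEx \<tau> (\<^bold>\<not> A))"
      by (rule deriv.ExI[OF fmE tyv]) (auto intro!: deriv.Hyp simp: fmv)
    moreover have "deriv L {} ?G' (\<^bold>\<not> FEx \<tau> (\<^bold>\<not> A))"
      by (rule deriv.Hyp) (auto simp: fmE)
    ultimately have "deriv L {} ?G' FBot" by (rule deriv.ImpE[rotated])
    then have "deriv L {} ?G (opn 0 (Fr v) A)" by (rule deriv.Raa[OF fmv])
    then have "deriv L {} ?G (FAll (snd v) A)"
      by (rule deriv.AllI) (use v tyv in auto)
    moreover have "deriv L {} ?G (\<^bold>\<not> FAll \<tau> A)"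
      by (rule deriv.Hyp) (auto simp: fm)
    ultimately have "deriv L {} ?G FBot" unfolding v by (rule deriv.ImpE[rotated])
    then have "deriv L {} {\<^bold>\<not> FAll \<tau> A} (FEx \<tau> (\<^bold>\<not> A))" by (rule deriv.Raa[OF fmE])
    then have "fin_deriv L H (FEx \<tau> (\<^bold>\<not> A))"
      unfolding fin_deriv_def using neg by (intro exI[of _ "{\<^bold>\<not> FAll \<tau> A}"]) auto
    then have "FEx \<tau> (\<^bold>\<not> A) \<in> H" using fmE by (rule henkin_closed)
    then obtain w where w: "snd w = \<tau>" "opn 0 (Fr w) (\<^bold>\<not> A) \<in> H"
      using H unfolding henkin_def by blast
    moreover have "opn 0 (Fr w) A \<in> H" using all w(1) tyv by auto
    ultimately have "FBot \<in> H" using henkin_imp[of "opn 0 (Fr w) A" FBot] henkin_is_fm[OF w(2)] by auto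
    then show False using henkin_bot by simp
  qed
qed

lemma henkin_ex:
  assumes fm: "is_fm L (FEx \<tau> A)"
  shows "FEx \<tau> A \<in> H \<longleftrightarrow> (\<exists>t. is_tm L t \<tau> \<and> opn 0 t A \<in> H)"
proof
  assume "FEx \<tau> A \<in> H"
  then obtain v where "snd v = \<tau>" "opn 0 (Fr v) A \<in> H" using H unfolding henkin_def by blast
  moreover from this have "is_tm L (Fr v) \<tau>" using fm by (simp add: is_fm_FEx is_fm_FAll)
  ultimately show "\<exists>t. is_tm L t \<tau> \<and> opn 0 t A \<in> H" by blast
next
  assume "\<exists>t. is_tm L t \<tau> \<and> opn 0 t A \<in> H"
  then obtain t where t: "is_tm L t \<tau>" "opn 0 t A \<in> H" by blast
  from henkin_hyp[OF t(2)] have "fin_deriv L H (FEx \<tau> A)"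
    by (rule fin_deriv_rule1) (rule deriv.ExI[OF fm t(1)])
  then show "FEx \<tau> A \<in> H" using fm by (rule henkin_closed)
qed

lemma henkin_ball:
  assumes fm: "is_fm L (FBAll t A)"
  shows "FBAll t A \<in> H \<longleftrightarrow> FAll N (Bd 0 \<^bold>\<le> t \<^bold>\<longrightarrow> A) \<in> H"
proof
  assume "FBAll t A \<in> H"
  then have "fin_deriv L H (FAll N (Bd 0 \<^bold>\<le> t \<^bold>\<longrightarrow> A))"
    by (rule fin_deriv_rule1[OF henkin_hyp]) (rule deriv.BAllE)
  then show "FAll N (Bd 0 \<^bold>\<le> t \<^bold>\<longrightarrow> A) \<in> H" using is_fm_FAll_Le(1)[OF fm] by (rule henkin_closed)
next
  assume "FAll N (Bd 0 \<^bold>\<le> t \<^bold>\<longrightarrow> A) \<in> H"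
  then have "fin_deriv L H (FBAll t A)"
    by (rule fin_deriv_rule1[OF henkin_hyp]) (rule deriv.BAllI[OF fm])
  then show "FBAll t A \<in> H" using fm by (rule henkin_closed)
qed

lemma henkin_bex:
  assumes fm: "is_fm L (FBEx t A)"
  shows "FBEx t A \<in> H \<longleftrightarrow> FEx N (Bd 0 \<^bold>\<le> t \<^bold>\<and> A) \<in> H"
proof
  assume "FBEx t A \<in> H"
  then have "fin_deriv L H (FEx N (Bd 0 \<^bold>\<le> t \<^bold>\<and> A))"
    by (rule fin_deriv_rule1[OF henkin_hyp]) (rule deriv.BExE)
  then show "FEx N (Bd 0 \<^bold>\<le> t \<^bold>\<and> A) \<in> H" using is_fm_FAll_Le(2)[OF fm] by (rule henkin_closed)
next
  assume "FEx N (Bd 0 \<^bold>\<le> t \<^bold>\<and> A) \<in> H"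
  then have "fin_deriv L H (FBEx t A)"
    by (rule fin_deriv_rule1[OF henkin_hyp]) (rule deriv.BExI[OF fm])
  then show "FBEx t A \<in> H" using fm by (rule henkin_closed)
qed

end

subsection \<open>Existence of Henkin sets\<close>

text \<open>The witness variable avoids A and all formulas accepted so far, so that
  \<open>ExE\<close> can remove its instance again.\<close>

definition witness :: "cn fm set \<Rightarrow> cn fm \<Rightarrow> cn fm set" where
  "witness \<Gamma> A = (case A of FEx \<tau> B \<Rightarrow>
     {opn 0 (Fr (SOME v. snd v = \<tau> \<and> v \<notin> fv A \<union> \<Union> (fv ` \<Gamma>))) B} | _ \<Rightarrow> {})"

definition extend :: "lang \<Rightarrow> cn fm set \<Rightarrow> cn fm \<Rightarrow> cn fm set" where
  "extend L \<Gamma> A = (if is_fm L A \<and> \<not> fin_deriv L (insert A \<Gamma>) FBot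
     then insert A \<Gamma> \<union> witness \<Gamma> A else \<Gamma>)"

text \<open>\<open>from_nat\<close> enumerates all formulas; this is what the countability instances
  serve.\<close>

primrec henkin_chain :: "lang \<Rightarrow> cn fm set \<Rightarrow> nat \<Rightarrow> cn fm set" where
  "henkin_chain L \<Gamma> 0 = \<Gamma>"
| "henkin_chain L \<Gamma> (Suc n) = extend L (henkin_chain L \<Gamma> n) (from_nat n)"

lemma finite_fv_witness: "finite (\<Union> (fv ` witness \<Gamma> A))"
  by (auto simp: witness_def split: fm.split)

lemma witness_FEx:
  assumes "finite (\<Union> (fv ` \<Gamma>))"
  obtains v where "snd v = \<tau>" "v \<notin> fv B" "\<And>C. C \<in> \<Gamma> \<Longrightarrow> v \<notin> fv C"
    "witness \<Gamma> (FEx \<tau> B) = {opn 0 (Fr v) B}"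
proof -
  let ?v = "SOME v. snd v = \<tau> \<and> v \<notin> fv (FEx \<tau> B) \<union> \<Union> (fv ` \<Gamma>)"
  have "snd ?v = \<tau> \<and> ?v \<notin> fv (FEx \<tau> B) \<union> \<Union> (fv ` \<Gamma>)"
    by (rule someI_ex, rule fresh_var) (use assms in auto)
  then show ?thesis by (intro that[of ?v]) (auto simp: witness_def)
qed

text \<open>The set may be infinite; what keeps a fresh variable available is that only finitely
  many variables are free in it. Adding a witness preserves consistency because \<open>ExE\<close>
  removes the instance from any refutation.\<close>

lemma extend_props:
  assumes "finite (\<Union> (fv ` \<Gamma>))" "\<forall>A\<in>\<Gamma>. is_fm L A" "\<not> fin_deriv L \<Gamma> FBot"
  shows "finite (\<Union> (fv ` extend L \<Gamma> A))" "\<forall>A\<in>extend L \<Gamma> A. is_fm L A"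
    "\<not> fin_deriv L (extend L \<Gamma> A) FBot"
proof -
  show "finite (\<Union> (fv ` extend L \<Gamma> A))"
    using assms(1) finite_fv_witness[of \<Gamma> A] by (simp add: extend_def)
  have "(\<forall>A\<in>extend L \<Gamma> A. is_fm L A) \<and> \<not> fin_deriv L (extend L \<Gamma> A) FBot"
  proof (cases "is_fm L A \<and> \<not> fin_deriv L (insert A \<Gamma>) FBot")
    case True
    show ?thesis
    proof (cases "\<exists>\<tau> B. A = FEx \<tau> B")
      case False
      then have "witness \<Gamma> A = {}" by (auto simp: witness_def split: fm.split)
      with True assms show ?thesis by (auto simp: extend_def)
    next
      case ex: True
      then obtain \<tau> B where A: "A = FEx \<tau> B" by blast
      from witness_FEx[OF assms(1), of \<tau> B] obtain v where v: "snd v = \<tau>" "v \<notin> fv B"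
        "\<And>C. C \<in> \<Gamma> \<Longrightarrow> v \<notin> fv C" and wit: "witness \<Gamma> A = {opn 0 (Fr v) B}" unfolding A by metis
      have fmB: "is_fm L (opn 0 (Fr v) B)"
        by (rule is_fm_opn[of L \<tau>]) (use True v in \<open>auto simp: A is_fm_FEx is_fm_FAll\<close>)
      have "fin_deriv L (insert A \<Gamma>) FBot" if inc: "fin_deriv L (insert (opn 0 (Fr v) B) (insert A \<Gamma>)) FBot"
      proof -
        from inc obtain F where F: "finite F" "F \<subseteq> insert A \<Gamma>" "deriv L {} (insert (opn 0 (Fr v) B) F) FBot"
          by (rule fin_deriv_insertD)
        then have "deriv L {} (insert (opn 0 (Fr v) B) (insert A F)) FBot"
          by (intro deriv_weaken[OF F(3)]) auto
        moreover have "deriv L {} (insert A F) (FEx (snd v) B)"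
          using True by (intro deriv.Hyp) (auto simp: A v)
        ultimately have "deriv L {} (insert A F) FBot"
          using F v A by (intro deriv.ExE[of L "{}" "insert A F" v B FBot]) auto
        then show ?thesis using F unfolding fin_deriv_def by (intro exI[of _ "insert A F"]) auto
      qed
      then show ?thesis using True assms fmB by (auto simp: extend_def wit insert_commute)
    qed
  qed (use assms in \<open>auto simp: extend_def\<close>)
  then show "\<forall>A\<in>extend L \<Gamma> A. is_fm L A" "\<not> fin_deriv L (extend L \<Gamma> A) FBot" by auto
qed

theorem henkin_extension:
  assumes fin: "finite (\<Union> (fv ` \<Gamma>))" and fm: "\<forall>A\<in>\<Gamma>. is_fm L A" and con: "\<not> fin_deriv L \<Gamma> FBot"
  obtains H where "\<Gamma> \<subseteq> H" "henkin L H"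
proof -
  let ?C = "henkin_chain L \<Gamma>"
  define H where "H = (\<Union>n. ?C n)"
  have props: "finite (\<Union> (fv ` ?C n)) \<and> (\<forall>A\<in>?C n. is_fm L A) \<and> \<not> fin_deriv L (?C n) FBot" for n
  proof (induction n)
    case (Suc n)
    then show ?case using extend_props[of "?C n" L "from_nat n"] by simp
  qed (use fin fm con in simp)
  have Suc: "?C n \<subseteq> ?C (Suc n)" for n by (auto simp: extend_def)
  have mono: "?C m \<subseteq> ?C n" if "m \<le> n" for m n using that Suc by (rule lift_Suc_mono_le[rotated])
  have fin_sub: "\<exists>n. F \<subseteq> ?C n" if "finite F" "F \<subseteq> H" for F
    using that
  proof (induction F rule: finite_induct)
    case (insert x F)
    then obtain m n where "F \<subseteq> ?C m" "x \<in> ?C n" by (auto simp: H_def)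
    then have "insert x F \<subseteq> ?C (max m n)" using mono[of m "max m n"] mono[of n "max m n"] by auto
    then show ?case by blast
  qed auto
  have conH: "\<not> fin_deriv L H FBot"
  proof
    assume "fin_deriv L H FBot"
    then obtain F where "finite F" "F \<subseteq> H" "deriv L {} F FBot" unfolding fin_deriv_def by blast
    with fin_sub[of F] props show False unfolding fin_deriv_def by blast
  qed
  \<comment> \<open>A formula is decided at the stage given by its code. If it belongs to H, it is
    consistent with that stage, so it was accepted there together with its witness.\<close>
  have step: "A \<in> H \<Longrightarrow> A \<in> ?C (Suc (to_nat A)) \<and> witness (?C (to_nat A)) A \<subseteq> H"
    and max: "is_fm L A \<Longrightarrow> A \<in> H \<or> fin_deriv L (insert A H) FBot" for A
  proof -
    have sub: "?C n \<subseteq> H" for n by (auto simp: H_def)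
    show "is_fm L A \<Longrightarrow> A \<in> H \<or> fin_deriv L (insert A H) FBot"
    proof -
      assume fmA: "is_fm L A"
      show ?thesis
      proof (cases "fin_deriv L (insert A (?C (to_nat A))) FBot")
        case True
        then show ?thesis using sub[of "to_nat A"] fin_deriv_mono[of L _ FBot "insert A H"] by blast
      next
        case False
        then have "A \<in> ?C (Suc (to_nat A))" using fmA by (simp add: extend_def)
        then show ?thesis using sub by blast
      qed
    qed
    assume A: "A \<in> H"
    then have fmA: "is_fm L A" using props by (auto simp: H_def)
    have "\<not> fin_deriv L (insert A (?C (to_nat A))) FBot"
    proof
      assume "fin_deriv L (insert A (?C (to_nat A))) FBot"
      then have "fin_deriv L H FBot"
        by (rule fin_deriv_mono) (use A sub[of "to_nat A"] in auto)
      with conH show False by simp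
    qed
    then have "?C (Suc (to_nat A)) = insert A (?C (to_nat A)) \<union> witness (?C (to_nat A)) A"
      using fmA by (simp add: extend_def)
    then show "A \<in> ?C (Suc (to_nat A)) \<and> witness (?C (to_nat A)) A \<subseteq> H"
      using sub[of "Suc (to_nat A)"] by auto
  qed
  have wit: "\<exists>v. snd v = \<tau> \<and> opn 0 (Fr v) A \<in> H" if "FEx \<tau> A \<in> H" for \<tau> A
  proof -
    have "finite (\<Union> (fv ` ?C (to_nat (FEx \<tau> A))))" using props by blast
    from witness_FEx[OF this, of \<tau> A] step[OF that] show ?thesis by (metis insert_subset)
  qed
  have "henkin L H" using conH max wit props by (auto simp: henkin_def H_def)
  moreover have "\<Gamma> \<subseteq> H" unfolding H_def using UN_upper[of 0 UNIV ?C] by simp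
  ultimately show ?thesis by (rule that[rotated])
qed

section \<open>Structures\<close>

text \<open>\<open>equ\<close> need not be the identity: in the term structure different terms can
  be provably equal. \<open>Dom\<close> is a family of sets over a single carrier, so typing is a
  matter of membership.\<close>

record 'a struct =
  Dom :: "ty \<Rightarrow> 'a set"
  app :: "'a \<Rightarrow> 'a \<Rightarrow> 'a"
  con :: "cn \<Rightarrow> 'a"
  equ :: "'a \<Rightarrow> 'a \<Rightarrow> bool"
  std :: "'a \<Rightarrow> bool"

primrec eval :: "('a, 'b) struct_scheme \<Rightarrow> (var \<Rightarrow> 'a) \<Rightarrow> 'a list \<Rightarrow> cn tm \<Rightarrow> 'a" where
  "eval S e bs (Bd n) = bs ! n"
| "eval S e bs (Fr v) = e v"
| "eval S e bs (Cn c) = con S c"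
| "eval S e bs (s \<cdot> t) = app S (eval S e bs s) (eval S e bs t)"

text \<open>Bounded quantifiers are primitive, so their meaning requires a semantic form of the
  inequality in their rules. As \<open>monusC\<close> is closed, the environment can be
  arbitrary.\<close>

definition le_in :: "('a, 'b) struct_scheme \<Rightarrow> 'a \<Rightarrow> 'a \<Rightarrow> bool" where
  "le_in S x y \<longleftrightarrow>
     equ S (app S (app S (eval S (\<lambda>_. undefined) [] monusC) x) y) (con S cZero)"

primrec sat :: "('a, 'b) struct_scheme \<Rightarrow> (var \<Rightarrow> 'a) \<Rightarrow> 'a list \<Rightarrow> cn fm \<Rightarrow> bool" where
  "sat S e bs (s \<^bold>= t) = equ S (eval S e bs s) (eval S e bs t)"
| "sat S e bs (FSt t) = std S (eval S e bs t)"
| "sat S e bs FBot = False"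
| "sat S e bs (A \<^bold>\<longrightarrow> B) = (sat S e bs A \<longrightarrow> sat S e bs B)"
| "sat S e bs (A \<^bold>\<and> B) = (sat S e bs A \<and> sat S e bs B)"
| "sat S e bs (A \<^bold>\<or> B) = (sat S e bs A \<or> sat S e bs B)"
| "sat S e bs (FAll \<tau> A) = (\<forall>d\<in>Dom S \<tau>. sat S e (d # bs) A)"
| "sat S e bs (FEx \<tau> A) = (\<exists>d\<in>Dom S \<tau>. sat S e (d # bs) A)"
| "sat S e bs (FBAll t A) =
     (\<forall>d\<in>Dom S N. le_in S d (eval S e bs t) \<longrightarrow> sat S e (d # bs) A)"
| "sat S e bs (FBEx t A) =
     (\<exists>d\<in>Dom S N. le_in S d (eval S e bs t) \<and> sat S e (d # bs) A)"

definition env_in :: "lang \<Rightarrow> ('a, 'b) struct_scheme \<Rightarrow> (var \<Rightarrow> 'a) \<Rightarrow> bool" where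
  "env_in L S e \<longleftrightarrow> (\<forall>v. ty_in L (snd v) \<longrightarrow> e v \<in> Dom S (snd v))"

lemma eval_closed_terms:
  assumes "has_ty L [] t \<tau>" "fv_tm t = {}"
  shows "eval S e bs t = eval S e' bs' t"
  using assms by (induction t arbitrary: \<tau>) auto

lemma eval_monusC: "eval S e bs monusC = eval S (\<lambda>_. undefined) [] monusC"
  by (rule eval_closed_terms[of Full _ "N \<Rrightarrow> N \<Rrightarrow> N"])
     (use is_tm_closed_terms(3)[of Full] in \<open>auto simp: is_tm_def\<close>)

lemma sat_Le [simp]: "sat S e bs (s \<^bold>\<le> t) = le_in S (eval S e bs s) (eval S e bs t)"
  by (simp add: Le_def le_in_def eval_monusC[of S e bs])

lemma eval_cls: "k < length bs \<Longrightarrow> eval S e bs (cls_tm k v t) = eval S (e(v := bs ! k)) bs t"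
  by (induction t) auto

lemma sat_cls: "k < length bs \<Longrightarrow> sat S e bs (cls k v A) = sat S (e(v := bs ! k)) bs A"
  by (induction A arbitrary: k bs) (simp_all add: eval_cls)

text \<open>The value \<open>d\<close> enters the environment and stays on the list of bound values
  too, where formulas without dangling indices do not see it (\<open>sat_is_fm\<close>).\<close>

lemma sat_all [simp]: "sat S e bs (all v A) = (\<forall>d\<in>Dom S (snd v). sat S (e(v := d)) (d # bs) A)"
  by (simp add: all_def sat_cls)
lemma sat_ex [simp]: "sat S e bs (ex v A) = (\<exists>d\<in>Dom S (snd v). sat S (e(v := d)) (d # bs) A)"
  by (simp add: ex_def sat_cls)
lemma sat_ball [simp]: "sat S e bs (ball v t A) =
    (\<forall>d\<in>Dom S N. le_in S d (eval S e bs t) \<longrightarrow> sat S (e(v := d)) (d # bs) A)"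
  by (simp add: ball_def sat_cls)
lemma sat_bex [simp]: "sat S e bs (bex v t A) =
    (\<exists>d\<in>Dom S N. le_in S d (eval S e bs t) \<and> sat S (e(v := d)) (d # bs) A)"
  by (simp add: bex_def sat_cls)

lemma eval_append: "has_ty L \<Delta> t \<tau> \<Longrightarrow> length \<Delta> = length bs \<Longrightarrow> eval S e (bs @ cs) t = eval S e bs t"
  by (induction t arbitrary: \<tau>) (auto simp: nth_append)

lemma sat_append: "wff L \<Delta> A \<Longrightarrow> length \<Delta> = length bs \<Longrightarrow> sat S e (bs @ cs) A = sat S e bs A"
proof (induction A arbitrary: \<Delta> bs)
  case (FAll \<tau> A)
  then have "sat S e ((d # bs) @ cs) A = sat S e (d # bs) A" for d
    by (intro FAll.IH[of "\<tau> # \<Delta>"]) auto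
  then show ?case by simp
next
  case (FEx \<tau> A)
  then have "sat S e ((d # bs) @ cs) A = sat S e (d # bs) A" for d
    by (intro FEx.IH[of "\<tau> # \<Delta>"]) auto
  then show ?case by simp
next
  case (FBAll t A)
  then have "sat S e ((d # bs) @ cs) A = sat S e (d # bs) A" for d
    by (intro FBAll.IH[of "N # \<Delta>"]) auto
  then show ?case using FBAll.prems eval_append[of L \<Delta> t N bs S e cs] by simp
next
  case (FBEx t A)
  then have "sat S e ((d # bs) @ cs) A = sat S e (d # bs) A" for d
    by (intro FBEx.IH[of "N # \<Delta>"]) auto
  then show ?case using FBEx.prems eval_append[of L \<Delta> t N bs S e cs] by simp
next
  case (FSt t)
  then obtain \<tau> where "has_ty L \<Delta> t \<tau>" by auto
  then show ?case using FSt.prems eval_append[of L \<Delta> t \<tau> bs S e cs] by simp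
qed (auto simp: eval_append)

lemma sat_is_fm: "is_fm L A \<Longrightarrow> sat S e bs A = sat S e [] A"
  using sat_append[of L "[]" A "[]" S e bs] by (simp add: is_fm_def)

lemma eval_opn: "has_ty L \<Delta> t \<tau> \<Longrightarrow> length \<Delta> = Suc (length bs) \<Longrightarrow> 
    eval S e bs (opn_tm (length bs) (Fr v) t) = eval S e (bs @ [e v]) t"
  by (induction t arbitrary: \<tau>) (auto simp: nth_append)

lemma sat_opn: "wff L \<Delta> A \<Longrightarrow> length \<Delta> = Suc (length bs) \<Longrightarrow>
    sat S e bs (opn (length bs) (Fr v) A) = sat S e (bs @ [e v]) A"
proof (induction A arbitrary: \<Delta> bs)
  case (FAll \<tau> A)
  then have "sat S e (d # bs) (opn (length (d # bs)) (Fr v) A) = sat S e ((d # bs) @ [e v]) A" for d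
    by (intro FAll.IH[of "\<tau> # \<Delta>"]) auto
  then show ?case by simp
next
  case (FEx \<tau> A)
  then have "sat S e (d # bs) (opn (length (d # bs)) (Fr v) A) = sat S e ((d # bs) @ [e v]) A" for d
    by (intro FEx.IH[of "\<tau> # \<Delta>"]) auto
  then show ?case by simp
next
  case (FBAll t A)
  then have "sat S e (d # bs) (opn (length (d # bs)) (Fr v) A) = sat S e ((d # bs) @ [e v]) A" for d
    by (intro FBAll.IH[of "N # \<Delta>"]) auto
  then show ?case using FBAll.prems eval_opn[of L \<Delta> t N bs S e v] by simp
next
  case (FBEx t A)
  then have "sat S e (d # bs) (opn (length (d # bs)) (Fr v) A) = sat S e ((d # bs) @ [e v]) A" for d
    by (intro FBEx.IH[of "N # \<Delta>"]) auto
  then show ?case using FBEx.prems eval_opn[of L \<Delta> t N bs S e v] by simp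
next
  case (FSt t)
  then obtain \<tau> where "has_ty L \<Delta> t \<tau>" by auto
  then show ?case using FSt.prems eval_opn[of L \<Delta> t \<tau> bs S e v] by simp
qed (auto simp: eval_opn)

lemma eval_upd: "v \<notin> fv_tm t \<Longrightarrow> eval S (e(v := d)) bs t = eval S e bs t"
  by (induction t) auto
lemma sat_upd: "v \<notin> fv A \<Longrightarrow> sat S (e(v := d)) bs A = sat S e bs A"
  by (induction A arbitrary: bs) (auto simp: eval_upd)

lemma sat_opn_fresh:
  assumes "wff L [\<tau>] A" "v \<notin> fv A"
  shows "sat S (e(v := d)) [] (opn 0 (Fr v) A) = sat S e [d] A"
  using sat_opn[of L "[\<tau>]" A "[]" S "e(v := d)" v] assms by (simp add: sat_upd)

subsection \<open>The term structure of a Henkin set\<close>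

text \<open>Open terms belong to the domains, so the variables chosen as witnesses are
  elements.\<close>

definition term_struct :: "lang \<Rightarrow> cn fm set \<Rightarrow> cn tm struct" where
  "term_struct L H = \<lparr>Dom = \<lambda>\<tau>. {t. is_tm L t \<tau>}, app = Ap, con = Cn,
     equ = \<lambda>s t. (s \<^bold>= t) \<in> H, std = \<lambda>t. FSt t \<in> H\<rparr>"

lemma term_struct_simps [simp]:
  "Dom (term_struct L H) \<tau> = {t. is_tm L t \<tau>}" "app (term_struct L H) = Ap"
  "con (term_struct L H) = Cn" "equ (term_struct L H) s t = ((s \<^bold>= t) \<in> H)"
  "std (term_struct L H) t = (FSt t \<in> H)"
  by (simp_all add: term_struct_def)

lemma env_in_term_struct: "env_in L (term_struct L H) e = env L e"
  by (simp add: env_in_def env_def)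

lemma eval_term_struct: "has_ty L [] t \<tau> \<Longrightarrow> eval (term_struct L H) e [] t = psub_tm e t"
  by (induction t arbitrary: \<tau>) auto

lemma le_in_term_struct: "le_in (term_struct L H) s t = ((s \<^bold>\<le> t) \<in> H)"
  using eval_term_struct[of L monusC "N \<Rrightarrow> N \<Rrightarrow> N" H] is_tm_closed_terms(3)[of L]
  by (simp add: le_in_def Le_def psub_tm_closed is_tm_def)

lemma size_opn_tm [simp]: "size (opn_tm k (Fr v) t :: 'c tm) = size t"
  by (induction t) auto
lemma size_opn [simp]: "size (opn k (Fr v) A :: 'c fm) = size A"
  by (induction A arbitrary: k) auto

lemma opn_psub_fresh:
  assumes "env L e" "is_fm L (FAll \<tau> A)" "v \<notin> fv A"
  shows "psub (e(v := d)) (opn 0 (Fr v) A) = opn 0 d (psub e A)"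
proof -
  have "opn_tm k u (e w) = e w" if "w \<in> fv A" for w k u
  proof -
    have "ty_in L (snd w)" using is_fm_fv[OF assms(2), of w] that by simp
    then have "is_tm L (e w) (snd w)" using assms(1) unfolding env_def by blast
    then show ?thesis by (rule is_tm_opn)
  qed
  then have "psub (e(v := d)) (opn 0 (Fr v) A) = opn 0 d (psub (e(v := d)) A)"
    using assms(3) by (subst psub_opn) auto
  also have "psub (e(v := d)) A = psub e A" by (rule psub_cong) (use assms(3) in auto)
  finally show ?thesis .
qed

text \<open>The induction is on size because an instance of a quantified formula is not a subformula
  of it.\<close>

lemma truth:
  assumes H: "henkin L H"
  shows "is_fm L A \<Longrightarrow> env L e \<Longrightarrow> sat (term_struct L H) e [] A \<longleftrightarrow> psub e A \<in> H"
proof (induction "size A" arbitrary: A e rule: less_induct)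
  case less
  let ?S = "term_struct L H"
  note fm = less.prems(1) and e = less.prems(2)
  \<comment> \<open>Opening with \<open>t\<close> could make the formula larger than A. It is opened
    with a fresh variable, which preserves the size, and \<open>t\<close> becomes the value of that
    variable.\<close>
  have quant: "sat ?S e [t] B \<longleftrightarrow> opn 0 t (psub e B) \<in> H"
    if "is_fm L (FAll \<tau> B)" "is_tm L t \<tau>" "size B < size A" for \<tau> B t
  proof -
    obtain v where v: "snd v = \<tau>" "v \<notin> fv B" using fresh_var[of "fv B" \<tau>] by auto
    have "sat ?S e [t] B = sat ?S (e(v := t)) [] (opn 0 (Fr v) B)"
      using sat_opn_fresh[of L \<tau> B v ?S e t] that v by (simp add: is_fm_FAll)
    also have "\<dots> \<longleftrightarrow> psub (e(v := t)) (opn 0 (Fr v) B) \<in> H"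
    proof (rule less.hyps)
      show "is_fm L (opn 0 (Fr v) B)"
        using that v is_tm_ty_in[OF that(2)] by (intro is_fm_opn[of L \<tau>]) auto
      show "env L (e(v := t))" using e that v by (intro env_upd) auto
    qed (use that in simp)
    also have "psub (e(v := t)) (opn 0 (Fr v) B) = opn 0 t (psub e B)"
      by (rule opn_psub_fresh[OF e that(1) v(2)])
    finally show ?thesis .
  qed
  have fm': "is_fm L (psub e A)" by (rule is_fm_psub[OF fm e])
  show ?case
  proof (cases A)
    case (FEq s t)
    then show ?thesis using fm by (auto simp: is_tm_def eval_term_struct)
  next
    case (FSt t)
    then obtain \<tau> where "has_ty L [] t \<tau>" using fm by (auto simp: is_tm_def)
    then show ?thesis using FSt by (simp add: eval_term_struct)
  next
    case FBot
    then show ?thesis using henkin_bot[OF H] by simp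
  next
    case (FImp B C)
    then show ?thesis using fm e fm' less.hyps[of B e] less.hyps[of C e] by (simp add: henkin_imp[OF H])
  next
    case (FAnd B C)
    then show ?thesis using fm e fm' less.hyps[of B e] less.hyps[of C e] by (simp add: henkin_and[OF H])
  next
    case (FOr B C)
    then show ?thesis using fm e fm' less.hyps[of B e] less.hyps[of C e] by (simp add: henkin_or[OF H])
  next
    case (FAll \<tau> B)
    then show ?thesis using fm fm' quant[of \<tau> B] by (auto simp: henkin_all[OF H])
  next
    case (FEx \<tau> B)
    then show ?thesis using fm fm' quant[of \<tau> B] by (auto simp: henkin_ex[OF H] is_fm_FEx)
  next
    case (FBAll t B)
    have t: "is_tm L t N" "is_fm L (FAll N B)" using fm FBAll by (auto simp: is_fm_FBAll)
    have t': "is_tm L (psub_tm e t) N" by (rule is_tm_psub[OF t(1) e])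
    have ev: "eval ?S e [] t = psub_tm e t" using t(1) by (auto simp: is_tm_def eval_term_struct)
    have fmle: "is_fm L (FAll N (Bd 0 \<^bold>\<le> psub_tm e t \<^bold>\<longrightarrow> psub e B))"
      using fm' FBAll by (auto intro: is_fm_FAll_Le)
    have "psub e A \<in> H \<longleftrightarrow> (\<forall>d. is_tm L d N \<longrightarrow> opn 0 d (Bd 0 \<^bold>\<le> psub_tm e t \<^bold>\<longrightarrow> psub e B) \<in> H)"
      using fm' FBAll henkin_ball[OF H] henkin_all[OF H fmle] by simp
    also have "\<dots> \<longleftrightarrow> (\<forall>d. is_tm L d N \<longrightarrow> (d \<^bold>\<le> psub_tm e t) \<in> H \<longrightarrow> opn 0 d (psub e B) \<in> H)"
      using is_fm_opn[OF fmle] is_tm_opn[OF t'] by (auto simp: henkin_imp[OF H])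
    finally show ?thesis using quant[of N B] t FBAll by (auto simp: le_in_term_struct ev)
  next
    case (FBEx t B)
    have t: "is_tm L t N" "is_fm L (FAll N B)" using fm FBEx by (auto simp: is_fm_FBEx)
    have t': "is_tm L (psub_tm e t) N" by (rule is_tm_psub[OF t(1) e])
    have ev: "eval ?S e [] t = psub_tm e t" using t(1) by (auto simp: is_tm_def eval_term_struct)
    have fmle: "is_fm L (FEx N (Bd 0 \<^bold>\<le> psub_tm e t \<^bold>\<and> psub e B))"
      using fm' FBEx by (auto intro: is_fm_FAll_Le)
    have "psub e A \<in> H \<longleftrightarrow> (\<exists>d. is_tm L d N \<and> opn 0 d (Bd 0 \<^bold>\<le> psub_tm e t \<^bold>\<and> psub e B) \<in> H)"
      using fm' FBEx henkin_bex[OF H] henkin_ex[OF H fmle] by simp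
    also have "\<dots> \<longleftrightarrow> (\<exists>d. is_tm L d N \<and> (d \<^bold>\<le> psub_tm e t) \<in> H \<and> opn 0 d (psub e B) \<in> H)"
      using is_fm_opn[OF fmle[unfolded is_fm_FEx]] is_tm_opn[OF t'] by (auto simp: henkin_and[OF H])
    finally show ?thesis using quant[of N B] t FBEx by (auto simp: le_in_term_struct ev)
  qed
qed

subsection \<open>Completeness\<close>

lemma fv_tm_cls: "fv_tm (cls_tm k v t) = fv_tm t - {v}" by (induction t) auto
lemma fv_cls [simp]: "fv (cls k v A) = fv A - {v}"
  by (induction A arbitrary: k) (auto simp: fv_tm_cls)

lemma set_tm_cls: "set_tm (cls_tm k v t) = set_tm t" by (induction t) auto
lemma set_fm_cls [simp]: "set_fm (cls k v A) = set_fm A"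
  by (induction A arbitrary: k) (auto simp: set_tm_cls)

lemma has_ty_cls: "has_ty L \<Delta> t \<tau> \<Longrightarrow> has_ty L (\<Delta> @ [snd v]) (cls_tm (length \<Delta>) v t) \<tau>"
  by (induction t arbitrary: \<tau>) (auto simp: nth_append)

lemma wff_cls: "wff L \<Delta> A \<Longrightarrow> wff L (\<Delta> @ [snd v]) (cls (length \<Delta>) v A)"
proof (induction A arbitrary: \<Delta>)
  case (FAll \<tau> A)
  then show ?case using FAll.IH[of "\<tau> # \<Delta>"] by simp
next
  case (FEx \<tau> A)
  then show ?case using FEx.IH[of "\<tau> # \<Delta>"] by simp
next
  case (FBAll t A)
  then show ?case using FBAll.IH[of "N # \<Delta>"] by (simp add: has_ty_cls)
next
  case (FBEx t A)
  then show ?case using FBEx.IH[of "N # \<Delta>"] by (simp add: has_ty_cls)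
qed (auto intro: has_ty_cls)

lemma opn_cls_tm: "has_ty L \<Delta> t \<tau> \<Longrightarrow> length \<Delta> \<le> k \<Longrightarrow> opn_tm k (Fr v) (cls_tm k v t) = t"
  by (induction t arbitrary: \<tau>) auto
lemma opn_cls: "wff L \<Delta> A \<Longrightarrow> length \<Delta> \<le> k \<Longrightarrow> opn k (Fr v) (cls k v A) = A"
proof (induction A arbitrary: \<Delta> k)
  case (FAll \<tau> A)
  then show ?case using FAll.IH[of "\<tau> # \<Delta>"] by simp
next
  case (FEx \<tau> A)
  then show ?case using FEx.IH[of "\<tau> # \<Delta>"] by simp
next
  case (FBAll t A)
  then show ?case using FBAll.IH[of "N # \<Delta>"] opn_cls_tm[of L \<Delta> t N] by simp
next
  case (FBEx t A)
  then show ?case using FBEx.IH[of "N # \<Delta>"] opn_cls_tm[of L \<Delta> t N] by simp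
next
  case (FSt t)
  then obtain \<tau> where "has_ty L \<Delta> t \<tau>" by auto
  then show ?case using FSt opn_cls_tm[of L \<Delta> t \<tau>] by simp
next
  case (FEq s t)
  then show ?case using opn_cls_tm[of L \<Delta> s N] opn_cls_tm[of L \<Delta> t N] by simp
qed auto

lemma fv_quant [simp]: "fv (all v A) = fv A - {v}" "fv (ex v A) = fv A - {v}"
  "fv (bex v t A) = fv_tm t \<union> (fv A - {v})" "fv (ball v t A) = fv_tm t \<union> (fv A - {v})"
  by (simp_all add: all_def ex_def bex_def ball_def)

lemma is_fm_all: "is_fm L A \<Longrightarrow> ty_in L (snd v) \<Longrightarrow> is_fm L (all v A)"
  using wff_cls[of L "[]" A v] by (simp add: is_fm_def all_def)
lemma is_fm_ex: "is_fm L A \<Longrightarrow> ty_in L (snd v) \<Longrightarrow> is_fm L (ex v A)"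
  using wff_cls[of L "[]" A v] by (simp add: is_fm_def ex_def)
lemma is_fm_bex: "is_fm L A \<Longrightarrow> is_tm L t N \<Longrightarrow> snd v = N \<Longrightarrow> is_fm L (bex v t A)"
  using is_fm_all[of L A v] by (simp add: is_fm_FBEx bex_def all_def)
lemma is_fm_ball: "is_fm L A \<Longrightarrow> is_tm L t N \<Longrightarrow> snd v = N \<Longrightarrow> is_fm L (ball v t A)"
  using is_fm_all[of L A v] by (simp add: is_fm_FBAll ball_def all_def)

lemma deriv_all: "deriv L X {} A \<Longrightarrow> is_fm L A \<Longrightarrow> ty_in L (snd v) \<Longrightarrow> deriv L X {} (all v A)"
  unfolding all_def by (rule deriv.AllI) (auto simp: opn_cls[of L "[]"] is_fm_def)

text \<open>Axioms have parameters, while the set from which the Henkin construction starts may use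
  up only finitely many variables. Generalizing in the empty context gives a closed theorem, whose
  truth in S returns that of the formula in every environment.\<close>

lemma universal_closure:
  assumes "deriv L X {} A" "is_fm L A"
  shows "\<exists>C. deriv L X {} C \<and> is_fm L C \<and> fv C = {} \<and>
    ((\<forall>e. env_in L S e \<longrightarrow> sat S e [] C) \<longrightarrow> (\<forall>e. env_in L S e \<longrightarrow> sat S e [] A))"
  using assms
proof (induction "card (fv A)" arbitrary: A)
  case 0
  then show ?case by auto
next
  case (Suc n)
  have "fv A \<noteq> {}" using Suc.hyps(2) by auto
  then obtain v where v: "v \<in> fv A" by blast
  have ty: "ty_in L (snd v)" using is_fm_fv[OF Suc.prems(2) v] .
  have "n = card (fv (all v A))" using Suc.hyps(2) v by simp
  from Suc.hyps(1)[OF this deriv_all[OF Suc.prems ty] is_fm_all[OF Suc.prems(2) ty]]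
  obtain C where C: "deriv L X {} C" "is_fm L C" "fv C = {}"
    "(\<forall>e. env_in L S e \<longrightarrow> sat S e [] C) \<longrightarrow> (\<forall>e. env_in L S e \<longrightarrow> sat S e [] (all v A))" by blast
  have "sat S e [] A" if e: "env_in L S e" and all: "\<forall>e. env_in L S e \<longrightarrow> sat S e [] (all v A)" for e
  proof -
    have "\<forall>d\<in>Dom S (snd v). sat S (e(v := d)) [d] A" using all e by simp
    moreover have "e v \<in> Dom S (snd v)" using e ty unfolding env_in_def by blast
    ultimately have "sat S (e(v := e v)) [e v] A" by (rule bspec)
    then show ?thesis using sat_is_fm[OF Suc.prems(2), of S e "[e v]"] by simp
  qed
  with C show ?case by blast
qed

lemma deriv_cut:
  assumes "finite F" "deriv L {} F A" "\<And>C. C \<in> F \<Longrightarrow> deriv L X {} C" "\<And>C. C \<in> F \<Longrightarrow> is_fm L C"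
  shows "deriv L X {} A"
  using assms
proof (induction F arbitrary: A rule: finite_induct)
  case empty
  then show ?case by (auto intro: deriv_mono_axioms)
next
  case (insert C F)
  then have "deriv L {} F (C \<^bold>\<longrightarrow> A)" by (intro deriv.ImpI) auto
  then have "deriv L X {} (C \<^bold>\<longrightarrow> A)" using insert by blast
  then show ?case by (rule deriv.ImpE) (use insert in auto)
qed

text \<open>The premises of \<open>valid\<close> list what holds in the term structure of a Henkin
  set. One satisfying environment suffices since G is closed, and it may be chosen to fit the
  argument, for example with standard values.\<close>

theorem completeness:
  assumes G: "is_fm L G" "fv G = {}" and
    valid: "\<And>S :: cn tm struct. (\<And>\<sigma> \<tau>. Dom S \<sigma> \<inter> Dom S \<tau> \<noteq> {} \<Longrightarrow> \<sigma> = \<tau>) \<Longrightarrow>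
      (\<And>\<sigma> \<tau> x y. x \<in> Dom S (\<sigma> \<Rrightarrow> \<tau>) \<Longrightarrow> y \<in> Dom S \<sigma> \<Longrightarrow> app S x y \<in> Dom S \<tau>) \<Longrightarrow>
      (\<And>c. cn_in L c \<Longrightarrow> con S c \<in> Dom S (cty c)) \<Longrightarrow>
      (\<And>\<tau>. ty_in L \<tau> \<Longrightarrow> Dom S \<tau> \<noteq> {}) \<Longrightarrow>
      (\<And>A e. A \<in> X \<Longrightarrow> is_fm L A \<Longrightarrow> env_in L S e \<Longrightarrow> sat S e [] A) \<Longrightarrow> \<exists>e. env_in L S e \<and> sat S e [] G"
  shows "deriv L X {} G"
proof (rule ccontr)
  assume nd: "\<not> deriv L X {} G"
  \<comment> \<open>The closed theorems together with \<not> G have no free variables at all, so the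
    finiteness condition of \<open>henkin_extension\<close> holds although the set is
    infinite.\<close>
  define Cl where "Cl = {C. deriv L X {} C \<and> is_fm L C \<and> fv C = {}}"
  have "\<not> fin_deriv L (insert (\<^bold>\<not> G) Cl) FBot"
  proof
    assume "fin_deriv L (insert (\<^bold>\<not> G) Cl) FBot"
    then obtain F where F: "finite F" "F \<subseteq> Cl" "deriv L {} F G"
      using fin_deriv_raa[OF _ G(1)] unfolding fin_deriv_def by blast
    have "deriv L X {} G" by (rule deriv_cut[OF F(1,3)]) (use F(2) in \<open>auto simp: Cl_def\<close>)
    with nd show False by simp
  qed
  moreover have "finite (\<Union> (fv ` insert (\<^bold>\<not> G) Cl))"
  proof -
    have "\<Union> (fv ` insert (\<^bold>\<not> G) Cl) = {}" using G by (auto simp: Cl_def)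
    then show ?thesis by (simp only: finite.emptyI)
  qed
  moreover have "\<forall>A\<in>insert (\<^bold>\<not> G) Cl. is_fm L A" using G by (auto simp: Cl_def)
  ultimately obtain H where sub: "insert (\<^bold>\<not> G) Cl \<subseteq> H" and H: "henkin L H"
    using henkin_extension by metis
  let ?S = "term_struct L H"
  have "\<exists>e. env_in L ?S e \<and> sat ?S e [] G"
  proof (rule valid)
    fix A e assume A: "A \<in> X" "is_fm L A" and e: "env_in L ?S e"
    have "deriv L X {} A" using A by (rule deriv.Axm)
    from universal_closure[OF this A(2), of ?S] obtain C where
      C: "deriv L X {} C" "is_fm L C" "fv C = {}" and
      closure: "(\<forall>e. env_in L ?S e \<longrightarrow> sat ?S e [] C) \<longrightarrow> (\<forall>e. env_in L ?S e \<longrightarrow> sat ?S e [] A)" by blast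
    have "C \<in> H" using C sub by (auto simp: Cl_def)
    then have "sat ?S e' [] C" if "env_in L ?S e'" for e'
      using truth[OF H C(2)] that C(3) by (simp add: env_in_term_struct psub_closed)
    then show "sat ?S e [] A" using closure e by blast
  next
    fix \<sigma> \<tau> assume "Dom ?S \<sigma> \<inter> Dom ?S \<tau> \<noteq> {}"
    then show "\<sigma> = \<tau>" by (auto dest: is_tm_unique)
  next
    fix \<tau> assume "ty_in L \<tau>"
    then have "is_tm L (Fr (undefined, \<tau>)) \<tau>" by simp
    then show "Dom ?S \<tau> \<noteq> {}" by (auto simp del: is_tm_simps)
  qed auto
  then obtain e where e: "env L e" "sat ?S e [] G" by (auto simp: env_in_term_struct)
  then have "G \<in> H" using truth[OF H G(1) e(1)] G(2) by (simp add: psub_closed)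
  moreover have "(\<^bold>\<not> G) \<in> H" using sub by simp
  ultimately have "FBot \<in> H" using henkin_imp[OF H, of G FBot] G by simp
  then show False using henkin_bot[OF H] by simp
qed

lemma is_tm_lam_iff [simp]:
  "ty_in L (snd v) \<Longrightarrow> is_tm L (lam v t) \<rho> \<longleftrightarrow> (\<exists>\<tau>. \<rho> = snd v \<Rrightarrow> \<tau> \<and> is_tm L t \<tau>)"
proof
  assume ty: "ty_in L (snd v)" and t: "is_tm L (lam v t) \<rho>"
  show "\<exists>\<tau>. \<rho> = snd v \<Rrightarrow> \<tau> \<and> is_tm L t \<tau>"
    using t
  proof (induction t arbitrary: \<rho>)
    case (Ap s t)
    show ?case
    proof (cases "v \<in> fv_tm (s \<cdot> t)")
      case True
      then have "is_tm L (lam v s) (snd v \<Rrightarrow> typeof t \<Rrightarrow> typeof (s \<cdot> t))"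
        "is_tm L (lam v t) (snd v \<Rrightarrow> typeof t)" "\<rho> = snd v \<Rrightarrow> typeof (s \<cdot> t)"
        using Ap.prems by (auto simp: lam.simps simp del: typeof.simps)
      then have "is_tm L s (typeof t \<Rrightarrow> typeof (s \<cdot> t))" "is_tm L t (typeof t)"
        using Ap.IH by fastforce+
      with \<open>\<rho> = _\<close> show ?thesis by (auto simp del: typeof.simps)
    qed (use Ap.prems in \<open>auto simp: lam.simps const_lam_def simp del: typeof.simps\<close>)
  qed (auto simp: lam.simps const_lam_def id_lam_def split: if_splits)
qed (auto intro: is_tm_lam)

lemma env_in_upd [simp]: "env_in L S e \<Longrightarrow> d \<in> Dom S (snd v) \<Longrightarrow> env_in L S (e(v := d))"
  by (cases v) (auto simp: env_in_def)

lemma env_inD: "env_in L S e \<Longrightarrow> ty_in L (snd v) \<Longrightarrow> e v \<in> Dom S (snd v)"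
  unfolding env_in_def by blast

section \<open>Models\<close>

text \<open>These are the facts shared by the quotient of a whole structure and that of its standard
  part. \<open>induct6\<close> is induction for a single propositional pattern of equations between
  elements of type 1, which is wide enough for disjunctions and implications.\<close>

locale model =
  fixes S :: "'a struct"
  assumes equ_eq [simp]: "equ S x y \<longleftrightarrow> x = y"
    and app_closed: "x \<in> Dom S (\<sigma> \<Rrightarrow> \<tau>) \<Longrightarrow> y \<in> Dom S \<sigma> \<Longrightarrow> app S x y \<in> Dom S \<tau>"
    and con_closed: "cn_in Base c \<Longrightarrow> con S c \<in> Dom S (cty c)"
    and comb_K: "star_free \<sigma> \<Longrightarrow> star_free \<tau> \<Longrightarrow> x \<in> Dom S \<sigma> \<Longrightarrow> y \<in> Dom S \<tau> \<Longrightarrow>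
      app S (app S (con S (cK \<sigma> \<tau>)) x) y = x"
    and comb_S: "star_free \<rho> \<Longrightarrow> star_free \<sigma> \<Longrightarrow> star_free \<tau> \<Longrightarrow>
      x \<in> Dom S (\<rho> \<Rrightarrow> \<sigma> \<Rrightarrow> \<tau>) \<Longrightarrow> y \<in> Dom S (\<rho> \<Rrightarrow> \<sigma>) \<Longrightarrow> z \<in> Dom S \<rho> \<Longrightarrow>
      app S (app S (app S (con S (cS \<rho> \<sigma> \<tau>)) x) y) z = app S (app S x z) (app S y z)"
    and suc_inj: "x \<in> Dom S N \<Longrightarrow> y \<in> Dom S N \<Longrightarrow>
      app S (con S cSucc) x = app S (con S cSucc) y \<Longrightarrow> x = y"
    and suc_nz: "x \<in> Dom S N \<Longrightarrow> app S (con S cSucc) x \<noteq> con S cZero"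
    and rec_0: "a \<in> Dom S N \<Longrightarrow> h \<in> Dom S (N \<Rrightarrow> N \<Rrightarrow> N) \<Longrightarrow>
      app S (app S (app S (con S cRec) (con S cZero)) a) h = a"
    and rec_suc: "n \<in> Dom S N \<Longrightarrow> a \<in> Dom S N \<Longrightarrow> h \<in> Dom S (N \<Rrightarrow> N \<Rrightarrow> N) \<Longrightarrow>
      app S (app S (app S (con S cRec) (app S (con S cSucc) n)) a) h =
      app S (app S h (app S (app S (app S (con S cRec) n) a) h)) n"
    and induct6: "\<forall>f\<in>{f1, g1, f2, g2, f3, g3}. f \<in> Dom S T1 \<Longrightarrow>
      P = (\<lambda>x. (app S f1 x = app S g1 x \<longrightarrow> app S f2 x = app S g2 x) \<longrightarrow> app S f3 x = app S g3 x) \<Longrightarrow>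
      P (con S cZero) \<Longrightarrow> (\<And>x. x \<in> Dom S N \<Longrightarrow> P x \<Longrightarrow> P (app S (con S cSucc) x)) \<Longrightarrow>
      x \<in> Dom S N \<Longrightarrow> P x"
begin

abbreviation D :: "ty \<Rightarrow> 'a set" where "D \<equiv> Dom S"
abbreviation ap :: "'a \<Rightarrow> 'a \<Rightarrow> 'a" (infixl "\<bullet>" 200) where "x \<bullet> y \<equiv> app S x y"
abbreviation Z :: 'a where "Z \<equiv> con S cZero"
abbreviation Sc :: "'a \<Rightarrow> 'a" where "Sc x \<equiv> con S cSucc \<bullet> x"

lemma app_closed_types [simp]:
  "x \<in> D T1 \<Longrightarrow> y \<in> D N \<Longrightarrow> x \<bullet> y \<in> D N"
  "x \<in> D T2 \<Longrightarrow> y \<in> D T1 \<Longrightarrow> x \<bullet> y \<in> D N"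
  "x \<in> D T3 \<Longrightarrow> y \<in> D T2 \<Longrightarrow> x \<bullet> y \<in> D N"
  "x \<in> D T3' \<Longrightarrow> y \<in> D T2 \<Longrightarrow> x \<bullet> y \<in> D T2"
  by (rule app_closed, assumption+)+

lemma con_closed_types [simp]:
  "Z \<in> D N" "x \<in> D N \<Longrightarrow> Sc x \<in> D N"
  "con S cRec \<in> D (N \<Rrightarrow> N \<Rrightarrow> (N \<Rrightarrow> N \<Rrightarrow> N) \<Rrightarrow> N)"
  using con_closed[of cZero] con_closed[of cSucc] con_closed[of cRec] by (auto intro: app_closed)

lemma suc_simps [simp]: "x \<in> D N \<Longrightarrow> Sc x \<noteq> Z" "x \<in> D N \<Longrightarrow> Z \<noteq> Sc x"
  "x \<in> D N \<Longrightarrow> y \<in> D N \<Longrightarrow> Sc x = Sc y \<longleftrightarrow> x = y"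
  using suc_nz suc_inj by metis+

lemma Dom_nonempty: "star_free \<tau> \<Longrightarrow> \<exists>d. d \<in> D \<tau>"
proof (induction \<tau>)
  case N
  then show ?case using con_closed_types(1) by blast
next
  case (Fun \<sigma> \<tau>)
  then obtain d where "d \<in> D \<tau>" by auto
  then have "con S (cK \<tau> \<sigma>) \<bullet> d \<in> D (\<sigma> \<Rrightarrow> \<tau>)"
    using Fun.prems con_closed[of "cK \<tau> \<sigma>"] by (auto intro: app_closed)
  then show ?case by blast
qed simp

definition e0 :: "var \<Rightarrow> 'a" where "e0 v = (SOME d. d \<in> D (snd v))"

lemma env_e0 [simp]: "env_in Base S e0"
  unfolding env_in_def e0_def using Dom_nonempty by (auto intro: someI_ex)

lemma eval_closed: "is_tm Base t \<tau> \<Longrightarrow> env_in Base S e \<Longrightarrow> eval S e bs t \<in> D \<tau>"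
  by (induction t arbitrary: \<tau>) (auto simp: env_in_def intro: app_closed con_closed)

lemma eval_lam:
  assumes "is_tm Base t \<tau>" "star_free (snd v)" "env_in Base S e" "d \<in> D (snd v)"
  shows "eval S e bs (lam v t) \<bullet> d = eval S (e(v := d)) bs t"
  using assms(1)
proof (induction t arbitrary: \<tau>)
  case (Bd n)
  then show ?case by simp
next
  case (Fr w)
  let ?\<tau> = "snd v"
  have "con S (cS ?\<tau> (?\<tau> \<Rrightarrow> ?\<tau>) ?\<tau>) \<bullet> con S (cK ?\<tau> (?\<tau> \<Rrightarrow> ?\<tau>)) \<bullet> con S (cK ?\<tau> ?\<tau>) \<bullet> d = d"
    using assms con_closed[of "cK ?\<tau> (?\<tau> \<Rrightarrow> ?\<tau>)"] con_closed[of "cK ?\<tau> ?\<tau>"]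
    by (subst comb_S) (auto intro!: comb_K intro: app_closed)
  moreover have "star_free (snd w)" "e w \<in> D (snd w)" using Fr env_inD[OF assms(3), of w] by auto
  ultimately show ?case using Fr assms
    by (auto simp: lam.simps id_lam_def const_lam_def comb_K)
next
  case (Cn c)
  then show ?case using assms ty_in_cty[of Base c] con_closed[of c]
    by (simp add: lam.simps const_lam_def comb_K)
next
  case (Ap s t)
  from Ap.prems obtain \<sigma> where st: "is_tm Base s (\<sigma> \<Rrightarrow> \<tau>)" "is_tm Base t \<sigma>" by auto
  have ty: "typeof s = \<sigma> \<Rrightarrow> \<tau>" "typeof t = \<sigma>" "star_free \<sigma>" "star_free \<tau>"
    using typeof_is_tm[OF st(1)] typeof_is_tm[OF st(2)] is_tm_ty_in[OF st(1)] by auto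
  show ?case
  proof (cases "v \<in> fv_tm (s \<cdot> t)")
    case False
    have "eval S e bs (s \<cdot> t) \<in> D \<tau>" using eval_closed[OF Ap.prems assms(3)] .
    then show ?thesis unfolding eval_upd[OF False] using False assms ty
      by (simp add: lam.simps const_lam_def comb_K)
  next
    case True
    have "eval S e bs (lam v s) \<in> D (snd v \<Rrightarrow> \<sigma> \<Rrightarrow> \<tau>)" "eval S e bs (lam v t) \<in> D (snd v \<Rrightarrow> \<sigma>)"
      using st assms by (auto intro!: eval_closed)
    then show ?thesis using True assms ty Ap.IH(1)[OF st(1)] Ap.IH(2)[OF st(2)]
      by (simp add: lam.simps comb_S)
  qed
qed

subsection \<open>Representable functions\<close>

text \<open>Functions induced by an element of the model. Induction is available for equations
  between these, so the closure lemmas for \<open>rep\<close> take the place of a syntactic check of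
  the induction formula.\<close>

definition rep :: "ty \<Rightarrow> ty \<Rightarrow> ('a \<Rightarrow> 'a) \<Rightarrow> bool" where
  "rep \<sigma> \<tau> F \<longleftrightarrow> star_free \<sigma> \<and> star_free \<tau> \<and> (\<exists>f\<in>D (\<sigma> \<Rrightarrow> \<tau>). \<forall>x\<in>D \<sigma>. f \<bullet> x = F x)"

lemma rep_id: "star_free \<sigma> \<Longrightarrow> rep \<sigma> \<sigma> (\<lambda>x. x)"
  using eval_lam[of "Fr ([], \<sigma>)" \<sigma> "([], \<sigma>)" e0 _ "[]"] eval_closed[of "lam ([], \<sigma>) (Fr ([], \<sigma>))" "\<sigma> \<Rrightarrow> \<sigma>" e0 "[]"]
  by (auto simp: rep_def)

lemma rep_const: "c \<in> D \<tau> \<Longrightarrow> star_free \<sigma> \<Longrightarrow> star_free \<tau> \<Longrightarrow> rep \<sigma> \<tau> (\<lambda>x. c)"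
  using con_closed[of "cK \<tau> \<sigma>"] unfolding rep_def
  by (auto simp: comb_K intro!: bexI[of _ "con S (cK \<tau> \<sigma>) \<bullet> c"] intro: app_closed)

lemma rep_app: "rep \<sigma> (\<rho> \<Rrightarrow> \<tau>) F \<Longrightarrow> rep \<sigma> \<rho> G \<Longrightarrow> rep \<sigma> \<tau> (\<lambda>x. F x \<bullet> G x)"
proof -
  assume "rep \<sigma> (\<rho> \<Rrightarrow> \<tau>) F" "rep \<sigma> \<rho> G"
  then obtain f g where ty: "star_free \<sigma>" "star_free \<rho>" "star_free \<tau>" and
    f: "f \<in> D (\<sigma> \<Rrightarrow> \<rho> \<Rrightarrow> \<tau>)" "\<forall>x\<in>D \<sigma>. f \<bullet> x = F x" and g: "g \<in> D (\<sigma> \<Rrightarrow> \<rho>)" "\<forall>x\<in>D \<sigma>. g \<bullet> x = G x"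
    by (auto simp: rep_def)
  have "con S (cS \<sigma> \<rho> \<tau>) \<in> D ((\<sigma> \<Rrightarrow> \<rho> \<Rrightarrow> \<tau>) \<Rrightarrow> (\<sigma> \<Rrightarrow> \<rho>) \<Rrightarrow> \<sigma> \<Rrightarrow> \<tau>)"
    using con_closed[of "cS \<sigma> \<rho> \<tau>"] ty by simp
  then have "con S (cS \<sigma> \<rho> \<tau>) \<bullet> f \<bullet> g \<in> D (\<sigma> \<Rrightarrow> \<tau>)" using f g by (blast intro: app_closed)
  moreover have "con S (cS \<sigma> \<rho> \<tau>) \<bullet> f \<bullet> g \<bullet> x = F x \<bullet> G x" if "x \<in> D \<sigma>" for x
    using comb_S[OF ty f(1) g(1) that] f(2) g(2) that by simp
  ultimately show ?thesis using ty by (auto simp: rep_def)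
qed

lemma rep_suc: "rep \<sigma> N F \<Longrightarrow> rep \<sigma> N (\<lambda>x. Sc (F x))"
  using rep_app[OF rep_const[of "con S cSucc" T1 \<sigma>], of F] con_closed[of cSucc] by (simp add: rep_def)

lemma induct_or:
  assumes "rep N N F1" "rep N N G1" "rep N N F2" "rep N N G2"
    and "F1 Z = G1 Z \<or> F2 Z = G2 Z"
    and "\<And>x. x \<in> D N \<Longrightarrow> F1 x = G1 x \<or> F2 x = G2 x \<Longrightarrow> F1 (Sc x) = G1 (Sc x) \<or> F2 (Sc x) = G2 (Sc x)"
    and "x \<in> D N"
  shows "F1 x = G1 x \<or> F2 x = G2 x"
proof -
  from assms(1-4) obtain f1 g1 f2 g2 where reps:
    "f1 \<in> D T1" "\<forall>x\<in>D N. f1 \<bullet> x = F1 x" "g1 \<in> D T1" "\<forall>x\<in>D N. g1 \<bullet> x = G1 x"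
    "f2 \<in> D T1" "\<forall>x\<in>D N. f2 \<bullet> x = F2 x" "g2 \<in> D T1" "\<forall>x\<in>D N. g2 \<bullet> x = G2 x"
    by (auto simp: rep_def)
  \<comment> \<open>Disjunction is the pattern of \<open>induct6\<close> with the false equation 0 =
    1 in the middle: (E1 \<longrightarrow> 0 = 1) \<longrightarrow> E2. The two constant functions
    provide this equation.\<close>
  have "rep N N (\<lambda>x. Z)" "rep N N (\<lambda>x. Sc Z)" by (rule rep_const; simp)+
  then obtain z u where zu: "z \<in> D T1" "\<forall>x\<in>D N. z \<bullet> x = Z" "u \<in> D T1" "\<forall>x\<in>D N. u \<bullet> x = Sc Z"
    by (auto simp: rep_def)
  let ?P = "\<lambda>x. (f1 \<bullet> x = g1 \<bullet> x \<longrightarrow> z \<bullet> x = u \<bullet> x) \<longrightarrow> f2 \<bullet> x = g2 \<bullet> x"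
  have iff: "?P y \<longleftrightarrow> F1 y = G1 y \<or> F2 y = G2 y" if "y \<in> D N" for y
    using reps zu that by auto
  have "?P x"
  proof (rule induct6[of f1 g1 z u f2 g2 ?P, OF _ refl _ _ assms(7)])
    show "?P Z" using iff[of Z] assms(5) by simp
    show "?P (Sc y)" if "y \<in> D N" "?P y" for y
      using iff[of y] iff[of "Sc y"] assms(6)[of y] that by simp
  qed (use reps zu in simp)
  then show ?thesis using iff[OF assms(7)] by simp
qed

lemma induct_imp:
  assumes "rep N N F1" "rep N N G1" "rep N N F2" "rep N N G2"
    and "F1 Z = G1 Z \<Longrightarrow> F2 Z = G2 Z"
    and "\<And>x. x \<in> D N \<Longrightarrow> (F1 x = G1 x \<Longrightarrow> F2 x = G2 x) \<Longrightarrow> F1 (Sc x) = G1 (Sc x) \<Longrightarrow> F2 (Sc x) = G2 (Sc x)"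
    and "x \<in> D N" "F1 x = G1 x"
  shows "F2 x = G2 x"
proof -
  from assms(1-4) obtain f1 g1 f2 g2 where reps:
    "f1 \<in> D T1" "\<forall>x\<in>D N. f1 \<bullet> x = F1 x" "g1 \<in> D T1" "\<forall>x\<in>D N. g1 \<bullet> x = G1 x"
    "f2 \<in> D T1" "\<forall>x\<in>D N. f2 \<bullet> x = F2 x" "g2 \<in> D T1" "\<forall>x\<in>D N. g2 \<bullet> x = G2 x"
    by (auto simp: rep_def)
  \<comment> \<open>The first equation is trivially true, which leaves the implication between the
    other two.\<close>
  let ?P = "\<lambda>x. (f1 \<bullet> x = f1 \<bullet> x \<longrightarrow> f1 \<bullet> x = g1 \<bullet> x) \<longrightarrow> f2 \<bullet> x = g2 \<bullet> x"
  have "?P x"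
    by (rule induct6[of f1 f1 f1 g1 f2 g2 ?P]) (use reps assms(5-7) in auto)
  then show ?thesis using reps assms(7,8) by auto
qed

lemma induct_eq:
  assumes "rep N N F" "rep N N G" "F Z = G Z"
    and "\<And>x. x \<in> D N \<Longrightarrow> F x = G x \<Longrightarrow> F (Sc x) = G (Sc x)" and "x \<in> D N"
  shows "F x = G x"
  using induct_or[OF assms(1,2,1,2)] assms by blast

subsection \<open>Arithmetic\<close>

definition "Pre x = eval S e0 [] predC \<bullet> x"
definition "Add x y = eval S e0 [] addC \<bullet> x \<bullet> y"
definition "Monus x y = eval S e0 [] monusC \<bullet> x \<bullet> y"
definition "Ifz x y z = eval S e0 [] ifzC \<bullet> x \<bullet> y \<bullet> z"
definition "Tri x = eval S e0 [] triC \<bullet> x"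
definition "Cpair x y = eval S e0 [] pairC \<bullet> x \<bullet> y"
definition "Root x = eval S e0 [] rootC \<bullet> x"
definition "Fst x = eval S e0 [] fstC \<bullet> x"
definition "Snd x = eval S e0 [] sndC \<bullet> x"
definition "Snoc x y = eval S e0 [] snocC \<bullet> x \<bullet> y"
definition "Butlast x = eval S e0 [] butlastC \<bullet> x"
definition "Last x = eval S e0 [] lastC \<bullet> x"
definition "Bar f x = eval S e0 [] barC \<bullet> f \<bullet> x"
definition "Drop x y = eval S e0 [] dropC \<bullet> x \<bullet> y"
definition "Lh x = eval S e0 [] lhC \<bullet> x"
definition "Pad x = eval S e0 [] padC \<bullet> x"

lemma eval_is_closed: "is_tm Base t \<tau> \<Longrightarrow> fv_tm t = {} \<Longrightarrow> eval S e bs t = eval S e0 [] t"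
  using eval_closed_terms[of Base t \<tau>] by (auto simp: is_tm_def)

lemma eval_closed_apps [simp]:
  "eval S e bs predC \<bullet> x = Pre x" "eval S e bs addC \<bullet> x \<bullet> y = Add x y"
  "eval S e bs monusC \<bullet> x \<bullet> y = Monus x y" "eval S e bs ifzC \<bullet> x \<bullet> y \<bullet> z = Ifz x y z"
  "eval S e bs triC \<bullet> x = Tri x" "eval S e bs pairC \<bullet> x \<bullet> y = Cpair x y"
  "eval S e bs rootC \<bullet> x = Root x" "eval S e bs fstC \<bullet> x = Fst x" "eval S e bs sndC \<bullet> x = Snd x"
  "eval S e bs snocC \<bullet> x \<bullet> y = Snoc x y" "eval S e bs butlastC \<bullet> x = Butlast x"
  "eval S e bs lastC \<bullet> x = Last x" "eval S e bs barC \<bullet> f \<bullet> x = Bar f x"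
  "eval S e bs dropC \<bullet> x \<bullet> y = Drop x y" "eval S e bs lhC \<bullet> x = Lh x" "eval S e bs padC \<bullet> x = Pad x"
  by (simp_all add: Pre_def Add_def Monus_def Ifz_def Tri_def Cpair_def Root_def Fst_def Snd_def
    Snoc_def Butlast_def Last_def Bar_def Drop_def Lh_def Pad_def
    is_tm_closed_terms[THEN eval_is_closed, of e bs])

lemmas closed_terms = is_tm_closed_terms[where L = Base, THEN eval_closed, OF env_e0]

lemma arith_closed [simp]:
  "x \<in> D N \<Longrightarrow> Pre x \<in> D N" "x \<in> D N \<Longrightarrow> y \<in> D N \<Longrightarrow> Add x y \<in> D N"
  "x \<in> D N \<Longrightarrow> y \<in> D N \<Longrightarrow> Monus x y \<in> D N"
  "x \<in> D N \<Longrightarrow> y \<in> D N \<Longrightarrow> z \<in> D N \<Longrightarrow> Ifz x y z \<in> D N"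
  "x \<in> D N \<Longrightarrow> Tri x \<in> D N" "x \<in> D N \<Longrightarrow> y \<in> D N \<Longrightarrow> Cpair x y \<in> D N" "x \<in> D N \<Longrightarrow> Root x \<in> D N"
  "x \<in> D N \<Longrightarrow> Fst x \<in> D N" "x \<in> D N \<Longrightarrow> Snd x \<in> D N" "x \<in> D N \<Longrightarrow> y \<in> D N \<Longrightarrow> Snoc x y \<in> D N"
  "x \<in> D N \<Longrightarrow> Butlast x \<in> D N" "x \<in> D N \<Longrightarrow> Last x \<in> D N"
  "f \<in> D T1 \<Longrightarrow> x \<in> D N \<Longrightarrow> Bar f x \<in> D N" "x \<in> D N \<Longrightarrow> y \<in> D N \<Longrightarrow> Drop x y \<in> D N"
  "x \<in> D N \<Longrightarrow> Lh x \<in> D N" "x \<in> D N \<Longrightarrow> Pad x \<in> D T1"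
  unfolding Pre_def Add_def Monus_def Ifz_def Tri_def Cpair_def Root_def Fst_def Snd_def
    Snoc_def Butlast_def Last_def Bar_def Drop_def Lh_def Pad_def
  by (assumption | rule closed_terms | rule app_closed)+

lemma rep_ap1: "c \<in> D (\<rho> \<Rrightarrow> \<tau>) \<Longrightarrow> star_free \<tau> \<Longrightarrow> rep \<sigma> \<rho> F \<Longrightarrow> rep \<sigma> \<tau> (\<lambda>x. c \<bullet> F x)"
  by (rule rep_app[OF rep_const[of c "\<rho> \<Rrightarrow> \<tau>" \<sigma>]]) (auto simp: rep_def)

lemma rep_ap2: "c \<in> D (\<rho> \<Rrightarrow> \<rho>' \<Rrightarrow> \<tau>) \<Longrightarrow> star_free \<tau> \<Longrightarrow> rep \<sigma> \<rho> F \<Longrightarrow> rep \<sigma> \<rho>' G \<Longrightarrow>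
    rep \<sigma> \<tau> (\<lambda>x. c \<bullet> F x \<bullet> G x)"
  by (rule rep_app[OF rep_ap1[of c \<rho> "\<rho>' \<Rrightarrow> \<tau>"]]) (auto simp: rep_def)

lemma rep_closed_apps:
  "rep \<sigma> N F \<Longrightarrow> rep \<sigma> N (\<lambda>x. Pre (F x))"
  "rep \<sigma> N F \<Longrightarrow> rep \<sigma> N G \<Longrightarrow> rep \<sigma> N (\<lambda>x. Add (F x) (G x))"
  "rep \<sigma> N F \<Longrightarrow> rep \<sigma> N G \<Longrightarrow> rep \<sigma> N (\<lambda>x. Monus (F x) (G x))"
  "rep \<sigma> N F \<Longrightarrow> rep \<sigma> N G \<Longrightarrow> rep \<sigma> N H \<Longrightarrow> rep \<sigma> N (\<lambda>x. Ifz (F x) (G x) (H x))"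
  "rep \<sigma> N F \<Longrightarrow> rep \<sigma> N (\<lambda>x. Tri (F x))"
  "rep \<sigma> N F \<Longrightarrow> rep \<sigma> N (\<lambda>x. Root (F x))"
  "rep \<sigma> T1 K \<Longrightarrow> rep \<sigma> N F \<Longrightarrow> rep \<sigma> N (\<lambda>x. Bar (K x) (F x))"
  "rep \<sigma> N F \<Longrightarrow> rep \<sigma> N G \<Longrightarrow> rep \<sigma> N (\<lambda>x. Drop (F x) (G x))"
  unfolding Pre_def Add_def Monus_def Ifz_def Tri_def Root_def Bar_def Drop_def
proof -
  show "rep \<sigma> N (\<lambda>x. eval S e0 [] predC \<bullet> F x)" if "rep \<sigma> N F"
    by (rule rep_ap1[OF closed_terms(1)]) (use that in auto)
  show "rep \<sigma> N (\<lambda>x. eval S e0 [] addC \<bullet> F x \<bullet> G x)" if "rep \<sigma> N F" "rep \<sigma> N G"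
    by (rule rep_ap2[OF closed_terms(2)]) (use that in auto)
  show "rep \<sigma> N (\<lambda>x. eval S e0 [] monusC \<bullet> F x \<bullet> G x)" if "rep \<sigma> N F" "rep \<sigma> N G"
    by (rule rep_ap2[OF closed_terms(3)]) (use that in auto)
  show "rep \<sigma> N (\<lambda>x. eval S e0 [] ifzC \<bullet> F x \<bullet> G x \<bullet> H x)" if "rep \<sigma> N F" "rep \<sigma> N G" "rep \<sigma> N H"
    by (rule rep_app[OF rep_ap2[OF closed_terms(4)]]) (use that in auto)
  show "rep \<sigma> N (\<lambda>x. eval S e0 [] triC \<bullet> F x)" if "rep \<sigma> N F"
    by (rule rep_ap1[OF closed_terms(5)]) (use that in auto)
  show "rep \<sigma> N (\<lambda>x. eval S e0 [] rootC \<bullet> F x)" if "rep \<sigma> N F"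
    by (rule rep_ap1[OF closed_terms(7)]) (use that in auto)
  show "rep \<sigma> N (\<lambda>x. eval S e0 [] barC \<bullet> K x \<bullet> F x)" if "rep \<sigma> T1 K" "rep \<sigma> N F"
    by (rule rep_ap2[OF closed_terms(13)]) (use that in auto)
  show "rep \<sigma> N (\<lambda>x. eval S e0 [] dropC \<bullet> F x \<bullet> G x)" if "rep \<sigma> N F" "rep \<sigma> N G"
    by (rule rep_ap2[OF closed_terms(14)]) (use that in auto)
qed

lemmas reps = rep_const rep_id rep_suc rep_closed_apps rep_app[of N N N]

lemma rec_closed: "a \<in> D N \<Longrightarrow> h \<in> D (N \<Rrightarrow> N \<Rrightarrow> N) \<Longrightarrow> n \<in> D N \<Longrightarrow> con S cRec \<bullet> n \<bullet> a \<bullet> h \<in> D N"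
  using app_closed con_closed_types(3) by blast

lemmas eval_lam' = eval_lam[of _ _ "(x, \<sigma>)" for x \<sigma>, simplified]

text \<open>Joins the recursor to the two abstractions of its step function, so that an arithmetical
  term gets its recursion equations by evaluating the body in an extended environment.\<close>

lemma rec_step:
  assumes "is_tm Base t N" "env_in Base S e" "a \<in> D N"
  shows "con S cRec \<bullet> Z \<bullet> a \<bullet> eval S e bs (lam (x, N) (lam (y, N) t)) = a"
    "n \<in> D N \<Longrightarrow> con S cRec \<bullet> Sc n \<bullet> a \<bullet> eval S e bs (lam (x, N) (lam (y, N) t)) =
      eval S (e((x, N) := con S cRec \<bullet> n \<bullet> a \<bullet> eval S e bs (lam (x, N) (lam (y, N) t)), (y, N) := n)) bs t"
proof -
  have h: "eval S e bs (lam (x, N) (lam (y, N) t)) \<in> D (N \<Rrightarrow> N \<Rrightarrow> N)"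
    using assms by (intro eval_closed) auto
  show "con S cRec \<bullet> Z \<bullet> a \<bullet> eval S e bs (lam (x, N) (lam (y, N) t)) = a"
    using rec_0[OF assms(3) h] .
  assume n: "n \<in> D N"
  have r: "con S cRec \<bullet> n \<bullet> a \<bullet> eval S e bs (lam (x, N) (lam (y, N) t)) \<in> D N"
    by (rule rec_closed) (use assms h n in auto)
  show "con S cRec \<bullet> Sc n \<bullet> a \<bullet> eval S e bs (lam (x, N) (lam (y, N) t)) =
      eval S (e((x, N) := con S cRec \<bullet> n \<bullet> a \<bullet> eval S e bs (lam (x, N) (lam (y, N) t)), (y, N) := n)) bs t"
    unfolding rec_suc[OF n assms(3) h]
    using eval_lam[of "lam (y, N) t" "N \<Rrightarrow> N" "(x, N)" e _ bs] r
      eval_lam[of t N "(y, N)" "e((x, N) := con S cRec \<bullet> n \<bullet> a \<bullet> eval S e bs (lam (x, N) (lam (y, N) t)))" n bs]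
      assms n by simp
qed

section \<open>Recursion equations of the arithmetical terms\<close>

lemma Pre_simps [simp]: "Pre Z = Z" "x \<in> D N \<Longrightarrow> Pre (Sc x) = x"
  unfolding Pre_def predC_def by (simp_all add: eval_lam' rec_step eval_upd)

lemma Add_simps [simp]: "x \<in> D N \<Longrightarrow> Add x Z = x"
  "x \<in> D N \<Longrightarrow> y \<in> D N \<Longrightarrow> Add x (Sc y) = Sc (Add x y)"
  unfolding Add_def addC_def by (simp_all add: eval_lam' rec_step eval_upd)

lemma Monus_simps [simp]: "x \<in> D N \<Longrightarrow> Monus x Z = x"
  "x \<in> D N \<Longrightarrow> y \<in> D N \<Longrightarrow> Monus x (Sc y) = Pre (Monus x y)"
  unfolding Monus_def monusC_def by (simp_all add: eval_lam' rec_step eval_upd)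

lemma Ifz_simps [simp]: "x \<in> D N \<Longrightarrow> y \<in> D N \<Longrightarrow> Ifz Z x y = x"
  "x \<in> D N \<Longrightarrow> y \<in> D N \<Longrightarrow> c \<in> D N \<Longrightarrow> Ifz (Sc c) x y = y"
  unfolding Ifz_def ifzC_def by (simp_all add: eval_lam' rec_step eval_upd)

lemma Tri_simps [simp]: "Tri Z = Z" "x \<in> D N \<Longrightarrow> Tri (Sc x) = Add (Tri x) (Sc x)"
  unfolding Tri_def triC_def by (simp_all add: eval_lam' rec_step eval_upd)

lemma Cpair_eq: "x \<in> D N \<Longrightarrow> y \<in> D N \<Longrightarrow> Cpair x y = Add (Tri (Add x y)) x"
  unfolding Cpair_def pairC_def by (simp add: eval_lam')

lemma Root_simps: "Root Z = Z"
  "x \<in> D N \<Longrightarrow> Root (Sc x) = Ifz (Monus (Tri (Sc (Root x))) (Sc x)) (Sc (Root x)) (Root x)"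
  unfolding Root_def rootC_def by (simp_all add: eval_lam' rec_step eval_upd)

lemma Fst_eq: "x \<in> D N \<Longrightarrow> Fst x = Monus x (Tri (Root x))"
  unfolding Fst_def fstC_def by (simp add: eval_lam')
lemma Snd_eq: "x \<in> D N \<Longrightarrow> Snd x = Monus (Root x) (Fst x)"
  unfolding Snd_def sndC_def by (simp add: eval_lam')
lemma Snoc_eq: "x \<in> D N \<Longrightarrow> y \<in> D N \<Longrightarrow> Snoc x y = Sc (Cpair x y)"
  unfolding Snoc_def snocC_def by (simp add: eval_lam')
lemma Butlast_eq: "x \<in> D N \<Longrightarrow> Butlast x = Fst (Pre x)"
  unfolding Butlast_def butlastC_def by (simp add: eval_lam')
lemma Last_eq: "x \<in> D N \<Longrightarrow> Last x = Snd (Pre x)"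
  unfolding Last_def lastC_def by (simp add: eval_lam')

lemma Bar_simps [simp]: "f \<in> D T1 \<Longrightarrow> Bar f Z = Z"
  "f \<in> D T1 \<Longrightarrow> n \<in> D N \<Longrightarrow> Bar f (Sc n) = Snoc (Bar f n) (f \<bullet> n)"
  unfolding Bar_def barC_def by (simp_all add: eval_lam' rec_step eval_upd)

lemma Drop_simps [simp]: "s \<in> D N \<Longrightarrow> Drop s Z = s"
  "s \<in> D N \<Longrightarrow> n \<in> D N \<Longrightarrow> Drop s (Sc n) = Butlast (Drop s n)"
  unfolding Drop_def dropC_def by (simp_all add: eval_lam' rec_step eval_upd)

lemma Pad_app: "s \<in> D N \<Longrightarrow> i \<in> D N \<Longrightarrow>
    Pad s \<bullet> i = Ifz (Monus (Sc i) (Lh s)) (Last (Drop s (Monus (Lh s) (Sc i)))) Z"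
  unfolding Pad_def padC_def by (simp add: eval_lam')

section \<open>Laws of addition and truncated subtraction\<close>

lemma Add_Z [simp]: "x \<in> D N \<Longrightarrow> Add Z x = x"
  by (rule induct_eq[where F = "\<lambda>x. Add Z x"]) (intro reps | simp)+

lemma Add_Sc [simp]: "x \<in> D N \<Longrightarrow> y \<in> D N \<Longrightarrow> Add (Sc x) y = Sc (Add x y)"
  by (rule induct_eq[where F = "\<lambda>y. Add (Sc x) y" and G = "\<lambda>y. Sc (Add x y)"]) (intro reps | simp)+

lemma Add_comm: "x \<in> D N \<Longrightarrow> y \<in> D N \<Longrightarrow> Add x y = Add y x"
  by (rule induct_eq[where F = "\<lambda>y. Add x y" and G = "\<lambda>y. Add y x"]) (intro reps | simp)+

lemma Add_assoc: "x \<in> D N \<Longrightarrow> y \<in> D N \<Longrightarrow> z \<in> D N \<Longrightarrow> Add (Add x y) z = Add x (Add y z)"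
  by (rule induct_eq[where F = "\<lambda>z. Add (Add x y) z" and G = "\<lambda>z. Add x (Add y z)"])
     (intro reps | simp)+

text \<open>Since subtracting a successor is taking the predecessor of a difference, this amounts to
  cancelling a successor on both sides.\<close>

lemma Pre_Monus_Sc: "x \<in> D N \<Longrightarrow> y \<in> D N \<Longrightarrow> Pre (Monus (Sc x) y) = Monus x y"
  by (rule induct_eq[where F = "\<lambda>y. Pre (Monus (Sc x) y)" and G = "\<lambda>y. Monus x y"]) (intro reps | simp)+

lemma Z_Monus [simp]: "x \<in> D N \<Longrightarrow> Monus Z x = Z"
  by (rule induct_eq[where F = "\<lambda>x. Monus Z x" and G = "\<lambda>x. Z"]) (intro reps | simp)+

lemma Monus_Add [simp]: "x \<in> D N \<Longrightarrow> y \<in> D N \<Longrightarrow> Monus (Add x y) x = y"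
  by (rule induct_eq[where F = "\<lambda>x. Monus (Add x y) x" and G = "\<lambda>x. y"])
     (intro reps | simp add: Pre_Monus_Sc)+

lemma Monus_Add_Add: "x \<in> D N \<Longrightarrow> y \<in> D N \<Longrightarrow> z \<in> D N \<Longrightarrow> Monus (Add x y) (Add x z) = Monus y z"
  by (rule induct_eq[where F = "\<lambda>x. Monus (Add x y) (Add x z)" and G = "\<lambda>x. Monus y z"])
     (intro reps | simp add: Pre_Monus_Sc)+

lemma Monus_self [simp]: "x \<in> D N \<Longrightarrow> Monus x x = Z"
  using Monus_Add[of x Z] by simp

text \<open>Even the case distinction is an induction. The predecessor is named by
  \<open>Pre\<close>, because the induction formula cannot contain an existential
  quantifier.\<close>

lemma cases_N: "x \<in> D N \<Longrightarrow> (x = Z \<Longrightarrow> R) \<Longrightarrow> (\<And>y. y \<in> D N \<Longrightarrow> x = Sc y \<Longrightarrow> R) \<Longrightarrow> R"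
proof -
  assume x: "x \<in> D N" and R: "x = Z \<Longrightarrow> R" "\<And>y. y \<in> D N \<Longrightarrow> x = Sc y \<Longrightarrow> R"
  have "x = Z \<or> x = Sc (Pre x)"
    by (rule induct_or[where ?F1.0 = "\<lambda>x. x" and ?G1.0 = "\<lambda>x. Z" and ?F2.0 = "\<lambda>x. x" and ?G2.0 = "\<lambda>x. Sc (Pre x)"])
       (use x in \<open>(intro reps | simp)+\<close>)
  then show R using R x arith_closed(1) by blast
qed

section \<open>The order\<close>

definition Le (infix "\<preceq>" 50) where "x \<preceq> y \<longleftrightarrow> Monus x y = Z"

lemma le_in_Le [simp]: "le_in S x y \<longleftrightarrow> x \<preceq> y"
  by (simp add: le_in_def Le_def)

text \<open>Supplies the witness behind the order: inequalities are then handled as equations y = x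
  + z.\<close>

lemma Le_Add: "x \<in> D N \<Longrightarrow> y \<in> D N \<Longrightarrow> x \<preceq> y \<Longrightarrow> Add x (Monus y x) = y"
proof (rule induct_imp[where ?F1.0 = "\<lambda>x. Monus x y" and ?G1.0 = "\<lambda>x. Z" and
      ?F2.0 = "\<lambda>x. Add x (Monus y x)" and ?G2.0 = "\<lambda>x. y"])
  fix x assume x: "x \<in> D N" and y: "y \<in> D N" and IH: "Monus x y = Z \<Longrightarrow> Add x (Monus y x) = y"
    and le: "Monus (Sc x) y = Z"
  have "Monus x y = Z" using Pre_Monus_Sc[OF x y] le by simp
  then have eq: "Add x (Monus y x) = y" by (rule IH)
  show "Add (Sc x) (Monus y (Sc x)) = y"
  proof (rule cases_N[of "Monus y x"])
    assume "Monus y x = Z"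
    \<comment> \<open>This case is impossible: with x = y the assumption x + 1 \<preceq> y would say
      1 = 0.\<close>
    then have "x = y" using eq x by simp
    then show ?thesis using le Monus_Add[OF x, of "Sc Z"] x by simp
  qed (use x y eq in simp_all)
qed (auto simp: Le_def intro!: reps)

lemma Le_iff: "x \<in> D N \<Longrightarrow> y \<in> D N \<Longrightarrow> x \<preceq> y \<longleftrightarrow> (\<exists>z\<in>D N. y = Add x z)"
  using Le_Add[of x y] Monus_Add_Add[of x Z] by (auto simp: Le_def intro!: bexI[of _ "Monus y x"])

lemma LeE: "x \<preceq> y \<Longrightarrow> x \<in> D N \<Longrightarrow> y \<in> D N \<Longrightarrow> (\<And>z. z \<in> D N \<Longrightarrow> y = Add x z \<Longrightarrow> R) \<Longrightarrow> R"
  using Le_iff by blast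

lemma Le_AddI [simp]: "x \<in> D N \<Longrightarrow> y \<in> D N \<Longrightarrow> x \<preceq> Add x y"
  using Le_iff[of x "Add x y"] by auto

lemma Le_refl [simp]: "x \<in> D N \<Longrightarrow> x \<preceq> x"
  by (simp add: Le_def)

lemma Z_Le [simp]: "x \<in> D N \<Longrightarrow> Z \<preceq> x"
  by (simp add: Le_def)

lemma Le_trans: "x \<preceq> y \<Longrightarrow> y \<preceq> z \<Longrightarrow> x \<in> D N \<Longrightarrow> y \<in> D N \<Longrightarrow> z \<in> D N \<Longrightarrow> x \<preceq> z"
  by (elim LeE[of x y] LeE[of y z]) (simp_all add: Add_assoc)

lemma Sc_Le_Sc [simp]: "x \<in> D N \<Longrightarrow> y \<in> D N \<Longrightarrow> Sc x \<preceq> Sc y \<longleftrightarrow> x \<preceq> y"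
  by (simp add: Le_def Pre_Monus_Sc)

lemma Le_Sc: "x \<preceq> y \<Longrightarrow> x \<in> D N \<Longrightarrow> y \<in> D N \<Longrightarrow> x \<preceq> Sc y"
  by (simp add: Le_def)

lemma Sc_Le: "Sc x \<preceq> y \<Longrightarrow> x \<in> D N \<Longrightarrow> y \<in> D N \<Longrightarrow> x \<preceq> y"
  using Le_trans[of x "Sc x" y] Le_Sc[of x x] by simp

lemma not_Sc_Le: "x \<preceq> y \<Longrightarrow> x \<in> D N \<Longrightarrow> y \<in> D N \<Longrightarrow> \<not> Sc y \<preceq> x"
proof
  assume "x \<preceq> y" "x \<in> D N" "y \<in> D N" "Sc y \<preceq> x"
  moreover from this have "Sc y \<preceq> y" using Le_trans[of "Sc y" x y] by simp
  ultimately show False using Monus_Add[of y "Sc Z"] by (simp add: Le_def)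
qed

lemma Le_total: "x \<in> D N \<Longrightarrow> y \<in> D N \<Longrightarrow> x \<preceq> y \<or> y \<preceq> x"
  unfolding Le_def
proof (rule induct_or[where ?F1.0 = "\<lambda>x. Monus x y" and ?G1.0 = "\<lambda>x. Z" and
      ?F2.0 = "\<lambda>x. Monus y x" and ?G2.0 = "\<lambda>x. Z"])
  fix x assume x: "x \<in> D N" and y: "y \<in> D N" and or: "Monus x y = Z \<or> Monus y x = Z"
  show "Monus (Sc x) y = Z \<or> Monus y (Sc x) = Z"
  proof (cases "Monus y x = Z")
    case False
    then have "x \<preceq> y" using or by (simp add: Le_def)
    then obtain z where z: "z \<in> D N" "y = Add x z" using x y by (rule LeE)
    have "z \<noteq> Z" using False z x by auto
    then obtain w where "w \<in> D N" "z = Sc w" using cases_N[OF z(1)] by metis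
    then have "Sc x \<preceq> y" using z x Le_AddI[of "Sc x" w] by simp
    then show ?thesis by (simp add: Le_def)
  qed (use x y in simp)
qed (auto intro!: reps)

lemma not_Le: "x \<in> D N \<Longrightarrow> y \<in> D N \<Longrightarrow> \<not> x \<preceq> y \<longleftrightarrow> Sc y \<preceq> x"
proof
  assume xy: "x \<in> D N" "y \<in> D N" and "\<not> x \<preceq> y"
  then have "y \<preceq> x" using Le_total by blast
  then obtain z where z: "z \<in> D N" "x = Add y z" using xy by (elim LeE)
  show "Sc y \<preceq> x"
  proof (rule cases_N[OF z(1)])
    assume "z = Z"
    then show ?thesis using \<open>\<not> x \<preceq> y\<close> z xy by simp
  next
    fix w assume "w \<in> D N" "z = Sc w"
    then show ?thesis using z xy Le_AddI[of "Sc y" w] by simp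
  qed
qed (use not_Sc_Le in blast)

lemma Le_Add_left: "x \<in> D N \<Longrightarrow> y \<in> D N \<Longrightarrow> x \<preceq> Add y x"
  by (simp add: Add_comm[of y x])

lemma Monus_Monus: "k \<preceq> n \<Longrightarrow> k \<in> D N \<Longrightarrow> n \<in> D N \<Longrightarrow> Monus n (Monus n k) = k"
proof (elim LeE)
  fix z assume "k \<in> D N" "z \<in> D N" "n = Add k z"
  then show ?thesis using Monus_Add[of z k] by (simp add: Add_comm[of z k])
qed

lemma Monus_Le [simp]: "x \<in> D N \<Longrightarrow> y \<in> D N \<Longrightarrow> Monus x y \<preceq> x"
  using Le_total[of x y] by (auto simp: Le_def[of x y] elim!: LeE[of y x] simp: Le_Add_left)

lemma Monus_nz: "x \<in> D N \<Longrightarrow> y \<in> D N \<Longrightarrow> \<not> x \<preceq> y \<Longrightarrow> \<exists>z\<in>D N. Monus x y = Sc z"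
  using cases_N[of "Monus x y"] by (auto simp: Le_def)

lemma Ifz_Monus: "x \<in> D N \<Longrightarrow> y \<in> D N \<Longrightarrow> a \<in> D N \<Longrightarrow> b \<in> D N \<Longrightarrow>
    Ifz (Monus x y) a b = (if x \<preceq> y then a else b)"
  using Monus_nz[of x y] by (auto simp: Le_def)

subsection \<open>Sequence codes\<close>

text \<open>\<open>Root\<close> stays at n on the whole block from \<open>Tri n\<close> to
  \<open>Add (Tri n) n\<close>, because it steps next at \<open>Tri (Sc n)\<close>, just after the
  block. The start of the block is a hypothesis so that \<open>Root_Tri\<close> can use the lemma
  within its own induction.\<close>

lemma Root_Tri_Add:
  assumes n: "n \<in> D N" and base: "Root (Tri n) = n" and a: "a \<in> D N" and le: "a \<preceq> n"
  shows "Root (Add (Tri n) a) = n"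
proof (rule induct_imp[where ?F1.0 = "\<lambda>a. Monus a n" and ?G1.0 = "\<lambda>a. Z" and
      ?F2.0 = "\<lambda>a. Root (Add (Tri n) a)" and ?G2.0 = "\<lambda>a. n"])
  fix a assume a: "a \<in> D N" and IH: "Monus a n = Z \<Longrightarrow> Root (Add (Tri n) a) = n"
    and le: "Monus (Sc a) n = Z"
  have le': "Sc a \<preceq> n" using le by (simp add: Le_def)
  have "a \<preceq> n" by (rule Sc_Le[OF le' a n])
  then have root: "Root (Add (Tri n) a) = n" using IH by (simp add: Le_def)
  have "\<not> Sc n \<preceq> Sc a" using not_Sc_Le[OF le'] a n by simp
  then have "\<not> Tri (Sc n) \<preceq> Sc (Add (Tri n) a)"
    using Monus_Add_Add[of "Tri n" "Sc n" "Sc a"] a n by (simp add: Le_def del: Monus_simps)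
  then show "Root (Add (Tri n) (Sc a)) = n"
    using a n root by (simp add: Root_simps Ifz_Monus del: Tri_simps Monus_simps)
qed (use assms in \<open>auto simp: Le_def intro!: reps\<close>)

lemma Root_Tri: "n \<in> D N \<Longrightarrow> Root (Tri n) = n"
proof (rule induct_eq[where F = "\<lambda>n. Root (Tri n)" and G = "\<lambda>n. n"])
  fix n assume n: "n \<in> D N" and IH: "Root (Tri n) = n"
  have "Root (Add (Tri n) n) = n" using Root_Tri_Add[OF n IH n] n by simp
  then show "Root (Tri (Sc n)) = Sc n"
    using n by (simp add: Root_simps Ifz_Monus del: Monus_simps)
qed (auto simp: Root_simps intro!: reps)

lemma Root_Cpair: "x \<in> D N \<Longrightarrow> y \<in> D N \<Longrightarrow> Root (Cpair x y) = Add x y"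
  by (simp add: Cpair_eq Root_Tri_Add Root_Tri)

lemma Fst_Cpair [simp]: "x \<in> D N \<Longrightarrow> y \<in> D N \<Longrightarrow> Fst (Cpair x y) = x"
  by (simp add: Fst_eq Root_Cpair) (simp add: Cpair_eq)

lemma Snd_Cpair [simp]: "x \<in> D N \<Longrightarrow> y \<in> D N \<Longrightarrow> Snd (Cpair x y) = y"
  by (simp add: Snd_eq Root_Cpair)

lemma Butlast_Snoc [simp]: "x \<in> D N \<Longrightarrow> y \<in> D N \<Longrightarrow> Butlast (Snoc x y) = x"
  by (simp add: Butlast_eq Snoc_eq)
lemma Last_Snoc [simp]: "x \<in> D N \<Longrightarrow> y \<in> D N \<Longrightarrow> Last (Snoc x y) = y"
  by (simp add: Last_eq Snoc_eq)
lemma Butlast_Z [simp]: "Butlast Z = Z"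
  by (simp add: Butlast_eq Fst_eq)

text \<open>Dropping more entries than there are causes no exception: the empty sequence has code 0
  and \<open>Butlast\<close> maps 0 to 0, in step with truncated subtraction.\<close>

lemma Drop_Bar:
  assumes "f \<in> D T1" "k \<in> D N" "i \<in> D N"
  shows "Drop (Bar f k) i = Bar f (Monus k i)"
proof (rule induct_eq[where F = "\<lambda>i. Drop (Bar f k) i" and G = "\<lambda>i. Bar f (Monus k i)"])
  fix i assume i: "i \<in> D N" and IH: "Drop (Bar f k) i = Bar f (Monus k i)"
  show "Drop (Bar f k) (Sc i) = Bar f (Monus k (Sc i))"
    by (rule cases_N[of "Monus k i"]) (use assms i IH in auto)
qed (use assms in \<open>auto intro!: reps\<close>)

text \<open>The recursion in \<open>lhC\<close> runs up to the code of the sequence, so the code has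
  to be at least the length.\<close>

lemma Le_Bar: "f \<in> D T1 \<Longrightarrow> k \<in> D N \<Longrightarrow> k \<preceq> Bar f k"
  unfolding Le_def
proof (rule induct_eq[where F = "\<lambda>k. Monus k (Bar f k)" and G = "\<lambda>k. Z"])
  fix k assume f: "f \<in> D T1" and k: "k \<in> D N" and IH: "Monus k (Bar f k) = Z"
  have "k \<preceq> Bar f k" using IH by (simp add: Le_def)
  moreover have "Bar f k \<preceq> Cpair (Bar f k) (f \<bullet> k)" using f k by (simp add: Cpair_eq Le_Add_left)
  ultimately have "k \<preceq> Cpair (Bar f k) (f \<bullet> k)" using f k Le_trans[of k "Bar f k"] by simp
  then have "Sc k \<preceq> Bar f (Sc k)" using f k by (simp add: Snoc_eq)
  then show "Monus (Sc k) (Bar f (Sc k)) = Z" unfolding Le_def .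
qed (auto intro!: reps)

lemma Lh_Bar [simp]:
  assumes f: "f \<in> D T1" and k: "k \<in> D N"
  shows "Lh (Bar f k) = k"
proof -
  let ?s = "Bar f k"
  define h where "h = eval S (e0(vs := ?s)) [] (lam vu (lam vi (ifz (dropC \<cdot> Fr vs \<cdot> Fr vi) (Fr vu) (suc (Fr vu)))))"
  have h: "h \<in> D (N \<Rrightarrow> N \<Rrightarrow> N)"
    unfolding h_def by (rule eval_closed) (use f k in auto)
  \<comment> \<open>After i steps the counter shows min(i, k), written with truncated subtraction to
    keep it representable. It increases precisely while dropping i entries leaves a non-empty
    sequence.\<close>
  have count: "con S cRec \<bullet> i \<bullet> Z \<bullet> h = Monus k (Monus k i)" if "i \<in> D N" for i
  proof (rule induct_eq[where F = "\<lambda>i. con S cRec \<bullet> i \<bullet> Z \<bullet> h" and G = "\<lambda>i. Monus k (Monus k i)"])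
    show "rep N N (\<lambda>i. con S cRec \<bullet> i \<bullet> Z \<bullet> h)"
      by (rule rep_app[OF rep_ap2[OF con_closed_types(3)] rep_const[OF h]]) (auto intro!: reps)
    show "con S cRec \<bullet> Z \<bullet> Z \<bullet> h = Monus k (Monus k Z)" using k rec_0[OF _ h] by simp
    fix i assume i: "i \<in> D N" and IH: "con S cRec \<bullet> i \<bullet> Z \<bullet> h = Monus k (Monus k i)"
    have "con S cRec \<bullet> Sc i \<bullet> Z \<bullet> h =
        Ifz (Drop ?s i) (con S cRec \<bullet> i \<bullet> Z \<bullet> h) (Sc (con S cRec \<bullet> i \<bullet> Z \<bullet> h))"
      unfolding h_def by (subst rec_step) (use f k i in auto)
    also have "\<dots> = Monus k (Monus k (Sc i))"
    proof (rule cases_N[of "Monus k i"])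
      fix w assume w: "w \<in> D N" "Monus k i = Sc w"
      then have "Sc w \<preceq> k" using Monus_Le[OF k i] by simp
      then obtain z where z: "z \<in> D N" "k = Add (Sc w) z" using k w by (elim LeE) auto
      then have "Monus k (Sc w) = z" "Monus k w = Sc z"
        using w Monus_Add[of "Sc w" z] Monus_Add[of w "Sc z"] by (simp_all del: Monus_Add)
      then show ?thesis using f k i IH w z(1) by (simp add: Drop_Bar Snoc_eq del: Monus_simps(2)) simp
    qed (use f k i IH in \<open>auto simp: Drop_Bar\<close>)
    finally show "con S cRec \<bullet> Sc i \<bullet> Z \<bullet> h = Monus k (Monus k (Sc i))" .
  qed (use that k in \<open>auto intro!: reps\<close>)
  have "Lh ?s = con S cRec \<bullet> ?s \<bullet> Z \<bullet> h"
    unfolding Lh_def lhC_def h_def using f k by (simp add: eval_lam')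
  also have "\<dots> = Monus k (Monus k ?s)" using count f k by simp
  also have "Monus k ?s = Z" using Le_Bar[OF f k] by (simp add: Le_def)
  finally show ?thesis using k by simp
qed

lemma Pad_Bar:
  assumes "f \<in> D T1" "k \<in> D N" "i \<in> D N"
  shows "Pad (Bar f k) \<bullet> i = (if Sc i \<preceq> k then f \<bullet> i else Z)"
  using assms by (simp add: Pad_app Ifz_Monus Drop_Bar Monus_Monus del: Monus_simps)

text \<open>The agreement of f and g stays outside the induction. The formula proved by induction is
  m \<preceq> n \<longrightarrow> \<open>Bar f m = Bar g m\<close>, which has no quantifier.\<close>

lemma Bar_cong:
  assumes fg: "f \<in> D T1" "g \<in> D T1" "n \<in> D N"
    and eq: "\<And>i. i \<in> D N \<Longrightarrow> Sc i \<preceq> n \<Longrightarrow> f \<bullet> i = g \<bullet> i"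
  shows "Bar f n = Bar g n"
proof (rule induct_imp[where ?F1.0 = "\<lambda>m. Monus m n" and ?G1.0 = "\<lambda>m. Z" and
      ?F2.0 = "\<lambda>m. Bar f m" and ?G2.0 = "\<lambda>m. Bar g m"])
  fix m assume m: "m \<in> D N" and IH: "Monus m n = Z \<Longrightarrow> Bar f m = Bar g m" and "Monus (Sc m) n = Z"
  then have le: "Sc m \<preceq> n" by (simp add: Le_def)
  then have "m \<preceq> n" using Sc_Le m fg by blast
  then show "Bar f (Sc m) = Bar g (Sc m)" using IH eq[OF m le] fg m by (simp add: Le_def)
qed (use fg in \<open>auto intro!: reps\<close>)

text \<open>Both sides arise from the codes at n by dropping the last n - j entries.\<close>

lemma Bar_mono:
  assumes "f \<in> D T1" "g \<in> D T1" "n \<in> D N" "j \<in> D N" "Bar f n = Bar g n" "j \<preceq> n"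
  shows "Bar f j = Bar g j"
  using Drop_Bar[of f n "Monus n j"] Drop_Bar[of g n "Monus n j"] assms by (simp add: Monus_Monus)

section \<open>Semantic forms of the three principles\<close>

definition bin :: "'a \<Rightarrow> bool" where "bin f \<longleftrightarrow> (\<forall>n\<in>D N. f \<bullet> n \<preceq> Sc Z)"

lemma Le_one_iff: "x \<in> D N \<Longrightarrow> x \<preceq> Sc Z \<longleftrightarrow> x = Z \<or> x = Sc Z"
proof (rule cases_N[of x])
  fix y assume "x \<in> D N" "y \<in> D N" "x = Sc y"
  then show ?thesis by (rule_tac cases_N[of y]) (auto simp: Le_def Pre_Monus_Sc)
qed auto

lemma bin_Pad_Bar: "f \<in> D T1 \<Longrightarrow> bin f \<Longrightarrow> k \<in> D N \<Longrightarrow> bin (Pad (Bar f k))"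
  by (auto simp: bin_def Pad_Bar)

definition uc :: "'a \<Rightarrow> 'a \<Rightarrow> bool" where
  "uc \<Omega> \<phi> \<longleftrightarrow> (\<forall>f\<in>D T1. bin f \<longrightarrow> (\<forall>g\<in>D T1. bin g \<longrightarrow>
     Bar f (\<Omega> \<bullet> \<phi>) = Bar g (\<Omega> \<bullet> \<phi>) \<longrightarrow> \<phi> \<bullet> f = \<phi> \<bullet> g))"

definition pc :: "'a \<Rightarrow> 'a \<Rightarrow> bool" where
  "pc \<Delta> \<phi> \<longleftrightarrow> (\<forall>f\<in>D T1. bin f \<longrightarrow> (\<forall>g\<in>D T1. bin g \<longrightarrow>
     Bar f (\<Delta> \<bullet> \<phi> \<bullet> f) = Bar g (\<Delta> \<bullet> \<phi> \<bullet> f) \<longrightarrow> \<phi> \<bullet> f = \<phi> \<bullet> g))"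

definition bintree :: "'a \<Rightarrow> bool" where
  "bintree T \<longleftrightarrow> bin T \<and> (\<forall>s\<in>D N. T \<bullet> s = Sc Z \<longrightarrow>
     (\<forall>i\<in>D N. i \<preceq> Lh s \<longrightarrow> Sc i \<preceq> Lh s \<longrightarrow> Pad s \<bullet> i \<preceq> Sc Z) \<and>
     (\<forall>k\<in>D N. k \<preceq> Lh s \<longrightarrow> T \<bullet> Bar (Pad s) k = Sc Z))"

definition ufan :: "'a \<Rightarrow> bool" where
  "ufan \<Phi> \<longleftrightarrow> (\<forall>T\<in>D T1. \<forall>g\<in>D T2. bintree T \<longrightarrow>
     (\<forall>f\<in>D T1. bin f \<longrightarrow> T \<bullet> Bar f (g \<bullet> f) \<noteq> Sc Z) \<longrightarrow>
     (\<forall>f\<in>D T1. bin f \<longrightarrow> (\<exists>n\<in>D N. n \<preceq> \<Phi> \<bullet> g \<bullet> T \<and> T \<bullet> Bar f n \<noteq> Sc Z)))"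

text \<open>\<open>le1\<close> binds the name \<open>vn\<close> around its argument, so a variable
  of that name would be captured.\<close>

lemma sat_le1 [simp]: "v \<noteq> vn \<Longrightarrow> sat S e bs (le1 (Fr v)) \<longleftrightarrow> bin (e v)"
  by (simp add: le1_def bin_def)

lemma sat_Lt [simp]: "sat S e bs (s \<^bold>< t) \<longleftrightarrow> Sc (eval S e bs s) \<preceq> eval S e bs t"
  by (simp add: Lt_def)

lemma sat_MUC: "sat S e bs MUC \<longleftrightarrow> (\<exists>\<Omega>\<in>D T3. \<forall>\<phi>\<in>D T2. uc \<Omega> \<phi>)"
  by (simp add: MUC_def uc_mod_def uc_def)

lemma sat_MPC: "sat S e bs MPC \<longleftrightarrow> (\<exists>\<Delta>\<in>D T3'. \<forall>\<phi>\<in>D T2. pc \<Delta> \<phi>)"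
  by (simp add: MPC_def is_pc_mod_def pc_def)

lemma sat_UFAN2: "sat S e bs UFAN2 \<longleftrightarrow> (\<exists>\<Phi>\<in>D T3'. ufan \<Phi>)"
  by (simp add: UFAN2_def is_bintree_def bintree_def ufan_def)

subsection \<open>From uniform continuity to the uniform fan theorem\<close>

text \<open>A uniform modulus serves as a pointwise one that is constant in f.\<close>

lemma MUC_imp_MPC:
  assumes \<Omega>: "\<Omega> \<in> D T3" and uc: "\<forall>\<phi>\<in>D T2. uc \<Omega> \<phi>"
  shows "\<exists>\<Delta>\<in>D T3'. \<forall>\<phi>\<in>D T2. pc \<Delta> \<phi>"
proof
  let ?t = "lam vphi (lam vf (Fr vOmega \<cdot> Fr vphi))"
  let ?\<Delta> = "eval S (e0(vOmega := \<Omega>)) [] ?t"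
  show "?\<Delta> \<in> D T3'" by (rule eval_closed) (use \<Omega> in auto)
  have \<Delta>_app: "?\<Delta> \<bullet> \<phi> \<bullet> f = \<Omega> \<bullet> \<phi>" if "\<phi> \<in> D T2" "f \<in> D T1" for \<phi> f
    using \<Omega> that by (simp add: eval_lam')
  show "\<forall>\<phi>\<in>D T2. pc ?\<Delta> \<phi>"
    unfolding pc_def
  proof (intro ballI impI)
    fix \<phi> f g
    assume \<phi>: "\<phi> \<in> D T2" and fg: "f \<in> D T1" "bin f" "g \<in> D T1" "bin g"
      and eq: "Bar f (?\<Delta> \<bullet> \<phi> \<bullet> f) = Bar g (?\<Delta> \<bullet> \<phi> \<bullet> f)"
    show "\<phi> \<bullet> f = \<phi> \<bullet> g"
      using uc \<phi> fg eq[unfolded \<Delta>_app[OF \<phi> fg(1)]] unfolding uc_def by blast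
  qed
qed

text \<open>If \<open>g \<alpha>\<close> exceeded the modulus \<open>M\<close> of \<open>\<alpha> \<mapsto> \<alpha> (g \<alpha> + \<Omega> g)\<close>, then \<open>\<alpha>\<close> could be changed at the
  position \<open>g \<alpha> + \<Omega> g\<close> without changing its first \<open>M\<close> and \<open>\<Omega> g\<close> values.\<close>

lemma bound_from_modulus:
  assumes \<Omega>: "\<Omega> \<in> D T3" and uc: "\<forall>\<phi>\<in>D T2. uc \<Omega> \<phi>" and g: "g \<in> D T2"
    and \<phi>: "\<phi> \<in> D T2" "\<And>f. f \<in> D T1 \<Longrightarrow> \<phi> \<bullet> f = f \<bullet> Add (g \<bullet> f) (\<Omega> \<bullet> g)"
    and f: "f \<in> D T1" "bin f"
  shows "g \<bullet> f \<preceq> \<Omega> \<bullet> \<phi>"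
proof (rule ccontr)
  assume not_le: "\<not> g \<bullet> f \<preceq> \<Omega> \<bullet> \<phi>"
  define M where "M = \<Omega> \<bullet> \<phi>"
  define m where "m = \<Omega> \<bullet> g"
  define p where "p = Add (g \<bullet> f) m"
  have closed': "M \<in> D N" "m \<in> D N" "p \<in> D N" using \<Omega> g \<phi> f by (auto simp: M_def m_def p_def)
  \<comment> \<open>h copies f below M and below m and is constantly 1 - f(p) elsewhere. As p lies
    in neither range, this inverts the entry at p without a test for equality with p.\<close>
  define h where "h = eval S (e0(vf := f, va := M, vb := m, vc := p)) [] (lam vi
    (ifz (monus (suc (Fr vi)) (Fr va)) (Fr vf \<cdot> Fr vi)
      (ifz (monus (suc (Fr vi)) (Fr vb)) (Fr vf \<cdot> Fr vi) (monus one (Fr vf \<cdot> Fr vc)))))"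
  have h: "h \<in> D T1" unfolding h_def by (rule eval_closed) (use closed' f in auto)
  have h_app: "h \<bullet> i = (if Sc i \<preceq> M \<or> Sc i \<preceq> m then f \<bullet> i else Monus (Sc Z) (f \<bullet> p))"
    if "i \<in> D N" for i
    unfolding h_def using closed' f that by (simp add: eval_lam' Ifz_Monus)
  have bin_h: "bin h" using f closed' by (auto simp: bin_def h_app simp del: Monus_simps)
  have "Bar f M = Bar h M" "Bar f m = Bar h m"
    by (rule Bar_cong; use f h closed' h_app in auto)+
  then have "\<phi> \<bullet> f = \<phi> \<bullet> h" "g \<bullet> f = g \<bullet> h"
    using uc \<phi>(1) g f h bin_h unfolding uc_def M_def m_def by blast+
  then have "f \<bullet> p = h \<bullet> p" using \<phi>(2)[OF f(1)] \<phi>(2)[OF h] by (simp add: p_def m_def)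
  moreover have "\<not> Sc p \<preceq> M"
  proof
    assume "Sc p \<preceq> M"
    then have "p \<preceq> M" using closed' Sc_Le by blast
    moreover have "g \<bullet> f \<preceq> p" using g f closed' by (simp add: p_def)
    ultimately show False using not_le Le_trans[of "g \<bullet> f" p M] g f closed' by (simp add: M_def)
  qed
  moreover have "\<not> Sc p \<preceq> m"
    using not_Sc_Le[of m p] Le_Add_left[of m "g \<bullet> f"] g f closed' by (simp add: p_def)
  ultimately have "f \<bullet> p = Monus (Sc Z) (f \<bullet> p)" using h_app[of p] closed' by simp
  moreover have "f \<bullet> p = Z \<or> f \<bullet> p = Sc Z"
    using f closed' Le_one_iff[of "f \<bullet> p"] by (simp add: bin_def)
  ultimately show False by auto
qed

text \<open>Once g is bounded on Cantor space, every f leaves T within the bound, namely at n =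
  g(f).\<close>

lemma MUC_imp_UFAN2:
  assumes \<Omega>: "\<Omega> \<in> D T3" and uc: "\<forall>\<phi>\<in>D T2. uc \<Omega> \<phi>"
  shows "\<exists>\<Phi>\<in>D T3'. ufan \<Phi>"
proof
  let ?b = "lam vf (Fr vf \<cdot> add (Fr vG \<cdot> Fr vf) (Fr vOmega \<cdot> Fr vG))"
  let ?t = "lam vG (lam vT (Fr vOmega \<cdot> ?b))"
  let ?\<Phi> = "eval S (e0(vOmega := \<Omega>)) [] ?t"
  show "?\<Phi> \<in> D T3'" by (rule eval_closed) (use \<Omega> in auto)
  show "ufan ?\<Phi>"
    unfolding ufan_def
  proof (intro ballI impI)
    fix T g f
    assume T: "T \<in> D T1" and g: "g \<in> D T2" and f: "f \<in> D T1" "bin f"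
      and bar: "\<forall>f\<in>D T1. bin f \<longrightarrow> T \<bullet> Bar f (g \<bullet> f) \<noteq> Sc Z"
    define \<phi> where "\<phi> = eval S (e0(vOmega := \<Omega>, vG := g, vT := T)) [] ?b"
    have \<phi>: "\<phi> \<in> D T2" unfolding \<phi>_def by (rule eval_closed) (use \<Omega> g T in auto)
    have \<phi>_app: "\<phi> \<bullet> f = f \<bullet> Add (g \<bullet> f) (\<Omega> \<bullet> g)" if "f \<in> D T1" for f
      unfolding \<phi>_def using \<Omega> g T that by (simp add: eval_lam')
    have "?\<Phi> \<bullet> g \<bullet> T = \<Omega> \<bullet> \<phi>"
      unfolding \<phi>_def using \<Omega> g T by (simp add: eval_lam')
    then have "g \<bullet> f \<preceq> ?\<Phi> \<bullet> g \<bullet> T" using bound_from_modulus[OF \<Omega> uc g \<phi> \<phi>_app f] by simp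
    then show "\<exists>n\<in>D N. n \<preceq> ?\<Phi> \<bullet> g \<bullet> T \<and> T \<bullet> Bar f n \<noteq> Sc Z"
      using bar f g by (intro bexI[of _ "g \<bullet> f"]) auto
  qed
qed

subsection \<open>From the uniform fan theorem to uniform continuity\<close>

text \<open>\<open>unsecured_tm \<omega> \<cdot> s \<cdot> n\<close> is 1 if, for all \<open>k < n\<close>, \<open>\<omega> (\<sigma> * 00\<dots>) > k\<close> holds for the initial
  segment \<open>\<sigma>\<close> of \<open>s\<close> of length \<open>k\<close> and the \<open>k\<close>-th entry of \<open>s\<close> is at most 1; otherwise it is 0.\<close>

definition unsecured_tm :: "cn tm \<Rightarrow> cn tm" where
  "unsecured_tm w = lam vs (lam vn (rcs (Fr vn) one (lam vu (lam vk
     (ifz (monus (suc (Fr vk)) (w \<cdot> pad (bar (pad (Fr vs)) (Fr vk))))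
       (ifz (monus (pad (Fr vs) \<cdot> Fr vk) one) (Fr vu) zero) zero)))))"

text \<open>The argument is the length plus 1, so that s itself is tested along with its proper
  initial segments. At k = \<open>lh s\<close> the test on entries reads the padding, which is
  0.\<close>

definition tree_tm :: "cn tm \<Rightarrow> cn tm" where
  "tree_tm w = lam vs (unsecured_tm w \<cdot> Fr vs \<cdot> suc (lh (Fr vs)))"

lemma UFAN2_MPC_imp_MUC:
  assumes \<Phi>: "\<Phi> \<in> D T3'" "ufan \<Phi>" and \<Delta>: "\<Delta> \<in> D T3'" and pc: "\<forall>\<phi>\<in>D T2. pc \<Delta> \<phi>"
  shows "\<exists>\<Omega>\<in>D T3. \<forall>\<phi>\<in>D T2. uc \<Omega> \<phi>"
proof
  let ?w = "Fr vDelta \<cdot> Fr vphi"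
  let ?g = "lam vf (add (Fr vDelta \<cdot> ?w \<cdot> Fr vf) (?w \<cdot> Fr vf))"
  let ?T = "tree_tm ?w"
  let ?t = "lam vphi (Fr vPhi \<cdot> ?g \<cdot> ?T)"
  let ?e = "e0(vDelta := \<Delta>, vPhi := \<Phi>)"
  let ?\<Omega> = "eval S ?e [] ?t"
  have ty: "is_tm Base (unsecured_tm ?w) (N \<Rrightarrow> N \<Rrightarrow> N)" "is_tm Base ?T T1" "is_tm Base ?g T2"
    by (auto simp: unsecured_tm_def tree_tm_def)
  show "?\<Omega> \<in> D T3" by (rule eval_closed) (use \<Phi> \<Delta> ty in auto)
  show "\<forall>\<phi>\<in>D T2. uc ?\<Omega> \<phi>"
  proof
    fix \<phi> assume \<phi>: "\<phi> \<in> D T2"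
    define w where "w = \<Delta> \<bullet> \<phi>"
    define e where "e = ?e(vphi := \<phi>)"
    define g where "g = eval S e [] ?g"
    define T where "T = eval S e [] ?T"
    define U where "U s n = eval S e [] (unsecured_tm ?w) \<bullet> s \<bullet> n" for s n
    have e: "env_in Base S e" unfolding e_def using \<Phi> \<Delta> \<phi> by simp
    have e_app: "e vDelta = \<Delta>" "e vphi = \<phi>" by (simp_all add: e_def)
    have w: "w \<in> D T2" unfolding w_def using \<Delta> \<phi> by simp
    have g: "g \<in> D T2" and T: "T \<in> D T1" unfolding g_def T_def by (rule eval_closed; use e ty in simp)+
    have U: "U s n \<in> D N" if "s \<in> D N" "n \<in> D N" for s n
      unfolding U_def using eval_closed[OF ty(1) e, of "[]"] that by (blast intro: app_closed)
    have \<Omega>_app: "?\<Omega> \<bullet> \<phi> = \<Phi> \<bullet> g \<bullet> T"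
      using \<Phi> \<Delta> \<phi> ty eval_lam[of "Fr vPhi \<cdot> ?g \<cdot> ?T" N vphi ?e \<phi> "[]"] by (simp add: g_def T_def e_def)
    have g_app: "g \<bullet> f = Add (\<Delta> \<bullet> w \<bullet> f) (w \<bullet> f)" if "f \<in> D T1" for f
      unfolding g_def using e that by (simp add: eval_lam' e_app w_def)
    have T_app: "T \<bullet> s = U s (Sc (Lh s))" if "s \<in> D N" for s
      unfolding T_def tree_tm_def U_def
      using e that ty(1) fv_lam by (simp add: eval_lam' eval_upd unsecured_tm_def)
    have U_Z: "U s Z = Sc Z" if "s \<in> D N" for s
      unfolding U_def unsecured_tm_def using e that by (simp add: eval_lam' rec_step)
    have U_Sc: "U s (Sc k) = (if Sc k \<preceq> w \<bullet> Pad (Bar (Pad s) k) \<and> Pad s \<bullet> k \<preceq> Sc Z then U s k else Z)"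
      if "s \<in> D N" "k \<in> D N" for s k
    proof -
      have "U s (Sc k) = Ifz (Monus (Sc k) (w \<bullet> Pad (Bar (Pad s) k)))
          (Ifz (Monus (Pad s \<bullet> k) (Sc Z)) (U s k) Z) Z"
        unfolding U_def unsecured_tm_def
        using e that by (simp add: eval_lam' rec_step eval_upd e_app w_def del: Monus_simps)
      then show ?thesis using that U w by (simp add: Ifz_Monus del: Monus_simps)
    qed
    have rep_U: "rep N N (\<lambda>x. U s (F x))" if "s \<in> D N" "rep N N F" for s F
      unfolding U_def by (rule rep_ap1[of _ N]) (use eval_closed[OF ty(1) e, of "[]"] that in \<open>auto intro: app_closed\<close>)
    have rep_U': "rep N N (U s)" if "s \<in> D N" for s
      using rep_U[OF that rep_id] by simp
    have U_01: "U s n = Z \<or> U s n = Sc Z" if "s \<in> D N" "n \<in> D N" for s n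
      by (rule induct_or[where ?F1.0 = "U s" and ?G1.0 = "\<lambda>n. Z" and ?F2.0 = "U s" and ?G2.0 = "\<lambda>n. Sc Z"])
         (use that rep_U' in \<open>auto simp: U_Z U_Sc intro!: reps\<close>)
    \<comment> \<open>The recursion never leaves 0 once it is there, so the value 1 at n passes down
      to all smaller arguments. The induction runs over the distance j from n.\<close>
    have U_down: "U s (Monus n j) = Sc Z" if "s \<in> D N" "n \<in> D N" "U s n = Sc Z" "j \<in> D N" for s n j
    proof (rule induct_eq[where F = "\<lambda>j. U s (Monus n j)" and G = "\<lambda>j. Sc Z"])
      fix j assume j: "j \<in> D N" and IH: "U s (Monus n j) = Sc Z"
      show "U s (Monus n (Sc j)) = Sc Z"
        by (rule cases_N[of "Monus n j"]) (use j that IH in \<open>auto simp: U_Sc split: if_splits\<close>)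
    qed (use that in \<open>auto intro!: reps rep_U\<close>)
    have U_one: "Sc k \<preceq> w \<bullet> Pad (Bar (Pad s) k)" "Pad s \<bullet> k \<preceq> Sc Z" "U s k = Sc Z"
      if "s \<in> D N" "n \<in> D N" "U s n = Sc Z" "k \<in> D N" "Sc k \<preceq> n" for s n k
      using U_down[OF that(1-3), of "Monus n (Sc k)"] that
      by (auto simp: Monus_Monus U_Sc split: if_splits simp del: Monus_simps)
    have U_cong: "U s k = U s' k"
      if s: "s \<in> D N" "s' \<in> D N" "k \<in> D N" and
        eq: "\<And>i. i \<in> D N \<Longrightarrow> Sc i \<preceq> k \<Longrightarrow> Pad s \<bullet> i = Pad s' \<bullet> i" for s s' k
    proof (rule induct_imp[where ?F1.0 = "\<lambda>m. Monus m k" and ?G1.0 = "\<lambda>m. Z" and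
          ?F2.0 = "U s" and ?G2.0 = "U s'"])
      fix m assume m: "m \<in> D N" and IH: "Monus m k = Z \<Longrightarrow> U s m = U s' m" and "Monus (Sc m) k = Z"
      then have le: "Sc m \<preceq> k" by (simp add: Le_def)
      then have le': "m \<preceq> k" using Sc_Le m s by blast
      have "Bar (Pad s) m = Bar (Pad s') m"
        by (rule Bar_cong) (use s m le' eq Le_trans[of _ m k] in auto)
      then show "U s (Sc m) = U s' (Sc m)" using IH le' eq[OF m le] s m by (simp add: U_Sc Le_def)
    qed (use s rep_U' in \<open>auto simp: U_Z intro!: reps\<close>)
    have bar_pad: "Bar (Pad (Bar f n)) m = Bar f m"
      if "f \<in> D T1" "n \<in> D N" "m \<in> D N" "m \<preceq> n" for f n m
      by (rule Bar_cong) (use that Le_trans[of _ m n] in \<open>auto simp: Pad_Bar\<close>)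
    have tree: "bintree T"
      unfolding bintree_def
    proof (intro conjI ballI impI)
      show "bin T" using U_01 by (simp add: bin_def T_app Le_one_iff U)
      fix s assume s: "s \<in> D N" and "T \<bullet> s = Sc Z"
      then have one: "U s (Sc (Lh s)) = Sc Z" by (simp add: T_app)
      show "Pad s \<bullet> i \<preceq> Sc Z" if "i \<in> D N" "i \<preceq> Lh s" "Sc i \<preceq> Lh s" for i
        using U_one(2)[OF s _ one, of i] s that by simp
      fix k assume k: "k \<in> D N" "k \<preceq> Lh s"
      let ?s = "Bar (Pad s) k"
      have s': "?s \<in> D N" using s k by simp
      note one_k = U_one[OF s _ one k(1)]
      \<comment> \<open>The tests below k see only entries that s shares with its initial segment.
        At k itself the condition on \<omega> is the same for both, and the entry of the shorter
        sequence there is the padding 0.\<close>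
      have "U ?s k = U s k" by (rule U_cong) (use s k in \<open>auto simp: Pad_Bar\<close>)
      moreover have "Bar (Pad ?s) k = Bar (Pad s) k" using bar_pad[of "Pad s" k k] s k by simp
      moreover have "Pad ?s \<bullet> k = Z" using s k not_Sc_Le[of k k] by (simp add: Pad_Bar)
      ultimately show "T \<bullet> ?s = Sc Z" using one_k s s' k by (simp add: T_app U_Sc)
    qed
    have barred: "T \<bullet> Bar f (g \<bullet> f) \<noteq> Sc Z" if f: "f \<in> D T1" "bin f" for f
    proof
      let ?n = "g \<bullet> f" and ?s = "Bar f (g \<bullet> f)"
      have n: "?n \<in> D N" and s: "?s \<in> D N" using f g by auto
      have dw: "\<Delta> \<bullet> w \<bullet> f \<in> D N" "w \<bullet> f \<in> D N" using \<Delta> w f by auto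
      have le: "\<Delta> \<bullet> w \<bullet> f \<preceq> ?n" "w \<bullet> f \<preceq> ?n" using dw f by (simp_all add: g_app Le_Add_left)
      assume "T \<bullet> ?s = Sc Z"
      then have "U ?s (Sc ?n) = Sc Z" using f n s by (simp add: T_app)
      \<comment> \<open>Membership includes the test on the whole segment, of length n. As \<omega>
        takes the same value at f and at the extended segment, this test says \<omega>(f) > n,
        whereas n is at least \<omega>(f).\<close>
      from U_one(1)[OF s _ this n] have "Sc ?n \<preceq> w \<bullet> Pad (Bar (Pad ?s) ?n)" using n by simp
      moreover have "Bar (Pad ?s) ?n = ?s" using bar_pad[of f ?n ?n] f n by simp
      moreover have "w \<bullet> f = w \<bullet> Pad ?s"
      proof -
        have "Bar f (\<Delta> \<bullet> w \<bullet> f) = Bar (Pad ?s) (\<Delta> \<bullet> w \<bullet> f)"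
          using bar_pad[OF f(1) n dw(1) le(1)] by simp
        then show ?thesis using pc w f s arith_closed(16) bin_Pad_Bar[OF f n] unfolding pc_def by blast
      qed
      ultimately show False using not_Sc_Le[OF le(2) dw(2) n] by simp
    qed
    show "uc ?\<Omega> \<phi>"
      unfolding uc_def \<Omega>_app
    proof (intro ballI impI)
      let ?N = "\<Phi> \<bullet> g \<bullet> T"
      fix f f' assume f: "f \<in> D T1" "bin f" and f': "f' \<in> D T1" "bin f'" and eqN: "Bar f ?N = Bar f' ?N"
      have N: "?N \<in> D N" using \<Phi> g T by auto
      obtain n where n: "n \<in> D N" "n \<preceq> ?N" "T \<bullet> Bar f n \<noteq> Sc Z"
        using \<Phi>(2) tree barred f g T unfolding ufan_def by blast
      let ?s = "Bar f n"
      have s: "?s \<in> D N" using f n by simp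
      show "\<phi> \<bullet> f = \<phi> \<bullet> f'"
      proof (rule ccontr)
        assume neq: "\<phi> \<bullet> f \<noteq> \<phi> \<bullet> f'"
        \<comment> \<open>A secured segment determines \<phi>: its extension by zeros agrees with h
          on as many entries as \<omega> asks for at this extension.\<close>
        have agree: "\<phi> \<bullet> Pad (Bar h m) = \<phi> \<bullet> h"
          if h: "h \<in> D T1" "bin h" and m: "m \<in> D N" "w \<bullet> Pad (Bar h m) \<preceq> m" for h m
        proof -
          let ?q = "Pad (Bar h m)"
          have "?q \<in> D T1" "bin ?q" using h m bin_Pad_Bar by auto
          moreover from this have "Bar ?q (w \<bullet> ?q) = Bar h (w \<bullet> ?q)"
            using bar_pad[of h m "w \<bullet> ?q"] h m w by simp
          ultimately show ?thesis using pc \<phi> h unfolding pc_def w_def by blast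
        qed
        \<comment> \<open>If \<phi> separates f and f', which share their first N entries, then no
          common initial segment is secured. So all tests up to length n succeed and the segment of
          length n lies in T, against the choice of n.\<close>
        have "U ?s (Sc n) = Sc Z"
        proof (rule induct_imp[where ?F1.0 = "\<lambda>m. Monus m (Sc n)" and ?G1.0 = "\<lambda>m. Z" and
              ?F2.0 = "U ?s" and ?G2.0 = "\<lambda>m. Sc Z"])
          fix m assume m: "m \<in> D N" and IH: "Monus m (Sc n) = Z \<Longrightarrow> U ?s m = Sc Z"
            and "Monus (Sc m) (Sc n) = Z"
          then have le: "m \<preceq> n" using m n Sc_Le_Sc[of m n] by (simp add: Le_def)
          then have "m \<preceq> Sc n" using Le_Sc m n by blast
          then have one: "U ?s m = Sc Z" using IH by (simp add: Le_def)
          have eqm: "Bar f m = Bar f' m"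
            using Bar_mono[OF f(1) f'(1) N m eqN] Le_trans[OF le n(2)] m n N by simp
          have "\<not> w \<bullet> Pad (Bar f m) \<preceq> m"
            using agree[OF f m] agree[OF f' m] eqm neq by auto
          then have "Sc m \<preceq> w \<bullet> Pad (Bar f m)" using w f m by (simp add: not_Le)
          moreover have "Pad ?s \<bullet> m \<preceq> Sc Z" using bin_Pad_Bar[OF f n(1)] m by (simp add: bin_def)
          ultimately show "U ?s (Sc m) = Sc Z"
            using one bar_pad[OF f(1) n(1) m le] s m by (simp add: U_Sc)
        qed (use s n rep_U' in \<open>auto simp: U_Z simp del: Monus_simps intro!: reps\<close>)
        then show False using n(3) s f n(1) by (simp add: T_app)
      qed
    qed
  qed
qed

theorem sat_equivalence: "sat S e bs ((UFAN2 \<^bold>\<and> MPC) \<^bold>\<longleftrightarrow> MUC)"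
  using UFAN2_MPC_imp_MUC MUC_imp_UFAN2 MUC_imp_MPC by (auto simp: sat_UFAN2 sat_MPC sat_MUC)

end

section \<open>Models from structures satisfying the axioms\<close>

lemma eval_lift [simp]: "eval S e (d # bs) (lift t) = eval S e bs t"
  by (induction t) auto

lemma has_ty_lift: "has_ty L \<Delta> t \<tau> \<Longrightarrow> has_ty L (\<sigma> # \<Delta>) (lift t) \<tau>"
  by (induction t arbitrary: \<tau>) auto

lemma set_tm_lift [simp]: "set_tm (lift t) = set_tm t"
  by (induction t) auto

lemma wff_eq: "star_free \<tau> \<Longrightarrow> has_ty L \<Delta> s \<tau> \<Longrightarrow> has_ty L \<Delta> t \<tau> \<Longrightarrow> wff L \<Delta> (eq \<tau> s t)"
proof (induction \<tau> arbitrary: \<Delta> s t)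
  case (Fun \<sigma> \<tau>)
  then have "wff L (\<sigma> # \<Delta>) (eq \<tau> (lift s \<cdot> Bd 0) (lift t \<cdot> Bd 0))"
    by (intro Fun.IH) (auto intro: has_ty_lift)
  then show ?case using Fun.prems by simp
qed auto

lemma set_fm_eq: "star_free \<tau> \<Longrightarrow> set_fm (eq \<tau> s t) = set_tm s \<union> set_tm t"
  by (induction \<tau> arbitrary: s t) auto

lemma is_fm_eq [simp]: "star_free \<tau> \<Longrightarrow> is_tm L s \<tau> \<Longrightarrow> is_tm L t \<tau> \<Longrightarrow> is_fm L (eq \<tau> s t)"
  by (auto simp: is_fm_def is_tm_def wff_eq set_fm_eq)

text \<open>The clause for \<open>Seq\<close> is a placeholder, as \<open>Eq\<close> is applied at
  types without \<open>Seq\<close>. The quantifier ranges over the whole domain, not just over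
  standard arguments; this is why extensionality may be lost when only standard elements are
  kept.\<close>

primrec Eq :: "('a, 'b) struct_scheme \<Rightarrow> ty \<Rightarrow> 'a \<Rightarrow> 'a \<Rightarrow> bool" where
  "Eq S N x y = equ S x y"
| "Eq S (\<sigma> \<Rrightarrow> \<tau>) x y = (\<forall>d\<in>Dom S \<sigma>. Eq S \<tau> (app S x d) (app S y d))"
| "Eq S (Seq \<sigma>) x y = True"

lemma sat_eq: "star_free \<tau> \<Longrightarrow> sat S e bs (eq \<tau> s t) \<longleftrightarrow> Eq S \<tau> (eval S e bs s) (eval S e bs t)"
  by (induction \<tau> arbitrary: s t bs) auto

text \<open>Disjoint domains let an element determine its type, so that representatives can be
  chosen by a function of the element alone. The parameter L allows one treatment of both
  theories.\<close>

locale epra_struct =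
  fixes S :: "'a struct" and L :: lang
  assumes Dom_disjoint: "x \<in> Dom S \<sigma> \<Longrightarrow> x \<in> Dom S \<tau> \<Longrightarrow> \<sigma> = \<tau>"
    and app_closed: "x \<in> Dom S (\<sigma> \<Rrightarrow> \<tau>) \<Longrightarrow> y \<in> Dom S \<sigma> \<Longrightarrow> app S x y \<in> Dom S \<tau>"
    and con_closed: "cn_in L c \<Longrightarrow> con S c \<in> Dom S (cty c)"
    and nonempty: "ty_in L \<tau> \<Longrightarrow> Dom S \<tau> \<noteq> {}"
    and epra: "A \<in> EPRA \<Longrightarrow> is_fm L A \<Longrightarrow> env_in L S e \<Longrightarrow> sat S e [] A"
begin

abbreviation D :: "ty \<Rightarrow> 'a set" where "D \<equiv> Dom S"
abbreviation ap :: "'a \<Rightarrow> 'a \<Rightarrow> 'a" (infixl "\<bullet>" 200) where "x \<bullet> y \<equiv> app S x y"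

definition some_env :: "var \<Rightarrow> 'a" where "some_env v = (SOME d. d \<in> D (snd v))"

lemma some_env [simp]: "env_in L S some_env"
  unfolding env_in_def some_env_def by (metis nonempty some_in_eq)

lemma con_in_Dom:
  "con S cZero \<in> D N" "con S cSucc \<in> D T1" "con S cRec \<in> D (N \<Rrightarrow> N \<Rrightarrow> (N \<Rrightarrow> N \<Rrightarrow> N) \<Rrightarrow> N)"
  "star_free \<sigma> \<Longrightarrow> star_free \<tau> \<Longrightarrow> con S (cK \<sigma> \<tau>) \<in> D (\<sigma> \<Rrightarrow> \<tau> \<Rrightarrow> \<sigma>)"
  "star_free \<rho> \<Longrightarrow> star_free \<sigma> \<Longrightarrow> star_free \<tau> \<Longrightarrow>
    con S (cS \<rho> \<sigma> \<tau>) \<in> D ((\<rho> \<Rrightarrow> \<sigma> \<Rrightarrow> \<tau>) \<Rrightarrow> (\<rho> \<Rrightarrow> \<sigma>) \<Rrightarrow> \<rho> \<Rrightarrow> \<tau>)"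
  using con_closed[of cZero] con_closed[of cSucc] con_closed[of cRec] con_closed[of "cK \<sigma> \<tau>"]
    con_closed[of "cS \<rho> \<sigma> \<tau>"] by simp_all

lemma equ_refl: "x \<in> D N \<Longrightarrow> equ S x x"
  using epra[OF EPRA.eq_refl, of "some_env((''x'', N) := x)"] by simp

lemma equ_sym: "x \<in> D N \<Longrightarrow> y \<in> D N \<Longrightarrow> equ S x y \<Longrightarrow> equ S y x"
  using epra[OF EPRA.eq_sym, of "some_env((''x'', N) := x, (''y'', N) := y)"] by simp

lemma equ_trans: "x \<in> D N \<Longrightarrow> y \<in> D N \<Longrightarrow> z \<in> D N \<Longrightarrow> equ S x y \<Longrightarrow> equ S y z \<Longrightarrow> equ S x z"
  using epra[OF EPRA.eq_trans, of "some_env((''x'', N) := x, (''y'', N) := y, (''z'', N) := z)"] by simp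

lemma suc_inj: "x \<in> D N \<Longrightarrow> y \<in> D N \<Longrightarrow> equ S (con S cSucc \<bullet> x) (con S cSucc \<bullet> y) \<Longrightarrow> equ S x y"
  using epra[OF EPRA.suc_inj, of "some_env((''x'', N) := x, (''y'', N) := y)"] by simp

lemma suc_nz: "x \<in> D N \<Longrightarrow> \<not> equ S (con S cSucc \<bullet> x) (con S cZero)"
  using epra[OF EPRA.suc_nz, of "some_env((''x'', N) := x)"] by simp

lemma rec_0: "a \<in> D N \<Longrightarrow> h \<in> D (N \<Rrightarrow> N \<Rrightarrow> N) \<Longrightarrow> equ S (con S cRec \<bullet> con S cZero \<bullet> a \<bullet> h) a"
  using epra[OF EPRA.rec_0, of "some_env((''y'', N) := a, (''z'', N \<Rrightarrow> N \<Rrightarrow> N) := h)"] by simp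

lemma rec_suc: "n \<in> D N \<Longrightarrow> a \<in> D N \<Longrightarrow> h \<in> D (N \<Rrightarrow> N \<Rrightarrow> N) \<Longrightarrow>
    equ S (con S cRec \<bullet> (con S cSucc \<bullet> n) \<bullet> a \<bullet> h) (h \<bullet> (con S cRec \<bullet> n \<bullet> a \<bullet> h) \<bullet> n)"
  using epra[OF EPRA.rec_suc, of "some_env((''x'', N) := n, (''y'', N) := a, (''z'', N \<Rrightarrow> N \<Rrightarrow> N) := h)"]
  by simp

lemma comb_K: "star_free \<sigma> \<Longrightarrow> star_free \<tau> \<Longrightarrow> x \<in> D \<sigma> \<Longrightarrow> y \<in> D \<tau> \<Longrightarrow>
    Eq S \<sigma> (con S (cK \<sigma> \<tau>) \<bullet> x \<bullet> y) x"
  using epra[OF EPRA.comb_K[of \<sigma> \<tau>], of "some_env((''x'', \<sigma>) := x, (''y'', \<tau>) := y)"] by (simp add: sat_eq)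

lemma comb_S: "star_free \<rho> \<Longrightarrow> star_free \<sigma> \<Longrightarrow> star_free \<tau> \<Longrightarrow>
    x \<in> D (\<rho> \<Rrightarrow> \<sigma> \<Rrightarrow> \<tau>) \<Longrightarrow> y \<in> D (\<rho> \<Rrightarrow> \<sigma>) \<Longrightarrow> z \<in> D \<rho> \<Longrightarrow>
    Eq S \<tau> (con S (cS \<rho> \<sigma> \<tau>) \<bullet> x \<bullet> y \<bullet> z) (x \<bullet> z \<bullet> (y \<bullet> z))"
  using epra[OF EPRA.comb_S[of \<tau> \<rho> \<sigma>], of "some_env((''x'', \<rho> \<Rrightarrow> \<sigma> \<Rrightarrow> \<tau>) := x, (''y'', \<rho> \<Rrightarrow> \<sigma>) := y, (''z'', \<rho>) := z)"]
  by (simp add: sat_eq)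

lemma extensionality: "star_free \<rho> \<Longrightarrow> star_free \<tau> \<Longrightarrow> x \<in> D \<rho> \<Longrightarrow> y \<in> D \<rho> \<Longrightarrow> f \<in> D (\<rho> \<Rrightarrow> \<tau>) \<Longrightarrow>
    Eq S \<rho> x y \<Longrightarrow> Eq S \<tau> (f \<bullet> x) (f \<bullet> y)"
  using epra[OF EPRA.extensionality[of \<rho> \<tau>],
    of "some_env((''x'', \<rho>) := x, (''y'', \<rho>) := y, (''f'', \<rho> \<Rrightarrow> \<tau>) := f)"]
  by (simp add: sat_eq)

text \<open>Induction reaches the models through a single instance of the schema, whose parameters
  are six variables of type 1. This is the origin of \<open>induct6\<close>.\<close>

lemma induction_axiom:
  assumes fs: "\<forall>f\<in>{f1, g1, f2, g2, f3, g3}. f \<in> D T1"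
    and P: "P = (\<lambda>x. (equ S (f1 \<bullet> x) (g1 \<bullet> x) \<longrightarrow> equ S (f2 \<bullet> x) (g2 \<bullet> x)) \<longrightarrow> equ S (f3 \<bullet> x) (g3 \<bullet> x))"
    and base: "P (con S cZero)" and step: "\<And>x. x \<in> D N \<Longrightarrow> P x \<Longrightarrow> P (con S cSucc \<bullet> x)" and x: "x \<in> D N"
  shows "P x"
proof -
  let ?F = "\<lambda>f. V f T1 \<cdot> V ''n'' N"
  define A where "A = (((?F ''f1'' \<^bold>= ?F ''g1'') \<^bold>\<longrightarrow> (?F ''f2'' \<^bold>= ?F ''g2'')) \<^bold>\<longrightarrow> (?F ''f3'' \<^bold>= ?F ''g3''))"
  let ?B = "subst (''n'', N) zero A \<^bold>\<and> all (''n'', N) (A \<^bold>\<longrightarrow> subst (''n'', N) (suc (V ''n'' N)) A) \<^bold>\<longrightarrow> all (''n'', N) A"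
  let ?e = "some_env((''f1'', T1) := f1, (''g1'', T1) := g1, (''f2'', T1) := f2, (''g2'', T1) := g2,
    (''f3'', T1) := f3, (''g3'', T1) := g3)"
  have A: "is_fm K A" "qf A" for K by (simp_all add: A_def)
  have fm: "is_fm L ?B" using A by (auto intro!: is_fm_all simp: A_def subst_def)
  have ax: "?B \<in> EPRA" using A by (rule EPRA.qf_induction)
  have "env_in L S ?e" using fs by simp
  note sat = epra[OF ax fm this]
  have "sat S ?e [] ?B \<longleftrightarrow> (P (con S cZero) \<and> (\<forall>d\<in>D N. P d \<longrightarrow> P (con S cSucc \<bullet> d)) \<longrightarrow> (\<forall>d\<in>D N. P d))"
    by (simp add: A_def subst_def P)
  with sat show ?thesis using base step x by blast
qed

lemma Eq_refl: "star_free \<tau> \<Longrightarrow> x \<in> D \<tau> \<Longrightarrow> Eq S \<tau> x x"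
  by (induction \<tau> arbitrary: x) (auto intro: equ_refl app_closed)

lemma Eq_sym: "star_free \<tau> \<Longrightarrow> x \<in> D \<tau> \<Longrightarrow> y \<in> D \<tau> \<Longrightarrow> Eq S \<tau> x y \<Longrightarrow> Eq S \<tau> y x"
proof (induction \<tau> arbitrary: x y)
  case (Fun \<sigma> \<tau>)
  then show ?case using app_closed[of _ \<sigma> \<tau>] by (auto intro!: Fun.IH(2))
qed (auto intro: equ_sym)

lemma Eq_trans: "star_free \<tau> \<Longrightarrow> x \<in> D \<tau> \<Longrightarrow> y \<in> D \<tau> \<Longrightarrow> z \<in> D \<tau> \<Longrightarrow>
    Eq S \<tau> x y \<Longrightarrow> Eq S \<tau> y z \<Longrightarrow> Eq S \<tau> x z"
proof (induction \<tau> arbitrary: x y z)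
  case (Fun \<sigma> \<tau>)
  have "Eq S \<tau> (x \<bullet> d) (z \<bullet> d)" if "d \<in> D \<sigma>" for d
    by (rule Fun.IH(2)[of _ "y \<bullet> d"]) (use Fun.prems that in \<open>auto intro: app_closed\<close>)
  then show ?case by simp
qed (auto intro: equ_trans)

lemma Eq_app: "star_free \<rho> \<Longrightarrow> star_free \<tau> \<Longrightarrow> f \<in> D (\<rho> \<Rrightarrow> \<tau>) \<Longrightarrow> g \<in> D (\<rho> \<Rrightarrow> \<tau>) \<Longrightarrow>
    x \<in> D \<rho> \<Longrightarrow> y \<in> D \<rho> \<Longrightarrow> Eq S (\<rho> \<Rrightarrow> \<tau>) f g \<Longrightarrow> Eq S \<rho> x y \<Longrightarrow> Eq S \<tau> (f \<bullet> x) (g \<bullet> y)"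
  by (rule Eq_trans[of _ _ "f \<bullet> y"]) (auto intro: app_closed extensionality)

subsection \<open>Canonical representatives\<close>

text \<open>Choosing representatives instead of forming classes keeps the quotient on the same
  carrier.\<close>

definition can :: "'a \<Rightarrow> 'a" where
  "can x = (SOME y. \<exists>\<tau>. star_free \<tau> \<and> x \<in> D \<tau> \<and> y \<in> D \<tau> \<and> Eq S \<tau> x y)"

lemma can: assumes "star_free \<tau>" "x \<in> D \<tau>" shows "can x \<in> D \<tau>" "Eq S \<tau> x (can x)"
proof -
  have "\<exists>\<tau>. star_free \<tau> \<and> x \<in> D \<tau> \<and> can x \<in> D \<tau> \<and> Eq S \<tau> x (can x)"
    unfolding can_def by (rule someI_ex) (use assms Eq_refl in blast)
  then show "can x \<in> D \<tau>" "Eq S \<tau> x (can x)" using assms Dom_disjoint by metis+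
qed

lemma can_eq_iff:
  assumes "star_free \<tau>" "x \<in> D \<tau>" "y \<in> D \<tau>"
  shows "can x = can y \<longleftrightarrow> Eq S \<tau> x y"
proof
  assume "can x = can y"
  then show "Eq S \<tau> x y"
    using can[OF assms(1,2)] can[OF assms(1,3)] assms Eq_sym Eq_trans[of \<tau> x "can x" y] by metis
next
  assume xy: "Eq S \<tau> x y"
  \<comment> \<open>Extensionally equal elements put the very same predicate under
    \<open>SOME\<close>, hence get the same representative.\<close>
  have "(star_free \<sigma> \<and> x \<in> D \<sigma> \<and> z \<in> D \<sigma> \<and> Eq S \<sigma> x z) = (star_free \<sigma> \<and> y \<in> D \<sigma> \<and> z \<in> D \<sigma> \<and> Eq S \<sigma> y z)" for \<sigma> z
  proof (cases "\<sigma> = \<tau>")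
    case True
    then show ?thesis using assms xy Eq_sym[of \<tau> x y] Eq_trans[of \<tau> x y z] Eq_trans[of \<tau> y x z] by auto
  next
    case False
    then show ?thesis using assms Dom_disjoint by metis
  qed
  then show "can x = can y" unfolding can_def by simp
qed

lemma can_can [simp]: "star_free \<tau> \<Longrightarrow> x \<in> D \<tau> \<Longrightarrow> can (can x) = can x"
  using can_eq_iff[of \<tau> "can x" x] can[of \<tau> x] Eq_sym by blast

lemma can_app: "star_free \<sigma> \<Longrightarrow> star_free \<tau> \<Longrightarrow> f \<in> D (\<sigma> \<Rrightarrow> \<tau>) \<Longrightarrow> x \<in> D \<sigma> \<Longrightarrow>
    can (can f \<bullet> can x) = can (f \<bullet> x)"
  using can[of "\<sigma> \<Rrightarrow> \<tau>" f] can[of \<sigma> x] Eq_app[of \<sigma> \<tau> "can f" f "can x" x] Eq_sym[of "\<sigma> \<Rrightarrow> \<tau>" f "can f"] Eq_sym[of \<sigma> x "can x"]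
  by (subst can_eq_iff[of \<tau>]) (auto intro: app_closed)

end

text \<open>U is the part that is kept: everything for \<open>RCA0_omega\<close>, the standard
  elements for \<open>RCA0_Omega\<close>. Downward closure among numbers preserves induction and
  makes bounded quantifiers mean the same in the part.\<close>

locale substruct = epra_struct S L for S :: "'a struct" and L +
  fixes U :: "'a \<Rightarrow> bool"
  assumes U_app: "star_free \<sigma> \<Longrightarrow> star_free \<tau> \<Longrightarrow> f \<in> Dom S (\<sigma> \<Rrightarrow> \<tau>) \<Longrightarrow> x \<in> Dom S \<sigma> \<Longrightarrow>
      U f \<Longrightarrow> U x \<Longrightarrow> U (app S f x)"
    and U_con: "cn_in Base c \<Longrightarrow> U (con S c)"
    and U_Eq: "star_free \<tau> \<Longrightarrow> x \<in> Dom S \<tau> \<Longrightarrow> y \<in> Dom S \<tau> \<Longrightarrow> U x \<Longrightarrow> Eq S \<tau> x y \<Longrightarrow> U y"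
    and U_le: "m \<in> Dom S N \<Longrightarrow> n \<in> Dom S N \<Longrightarrow> U n \<Longrightarrow> le_in S m n \<Longrightarrow> U m"
begin

text \<open>Types with \<open>Seq\<close> are discarded by giving them empty domains, and what is
  left counts as standard throughout.\<close>

definition quot :: "'a struct" where
  "quot = \<lparr>Dom = \<lambda>\<tau>. if star_free \<tau> then can ` {x \<in> D \<tau>. U x} else {},
     app = \<lambda>x y. can (x \<bullet> y), con = \<lambda>c. can (con S c), equ = (=), std = \<lambda>_. True\<rparr>"

lemma quot_simps [simp]: "app quot x y = can (x \<bullet> y)" "con quot c = can (con S c)" "equ quot x y \<longleftrightarrow> x = y"
  by (simp_all add: quot_def)

lemma Dom_quot: "x \<in> Dom quot \<tau> \<longleftrightarrow> star_free \<tau> \<and> x \<in> D \<tau> \<and> U x \<and> can x = x"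
proof
  assume "x \<in> Dom quot \<tau>"
  then obtain y where y: "star_free \<tau>" "y \<in> D \<tau>" "U y" "x = can y"
    by (auto simp: quot_def split: if_splits)
  then show "star_free \<tau> \<and> x \<in> D \<tau> \<and> U x \<and> can x = x"
    using can[of \<tau> y] U_Eq[of \<tau> y x] by simp
next
  assume x: "star_free \<tau> \<and> x \<in> D \<tau> \<and> U x \<and> can x = x"
  then have "can x \<in> can ` {x \<in> D \<tau>. U x}" by blast
  then show "x \<in> Dom quot \<tau>" using x by (simp add: quot_def)
qed

lemma can_in_quot: "star_free \<tau> \<Longrightarrow> x \<in> D \<tau> \<Longrightarrow> U x \<Longrightarrow> can x \<in> Dom quot \<tau>"
  by (auto simp: quot_def)

lemma app_quot_closed: "x \<in> Dom quot (\<sigma> \<Rrightarrow> \<tau>) \<Longrightarrow> y \<in> Dom quot \<sigma> \<Longrightarrow> app quot x y \<in> Dom quot \<tau>"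
  unfolding quot_simps by (rule can_in_quot) (auto simp: Dom_quot intro: app_closed U_app)

lemma con_quot_closed: "cn_in Base c \<Longrightarrow> con quot c \<in> Dom quot (cty c)"
  unfolding quot_simps using ty_in_cty[of Base c]
  by (intro can_in_quot) (auto intro: con_closed cn_in_mono U_con)

text \<open>Application in the quotient normalizes after every argument. Such equations remove the
  inner normalizations one at a time.\<close>

lemma can_app1: "star_free \<sigma> \<Longrightarrow> star_free \<tau> \<Longrightarrow> f \<in> D (\<sigma> \<Rrightarrow> \<tau>) \<Longrightarrow> x \<in> D \<sigma> \<Longrightarrow> can x = x \<Longrightarrow>
    can (can f \<bullet> x) = can (f \<bullet> x)"
  using can_app[of \<sigma> \<tau> f x] by simp

lemma can_app2: "star_free \<sigma> \<Longrightarrow> star_free \<tau> \<Longrightarrow> f \<in> D (\<sigma> \<Rrightarrow> \<tau>) \<Longrightarrow> x \<in> D \<sigma> \<Longrightarrow> can f = f \<Longrightarrow>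
    can (f \<bullet> can x) = can (f \<bullet> x)"
  using can_app[of \<sigma> \<tau> f x] by simp

lemma quot_equations:
  "star_free \<sigma> \<Longrightarrow> star_free \<tau> \<Longrightarrow> x \<in> Dom quot \<sigma> \<Longrightarrow> y \<in> Dom quot \<tau> \<Longrightarrow>
    app quot (app quot (con quot (cK \<sigma> \<tau>)) x) y = x"
  "star_free \<rho> \<Longrightarrow> star_free \<sigma> \<Longrightarrow> star_free \<tau> \<Longrightarrow>
    u \<in> Dom quot (\<rho> \<Rrightarrow> \<sigma> \<Rrightarrow> \<tau>) \<Longrightarrow> v \<in> Dom quot (\<rho> \<Rrightarrow> \<sigma>) \<Longrightarrow> w \<in> Dom quot \<rho> \<Longrightarrow>
    app quot (app quot (app quot (con quot (cS \<rho> \<sigma> \<tau>)) u) v) w = app quot (app quot u w) (app quot v w)"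
  "m \<in> Dom quot N \<Longrightarrow> n \<in> Dom quot N \<Longrightarrow>
    app quot (con quot cSucc) m = app quot (con quot cSucc) n \<Longrightarrow> m = n"
  "m \<in> Dom quot N \<Longrightarrow> app quot (con quot cSucc) m \<noteq> con quot cZero"
  "a \<in> Dom quot N \<Longrightarrow> h \<in> Dom quot (N \<Rrightarrow> N \<Rrightarrow> N) \<Longrightarrow>
    app quot (app quot (app quot (con quot cRec) (con quot cZero)) a) h = a"
  "n \<in> Dom quot N \<Longrightarrow> a \<in> Dom quot N \<Longrightarrow> h \<in> Dom quot (N \<Rrightarrow> N \<Rrightarrow> N) \<Longrightarrow>
    app quot (app quot (app quot (con quot cRec) (app quot (con quot cSucc) n)) a) h =
    app quot (app quot h (app quot (app quot (app quot (con quot cRec) n) a) h)) n"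
proof -
  note con_in_Dom [simp]
  show "app quot (app quot (con quot (cK \<sigma> \<tau>)) x) y = x"
    if ty: "star_free \<sigma>" "star_free \<tau>" and "x \<in> Dom quot \<sigma>" "y \<in> Dom quot \<tau>"
  proof -
    have xy: "x \<in> D \<sigma>" "y \<in> D \<tau>" "can x = x" "can y = y" using that by (auto simp: Dom_quot)
    have K: "con S (cK \<sigma> \<tau>) \<bullet> x \<in> D (\<tau> \<Rrightarrow> \<sigma>)" using con_in_Dom(4)[OF ty] xy(1) by (rule app_closed)
    have "app quot (app quot (con quot (cK \<sigma> \<tau>)) x) y = can (con S (cK \<sigma> \<tau>) \<bullet> x \<bullet> y)"
      using ty xy K can_app1[of \<sigma> "\<tau> \<Rrightarrow> \<sigma>" "con S (cK \<sigma> \<tau>)" x] can_app1[of \<tau> \<sigma> "con S (cK \<sigma> \<tau>) \<bullet> x" y] by simp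
    also have "\<dots> = can x" using comb_K[OF ty xy(1,2)] ty xy(1) app_closed[OF K xy(2)] can_eq_iff[of \<sigma> _ x] by blast
    finally show ?thesis using xy by simp
  qed
  show "app quot (app quot (app quot (con quot (cS \<rho> \<sigma> \<tau>)) u) v) w = app quot (app quot u w) (app quot v w)"
    if ty: "star_free \<rho>" "star_free \<sigma>" "star_free \<tau>" and
      "u \<in> Dom quot (\<rho> \<Rrightarrow> \<sigma> \<Rrightarrow> \<tau>)" "v \<in> Dom quot (\<rho> \<Rrightarrow> \<sigma>)" "w \<in> Dom quot \<rho>"
  proof -
    have d: "u \<in> D (\<rho> \<Rrightarrow> \<sigma> \<Rrightarrow> \<tau>)" "v \<in> D (\<rho> \<Rrightarrow> \<sigma>)" "w \<in> D \<rho>" "can u = u" "can v = v" "can w = w"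
      using that by (auto simp: Dom_quot)
    let ?S = "con S (cS \<rho> \<sigma> \<tau>)"
    have S: "?S \<bullet> u \<in> D ((\<rho> \<Rrightarrow> \<sigma>) \<Rrightarrow> \<rho> \<Rrightarrow> \<tau>)" "?S \<bullet> u \<bullet> v \<in> D (\<rho> \<Rrightarrow> \<tau>)" "?S \<bullet> u \<bullet> v \<bullet> w \<in> D \<tau>"
      "u \<bullet> w \<in> D (\<sigma> \<Rrightarrow> \<tau>)" "v \<bullet> w \<in> D \<sigma>" "u \<bullet> w \<bullet> (v \<bullet> w) \<in> D \<tau>"
      using con_in_Dom(5)[OF ty] d by (meson app_closed)+
    have "app quot (app quot (app quot (con quot (cS \<rho> \<sigma> \<tau>)) u) v) w = can (?S \<bullet> u \<bullet> v \<bullet> w)"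
      using ty d S can_app1[of "\<rho> \<Rrightarrow> \<sigma> \<Rrightarrow> \<tau>" "(\<rho> \<Rrightarrow> \<sigma>) \<Rrightarrow> \<rho> \<Rrightarrow> \<tau>" ?S u]
        can_app1[of "\<rho> \<Rrightarrow> \<sigma>" "\<rho> \<Rrightarrow> \<tau>" "?S \<bullet> u" v] can_app1[of \<rho> \<tau> "?S \<bullet> u \<bullet> v" w] by simp
    also have "\<dots> = can (u \<bullet> w \<bullet> (v \<bullet> w))"
      using comb_S[OF ty d(1-3)] ty S can_eq_iff[of \<tau>] by blast
    also have "\<dots> = app quot (app quot u w) (app quot v w)"
      using ty S can_app[of \<sigma> \<tau> "u \<bullet> w" "v \<bullet> w"] by simp
    finally show ?thesis .
  qed
  have suc: "app quot (con quot cSucc) m = can (con S cSucc \<bullet> m)" if "m \<in> Dom quot N" for m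
    using that can_app1[of N N "con S cSucc" m] by (auto simp: Dom_quot)
  have suc_D: "con S cSucc \<bullet> m \<in> D N" if "m \<in> D N" for m using con_in_Dom(2) that by (rule app_closed)
  show "m = n" if mn: "m \<in> Dom quot N" "n \<in> Dom quot N" and "app quot (con quot cSucc) m = app quot (con quot cSucc) n"
  proof -
    have "equ S (con S cSucc \<bullet> m) (con S cSucc \<bullet> n)"
      using that suc suc_D can_eq_iff[of N "con S cSucc \<bullet> m" "con S cSucc \<bullet> n"] by (auto simp: Dom_quot)
    then have "can m = can n" using mn suc_inj can_eq_iff[of N m n] by (auto simp: Dom_quot)
    then show ?thesis using mn by (auto simp: Dom_quot)
  qed
  show "app quot (con quot cSucc) m \<noteq> con quot cZero" if "m \<in> Dom quot N"
    using suc[OF that] that suc_D suc_nz can_eq_iff[of N "con S cSucc \<bullet> m" "con S cZero"]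
    by (auto simp: Dom_quot)
  have rec: "app quot (app quot (app quot (con quot cRec) n) a) h = can (con S cRec \<bullet> n \<bullet> a \<bullet> h)
      \<and> con S cRec \<bullet> n \<bullet> a \<bullet> h \<in> D N"
    if "n \<in> Dom quot N" "a \<in> Dom quot N" "h \<in> Dom quot (N \<Rrightarrow> N \<Rrightarrow> N)" for n a h
  proof -
    have d: "n \<in> D N" "a \<in> D N" "h \<in> D (N \<Rrightarrow> N \<Rrightarrow> N)" "can n = n" "can a = a" "can h = h"
      using that by (auto simp: Dom_quot)
    have R: "con S cRec \<bullet> n \<in> D (N \<Rrightarrow> (N \<Rrightarrow> N \<Rrightarrow> N) \<Rrightarrow> N)" "con S cRec \<bullet> n \<bullet> a \<in> D ((N \<Rrightarrow> N \<Rrightarrow> N) \<Rrightarrow> N)"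
      "con S cRec \<bullet> n \<bullet> a \<bullet> h \<in> D N"
      using con_in_Dom(3) d by (meson app_closed)+
    then show ?thesis
      using d can_app1[of N "N \<Rrightarrow> (N \<Rrightarrow> N \<Rrightarrow> N) \<Rrightarrow> N" "con S cRec" n]
        can_app1[of N "(N \<Rrightarrow> N \<Rrightarrow> N) \<Rrightarrow> N" "con S cRec \<bullet> n" a]
        can_app1[of "N \<Rrightarrow> N \<Rrightarrow> N" N "con S cRec \<bullet> n \<bullet> a" h] by simp
  qed
  have zero: "con quot cZero \<in> Dom quot N" using con_quot_closed[of cZero] by simp
  show "app quot (app quot (app quot (con quot cRec) (con quot cZero)) a) h = a"
    if a: "a \<in> Dom quot N" and h: "h \<in> Dom quot (N \<Rrightarrow> N \<Rrightarrow> N)"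
  proof -
    have d: "a \<in> D N" "h \<in> D (N \<Rrightarrow> N \<Rrightarrow> N)" "can a = a" "can h = h" using that by (auto simp: Dom_quot)
    let ?z = "con S cZero"
    have R: "con S cRec \<bullet> ?z \<in> D (N \<Rrightarrow> (N \<Rrightarrow> N \<Rrightarrow> N) \<Rrightarrow> N)" "con S cRec \<bullet> ?z \<bullet> a \<in> D ((N \<Rrightarrow> N \<Rrightarrow> N) \<Rrightarrow> N)"
      "con S cRec \<bullet> ?z \<bullet> a \<bullet> h \<in> D N"
      using con_in_Dom(1,3) d by (meson app_closed)+
    then have "app quot (app quot (app quot (con quot cRec) (con quot cZero)) a) h = can (con S cRec \<bullet> ?z \<bullet> a \<bullet> h)"
      using d can_app[of N "N \<Rrightarrow> (N \<Rrightarrow> N \<Rrightarrow> N) \<Rrightarrow> N" "con S cRec" ?z]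
        can_app1[of N "(N \<Rrightarrow> N \<Rrightarrow> N) \<Rrightarrow> N" "con S cRec \<bullet> ?z" a]
        can_app1[of "N \<Rrightarrow> N \<Rrightarrow> N" N "con S cRec \<bullet> ?z \<bullet> a" h] by simp
    also have "\<dots> = can a" by (subst can_eq_iff[of N]) (use rec_0[OF d(1,2)] R d in simp_all)
    finally show ?thesis using d by simp
  qed
  show "app quot (app quot (app quot (con quot cRec) (app quot (con quot cSucc) n)) a) h =
    app quot (app quot h (app quot (app quot (app quot (con quot cRec) n) a) h)) n"
    if n: "n \<in> Dom quot N" and a: "a \<in> Dom quot N" and h: "h \<in> Dom quot (N \<Rrightarrow> N \<Rrightarrow> N)"
  proof -
    have d: "n \<in> D N" "a \<in> D N" "h \<in> D (N \<Rrightarrow> N \<Rrightarrow> N)" "can n = n" "can a = a" "can h = h"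
      using that by (auto simp: Dom_quot)
    let ?s = "con S cSucc \<bullet> n"
    have R: "con S cRec \<bullet> ?s \<in> D (N \<Rrightarrow> (N \<Rrightarrow> N \<Rrightarrow> N) \<Rrightarrow> N)" "con S cRec \<bullet> ?s \<bullet> a \<in> D ((N \<Rrightarrow> N \<Rrightarrow> N) \<Rrightarrow> N)"
      "con S cRec \<bullet> ?s \<bullet> a \<bullet> h \<in> D N"
      using con_in_Dom(3) suc_D d by (meson app_closed)+
    let ?r = "con S cRec \<bullet> n \<bullet> a \<bullet> h"
    have r: "?r \<in> D N" "h \<bullet> ?r \<in> D T1" "h \<bullet> ?r \<bullet> n \<in> D N" using rec[OF n a h] d by (meson app_closed)+
    have "app quot (app quot (app quot (con quot cRec) (app quot (con quot cSucc) n)) a) h = can (con S cRec \<bullet> ?s \<bullet> a \<bullet> h)"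
      unfolding suc[OF n]
      using d R suc_D can_app[of N "N \<Rrightarrow> (N \<Rrightarrow> N \<Rrightarrow> N) \<Rrightarrow> N" "con S cRec" ?s]
        can_app1[of N "(N \<Rrightarrow> N \<Rrightarrow> N) \<Rrightarrow> N" "con S cRec \<bullet> ?s" a]
        can_app1[of "N \<Rrightarrow> N \<Rrightarrow> N" N "con S cRec \<bullet> ?s \<bullet> a" h] by simp
    also have "\<dots> = can (h \<bullet> ?r \<bullet> n)" by (subst can_eq_iff[of N]) (use rec_suc[OF d(1,2,3)] R r in simp_all)
    also have "\<dots> = app quot (app quot h (can ?r)) n"
      using d r can_app2[of N T1 h ?r] can_app1[of N N "h \<bullet> ?r" n] by simp
    finally show ?thesis using rec[OF n a h] by simp
  qed
qed

lemma eval_quot: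
  assumes "has_ty Base \<Delta> t \<tau>" "\<forall>c\<in>set_tm t. cn_in Base c" "length bs = length \<Delta>"
    "\<And>i. i < length \<Delta> \<Longrightarrow> star_free (\<Delta> ! i) \<and> bs ! i \<in> D (\<Delta> ! i) \<and> U (bs ! i)"
    "\<And>v. star_free (snd v) \<Longrightarrow> e v \<in> D (snd v) \<and> U (e v)"
  shows "star_free \<tau> \<and> eval S e bs t \<in> D \<tau> \<and> U (eval S e bs t) \<and>
    eval quot (\<lambda>v. can (e v)) (map can bs) t = can (eval S e bs t)"
  using assms(1,2)
proof (induction t arbitrary: \<tau>)
  case (Bd n)
  then show ?case using assms(3,4) by auto
next
  case (Fr v)
  then show ?case using assms(5)[of v] by auto
next
  case (Cn c)
  then show ?case using ty_in_cty[of Base c] by (auto intro: con_closed cn_in_mono U_con)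
next
  case (Ap s t)
  then obtain \<sigma> where st: "has_ty Base \<Delta> s (\<sigma> \<Rrightarrow> \<tau>)" "has_ty Base \<Delta> t \<sigma>" by auto
  note IH = Ap.IH(1)[OF st(1)] Ap.IH(2)[OF st(2)]
  then show ?case
    using Ap.prems(2) U_app[of \<sigma> \<tau>] app_closed[of _ \<sigma> \<tau>] can_app[of \<sigma> \<tau> "eval S e bs s" "eval S e bs t"] by simp
qed

lemma le_in_quot:
  assumes "x \<in> D N" "U x" "y \<in> D N" "U y"
  shows "le_in quot (can x) (can y) \<longleftrightarrow> le_in S x y"
proof -
  let ?t = "monusC \<cdot> Bd 0 \<cdot> Bd 1"
  have monus: "is_tm Base monusC (N \<Rrightarrow> N \<Rrightarrow> N)" by simp
  then have "has_ty Base [N, N] monusC (N \<Rrightarrow> N \<Rrightarrow> N)" by (simp only: is_tm_def has_ty_closed)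
  then have ty: "has_ty Base [N, N] ?t N" "\<forall>c\<in>set_tm ?t. cn_in Base c"
    using monus by (auto simp: is_tm_def intro!: exI[of _ N])
  \<comment> \<open>The environment for \<open>eval_quot\<close> needs values in U at every type
    without \<open>Seq\<close>; at function types constant functions supply them.\<close>
  have "\<exists>d. star_free \<tau> \<longrightarrow> d \<in> D \<tau> \<and> U d" for \<tau>
  proof (induction \<tau>)
    case N
    then show ?case using assms by blast
  next
    case (Fun \<sigma> \<tau>)
    then obtain d where d: "star_free \<tau> \<longrightarrow> d \<in> D \<tau> \<and> U d" by blast
    have "con S (cK \<tau> \<sigma>) \<bullet> d \<in> D (\<sigma> \<Rrightarrow> \<tau>) \<and> U (con S (cK \<tau> \<sigma>) \<bullet> d)" if "star_free (\<sigma> \<Rrightarrow> \<tau>)"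
      using that d con_in_Dom(4)[of \<tau> \<sigma>] U_con[of "cK \<tau> \<sigma>"] U_app[of \<tau> "\<sigma> \<Rrightarrow> \<tau>" "con S (cK \<tau> \<sigma>)" d] app_closed[of "con S (cK \<tau> \<sigma>)" \<tau> "\<sigma> \<Rrightarrow> \<tau>" d]
      by simp
    then show ?case by blast
  qed simp
  then obtain f where f: "\<And>\<tau>. star_free \<tau> \<Longrightarrow> f \<tau> \<in> D \<tau> \<and> U (f \<tau>)" by metis
  have bs: "star_free ([N, N] ! i) \<and> [x, y] ! i \<in> D ([N, N] ! i) \<and> U ([x, y] ! i)" if "i < length [N, N]" for i
    using that assms by (cases i) auto
  have ev: "eval quot (\<lambda>v. can (f (snd v))) (map can [x, y]) ?t = can (eval S (\<lambda>v. f (snd v)) [x, y] ?t)"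
    "eval S (\<lambda>v. f (snd v)) [x, y] ?t \<in> D N"
    using eval_quot[OF ty _ bs, of "\<lambda>v. f (snd v)"] f by simp_all
  have le_S: "le_in S x y \<longleftrightarrow> equ S (eval S (\<lambda>v. f (snd v)) [x, y] ?t) (con S cZero)"
    unfolding le_in_def using eval_monusC[of S "\<lambda>v. f (snd v)" "[x, y]"] by simp
  have "le_in quot (can x) (can y) \<longleftrightarrow>
      eval quot (\<lambda>v. can (f (snd v))) (map can [x, y]) ?t = can (con S cZero)"
    unfolding le_in_def using eval_monusC[of quot "\<lambda>v. can (f (snd v))" "map can [x, y]"] by simp
  then show ?thesis unfolding le_S ev(1) using can_eq_iff[OF _ ev(2) con_in_Dom(1)] by simp
qed

text \<open>Equality is a symbol of type 0 only, and there representatives coincide just when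
  \<open>equ\<close> holds. Passing to representatives thus changes nothing that a formula of
  \<open>Base\<close> can express.\<close>

lemma sat_quot:
  assumes "wff Base \<Delta> A" "\<forall>c\<in>set_fm A. cn_in Base c" "length bs = length \<Delta>"
    "\<And>i. i < length \<Delta> \<Longrightarrow> star_free (\<Delta> ! i) \<and> bs ! i \<in> D (\<Delta> ! i) \<and> U (bs ! i)"
    "\<And>v. star_free (snd v) \<Longrightarrow> e v \<in> D (snd v) \<and> U (e v)"
  shows "sat quot (\<lambda>v. can (e v)) (map can bs) A \<longleftrightarrow> sat (S\<lparr>Dom := \<lambda>\<tau>. {x \<in> D \<tau>. U x}\<rparr>) e bs A"
  using assms(1-4)
proof (induction A arbitrary: \<Delta> bs)
  let ?U = "S\<lparr>Dom := \<lambda>\<tau>. {x \<in> D \<tau>. U x}\<rparr>"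
  have ev_U: "eval ?U e bs t = eval S e bs t" for bs t by (induction t) auto
  have ev_U': "eval ?U (\<lambda>_. undefined) bs t = eval S (\<lambda>_. undefined) bs t" for bs t by (induction t) auto
  have le_U: "le_in ?U x y \<longleftrightarrow> le_in S x y" for x y by (simp add: le_in_def ev_U')
  have ball_Dom: "(\<forall>d\<in>Dom quot \<tau>. Q d) \<longleftrightarrow> (\<forall>d. d \<in> D \<tau> \<longrightarrow> U d \<longrightarrow> Q (can d))"
    and bex_Dom: "(\<exists>d\<in>Dom quot \<tau>. Q d) \<longleftrightarrow> (\<exists>d. d \<in> D \<tau> \<and> U d \<and> Q (can d))"
    if "star_free \<tau>" for \<tau> Q
    using that by (auto simp: quot_def)
  {
    case (FEq s t)
    then show ?case
      using eval_quot[of \<Delta> s N bs e] eval_quot[of \<Delta> t N bs e] assms(5) can_eq_iff[of N] by (auto simp: ev_U)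
  next
    case (FSt t)
    then show ?case by simp
  next
    case FBot
    then show ?case by simp
  next
    case (FImp A B)
    then show ?case by auto
  next
    case (FAnd A B)
    then show ?case by auto
  next
    case (FOr A B)
    then show ?case by auto
  next
    case (FAll \<tau> A)
    have "sat quot (\<lambda>v. can (e v)) (map can (d # bs)) A \<longleftrightarrow> sat ?U e (d # bs) A" if "d \<in> D \<tau>" "U d" for d
      by (rule FAll.IH[of "\<tau> # \<Delta>"]) (use FAll.prems that in \<open>auto simp: nth_Cons split: nat.split\<close>)
    then show ?case using FAll.prems(1) by (auto simp: ball_Dom)
  next
    case (FEx \<tau> A)
    have "sat quot (\<lambda>v. can (e v)) (map can (d # bs)) A \<longleftrightarrow> sat ?U e (d # bs) A" if "d \<in> D \<tau>" "U d" for d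
      by (rule FEx.IH[of "\<tau> # \<Delta>"]) (use FEx.prems that in \<open>auto simp: nth_Cons split: nat.split\<close>)
    then show ?case using FEx.prems(1) by (auto simp: bex_Dom)
  next
    case (FBAll t A)
    have "sat quot (\<lambda>v. can (e v)) (map can (d # bs)) A \<longleftrightarrow> sat ?U e (d # bs) A" if "d \<in> D N" "U d" for d
      by (rule FBAll.IH[of "N # \<Delta>"]) (use FBAll.prems that in \<open>auto simp: nth_Cons split: nat.split\<close>)
    moreover have "eval S e bs t \<in> D N \<and> U (eval S e bs t) \<and>
        eval quot (\<lambda>v. can (e v)) (map can bs) t = can (eval S e bs t)"
      using eval_quot[of \<Delta> t N bs e] FBAll.prems assms(5) by auto
    ultimately show ?case by (auto simp: ball_Dom le_in_quot le_U ev_U)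
  next
    case (FBEx t A)
    have "sat quot (\<lambda>v. can (e v)) (map can (d # bs)) A \<longleftrightarrow> sat ?U e (d # bs) A" if "d \<in> D N" "U d" for d
      by (rule FBEx.IH[of "N # \<Delta>"]) (use FBEx.prems that in \<open>auto simp: nth_Cons split: nat.split\<close>)
    moreover have "eval S e bs t \<in> D N \<and> U (eval S e bs t) \<and>
        eval quot (\<lambda>v. can (e v)) (map can bs) t = can (eval S e bs t)"
      using eval_quot[of \<Delta> t N bs e] FBEx.prems assms(5) by auto
    ultimately show ?case by (auto simp: bex_Dom le_in_quot le_U ev_U)
  }
qed

end

text \<open>The restriction of a model to a downward closed set is a model: to prove \<open>P n\<close> by induction
  there, prove \<open>x \<le> n \<longrightarrow> P x\<close> by induction in the whole model.\<close>

lemma (in model) submodel: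
  assumes sub: "\<And>\<tau>. Dom S' \<tau> \<subseteq> Dom S \<tau>" and same: "app S' = app S" "con S' = con S" "equ S' = equ S"
    and app: "\<And>x y \<sigma> \<tau>. x \<in> Dom S' (\<sigma> \<Rrightarrow> \<tau>) \<Longrightarrow> y \<in> Dom S' \<sigma> \<Longrightarrow> app S x y \<in> Dom S' \<tau>"
    and con: "\<And>c. cn_in Base c \<Longrightarrow> con S c \<in> Dom S' (cty c)"
    and down: "\<And>m n. m \<in> Dom S N \<Longrightarrow> n \<in> Dom S' N \<Longrightarrow> m \<preceq> n \<Longrightarrow> m \<in> Dom S' N"
  shows "model S'"
proof
  have D': "x \<in> Dom S' \<tau> \<Longrightarrow> x \<in> Dom S \<tau>" for x \<tau> using sub by blast
  fix f1 g1 f2 g2 f3 g3 P n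
  assume fs: "\<forall>f\<in>{f1, g1, f2, g2, f3, g3}. f \<in> Dom S' T1"
    and P: "P = (\<lambda>x. (app S' f1 x = app S' g1 x \<longrightarrow> app S' f2 x = app S' g2 x) \<longrightarrow> app S' f3 x = app S' g3 x)"
    and base: "P (con S' cZero)" and step: "\<And>x. x \<in> Dom S' N \<Longrightarrow> P x \<Longrightarrow> P (app S' (con S' cSucc) x)"
    and n': "n \<in> Dom S' N"
  have n: "n \<in> D N" using D' n' by blast
  have fs': "f \<in> D T1" if "f \<in> {f1, g1, f2, g2, f3, g3}" for f using fs that D' by blast
  \<comment> \<open>Beyond n both sides of the last equation are replaced by 0, so it holds there
    automatically. This expresses the restriction to x \<preceq> n inside the pattern of
    \<open>induct6\<close>.\<close>
  have r: "rep N N (\<lambda>x. Ifz (Monus x n) (f \<bullet> x) Z)" if "f \<in> D T1" for f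
    using that n by (intro reps rep_ap1[of f N]) auto
  obtain f g where fg: "f \<in> D T1" "g \<in> D T1" "\<And>x. x \<in> D N \<Longrightarrow> f \<bullet> x = Ifz (Monus x n) (f3 \<bullet> x) Z"
    "\<And>x. x \<in> D N \<Longrightarrow> g \<bullet> x = Ifz (Monus x n) (g3 \<bullet> x) Z"
    using r[of f3] r[of g3] fs' by (auto simp: rep_def)
  let ?P = "\<lambda>x. (f1 \<bullet> x = g1 \<bullet> x \<longrightarrow> f2 \<bullet> x = g2 \<bullet> x) \<longrightarrow> f \<bullet> x = g \<bullet> x"
  have P_iff: "?P x \<longleftrightarrow> (x \<preceq> n \<longrightarrow> P x)" if x: "x \<in> D N" for x
    using x n fs' fg by (simp add: P same Ifz_Monus)
  have "?P n"
  proof (rule induct6[of f1 g1 f2 g2 f g ?P, OF _ refl _ _ n])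
    show "\<forall>h\<in>{f1, g1, f2, g2, f, g}. h \<in> D T1" using fs' fg by simp
    show "?P Z" using P_iff[of Z] base by (simp add: same)
    fix x assume x: "x \<in> D N" and Px: "?P x"
    show "?P (Sc x)"
    proof (subst P_iff)
      show "Sc x \<preceq> n \<longrightarrow> P (Sc x)"
      proof
        assume "Sc x \<preceq> n"
        then have "x \<preceq> n" using Sc_Le x n by blast
        then have "P x" "x \<in> Dom S' N" using P_iff[OF x] Px down[OF x n'] by blast+
        then show "P (Sc x)" using step[of x] by (simp add: same)
      qed
    qed (use x in simp)
  qed
  then show "P n" using P_iff[OF n] n by simp
next
  fix x y show "equ S' x y \<longleftrightarrow> x = y" by (simp add: same)
qed (use sub app con comb_K comb_S suc_inj suc_nz rec_0 rec_suc same in \<open>auto simp: subset_iff\<close>)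

context substruct
begin

text \<open>With nothing removed, every number of S has a representative in the quotient, so an
  induction over representatives is an induction in S, where it is an instance of the
  schema.\<close>

lemma model_quot_UNIV:
  assumes "\<And>x. U x"
  shows "model quot"
proof
  fix f1 g1 f2 g2 f3 g3 P n
  assume fs: "\<forall>f\<in>{f1, g1, f2, g2, f3, g3}. f \<in> Dom quot T1"
    and P: "P = (\<lambda>x. (app quot f1 x = app quot g1 x \<longrightarrow> app quot f2 x = app quot g2 x) \<longrightarrow> app quot f3 x = app quot g3 x)"
    and base: "P (con quot cZero)" and step: "\<And>x. x \<in> Dom quot N \<Longrightarrow> P x \<Longrightarrow> P (app quot (con quot cSucc) x)"
    and n: "n \<in> Dom quot N"
  have fD: "f \<in> D T1" "can f = f" if "f \<in> {f1, g1, f2, g2, f3, g3}" for f using fs that by (auto simp: Dom_quot)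
  let ?P = "\<lambda>x. (equ S (f1 \<bullet> x) (g1 \<bullet> x) \<longrightarrow> equ S (f2 \<bullet> x) (g2 \<bullet> x)) \<longrightarrow> equ S (f3 \<bullet> x) (g3 \<bullet> x)"
  have eq_iff: "can (f \<bullet> can x) = can (g \<bullet> can x) \<longleftrightarrow> equ S (f \<bullet> x) (g \<bullet> x)"
    if "f \<in> {f1, g1, f2, g2, f3, g3}" "g \<in> {f1, g1, f2, g2, f3, g3}" "x \<in> D N" for f g x
    using fD[OF that(1)] fD[OF that(2)] that(3) can_app2[of N N f x] can_app2[of N N g x]
      can_eq_iff[of N "f \<bullet> x" "g \<bullet> x"] app_closed[of f N N x] app_closed[of g N N x] by simp
  have P_iff: "P (can x) \<longleftrightarrow> ?P x" if "x \<in> D N" for x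
    using that by (simp add: P eq_iff)
  have "?P n"
  proof (rule induction_axiom[of f1 g1 f2 g2 f3 g3 ?P, OF _ refl])
    show "\<forall>f\<in>{f1, g1, f2, g2, f3, g3}. f \<in> D T1" using fD by blast
    show "?P (con S cZero)" using base P_iff[OF con_in_Dom(1)] by simp
    show "n \<in> D N" using n by (simp add: Dom_quot)
    fix x assume x: "x \<in> D N" and "?P x"
    then have "P (can x)" using P_iff by blast
    then have "P (can (can (con S cSucc) \<bullet> can x))"
      using step[of "can x"] x assms by (simp add: can_in_quot)
    then have "P (can (con S cSucc \<bullet> x))" using can_app[OF _ _ con_in_Dom(2) x] by simp
    then show "?P (con S cSucc \<bullet> x)" using P_iff app_closed[OF con_in_Dom(2) x] by blast
  qed
  then show "P n" using P_iff[of n] n by (simp add: Dom_quot)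
next
  fix x y show "equ quot x y \<longleftrightarrow> x = y" by simp
qed (fact app_quot_closed con_quot_closed quot_equations)+

text \<open>Representatives are chosen with respect to the whole of S, independently of U. The
  quotient of the part is therefore a substructure of the quotient of the whole, and
  \<open>submodel\<close> applies.\<close>

lemma model_quot: "model quot"
proof -
  interpret T: substruct S L "\<lambda>_. True"
    by unfold_locales simp_all
  interpret M: model T.quot by (rule T.model_quot_UNIV) simp
  show ?thesis
  proof (rule M.submodel)
    show "Dom quot \<tau> \<subseteq> Dom T.quot \<tau>" for \<tau> by (auto simp: Dom_quot T.Dom_quot)
    show "app quot = app T.quot" "con quot = con T.quot" "equ quot = equ T.quot"
      by (simp_all add: quot_def T.quot_def)
    show "app T.quot x y \<in> Dom quot \<tau>" if "x \<in> Dom quot (\<sigma> \<Rrightarrow> \<tau>)" "y \<in> Dom quot \<sigma>" for x y \<sigma> \<tau>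
      using app_quot_closed[OF that] by simp
    show "con T.quot c \<in> Dom quot (cty c)" if "cn_in Base c" for c
      using con_quot_closed[OF that] by simp
    show "m \<in> Dom quot N" if m: "m \<in> Dom T.quot N" and n: "n \<in> Dom quot N" and le: "M.Le m n" for m n
    proof -
      have "le_in T.quot (can m) (can n)" using le m n by (simp add: Dom_quot T.Dom_quot)
      then have "le_in S m n" using m n T.le_in_quot[of m n] by (simp add: Dom_quot T.Dom_quot)
      then show ?thesis using m n U_le[of m n] by (simp add: Dom_quot T.Dom_quot)
    qed
  qed
qed

lemma sat_from_models:
  assumes A: "is_fm Base A" and models: "\<And>(M :: 'a struct) e. model M \<Longrightarrow> sat M e [] A"
    and e: "\<And>v. star_free (snd v) \<Longrightarrow> e v \<in> D (snd v) \<and> U (e v)"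
  shows "sat (S\<lparr>Dom := \<lambda>\<tau>. {x \<in> D \<tau>. U x}\<rparr>) e [] A"
  using sat_quot[of "[]" A "[]" e] A models[OF model_quot] e by (simp add: is_fm_def)

lemma U_nonempty: "star_free \<tau> \<Longrightarrow> \<exists>d. d \<in> D \<tau> \<and> U d"
  using model.Dom_nonempty[OF model_quot] by (auto simp: Dom_quot)

text \<open>\<open>rel_st\<close> leaves bounded quantifiers alone, whereas the smaller domains
  restrict them as well. The two readings agree because the bound is the value of a term, hence
  standard, and numbers below it are standard.\<close>

lemma sat_rel_st:
  assumes "wff Base \<Delta> A" "\<forall>c\<in>set_fm A. cn_in Base c" "length bs = length \<Delta>"
    "\<And>i. i < length \<Delta> \<Longrightarrow> star_free (\<Delta> ! i) \<and> bs ! i \<in> D (\<Delta> ! i) \<and> U (bs ! i)"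
    "\<And>v. star_free (snd v) \<Longrightarrow> e v \<in> D (snd v) \<and> U (e v)"
    and U: "U = std S"
  shows "sat S e bs (rel_st A) \<longleftrightarrow> sat (S\<lparr>Dom := \<lambda>\<tau>. {x \<in> D \<tau>. U x}\<rparr>) e bs A"
  using assms(1-4)
proof (induction A arbitrary: \<Delta> bs)
  let ?U = "S\<lparr>Dom := \<lambda>\<tau>. {x \<in> D \<tau>. U x}\<rparr>"
  have ev_U: "eval ?U e bs t = eval S e bs t" for bs t by (induction t) auto
  have ev_U': "eval ?U (\<lambda>_. undefined) bs t = eval S (\<lambda>_. undefined) bs t" for bs t by (induction t) auto
  have le_U: "le_in ?U x y \<longleftrightarrow> le_in S x y" for x y by (simp add: le_in_def ev_U')
  {
    case (FEq s t)
    then show ?case by (simp add: ev_U)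
  next
    case (FSt t)
    then show ?case by simp
  next
    case FBot
    then show ?case by simp
  next
    case (FImp A B)
    then show ?case by auto
  next
    case (FAnd A B)
    then show ?case by auto
  next
    case (FOr A B)
    then show ?case by auto
  next
    case (FAll \<tau> A)
    have "sat S e (d # bs) (rel_st A) \<longleftrightarrow> sat ?U e (d # bs) A" if "d \<in> D \<tau>" "U d" for d
      by (rule FAll.IH[of "\<tau> # \<Delta>"]) (use FAll.prems that in \<open>auto simp: nth_Cons split: nat.split\<close>)
    then show ?case by (auto simp: U)
  next
    case (FEx \<tau> A)
    have "sat S e (d # bs) (rel_st A) \<longleftrightarrow> sat ?U e (d # bs) A" if "d \<in> D \<tau>" "U d" for d
      by (rule FEx.IH[of "\<tau> # \<Delta>"]) (use FEx.prems that in \<open>auto simp: nth_Cons split: nat.split\<close>)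
    then show ?case by (auto simp: U)
  next
    case (FBAll t A)
    have "sat S e (d # bs) (rel_st A) \<longleftrightarrow> sat ?U e (d # bs) A" if "d \<in> D N" "U d" for d
      by (rule FBAll.IH[of "N # \<Delta>"]) (use FBAll.prems that in \<open>auto simp: nth_Cons split: nat.split\<close>)
    moreover have "eval S e bs t \<in> D N" "U (eval S e bs t)"
      using eval_quot[of \<Delta> t N bs e] FBAll.prems assms(5) by auto
    ultimately show ?case using U_le by (auto simp: le_U ev_U)
  next
    case (FBEx t A)
    have "sat S e (d # bs) (rel_st A) \<longleftrightarrow> sat ?U e (d # bs) A" if "d \<in> D N" "U d" for d
      by (rule FBEx.IH[of "N # \<Delta>"]) (use FBEx.prems that in \<open>auto simp: nth_Cons split: nat.split\<close>)
    moreover have "eval S e bs t \<in> D N" "U (eval S e bs t)"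
      using eval_quot[of \<Delta> t N bs e] FBEx.prems assms(5) by auto
    ultimately show ?case using U_le by (auto simp: le_U ev_U)
  }
qed

end

lemma (in epra_struct) substruct_UNIV: "substruct S L (\<lambda>_. True)"
  by unfold_locales simp_all

lemma (in epra_struct) substruct_std:
  assumes L: "L = Full" and st: "\<And>A e. A \<in> ST \<Longrightarrow> is_fm L A \<Longrightarrow> env_in L S e \<Longrightarrow> sat S e [] A"
  shows "substruct S L (std S)"
proof
  fix \<sigma> \<tau> f x
  assume "star_free \<sigma>" "star_free \<tau>" "f \<in> D (\<sigma> \<Rrightarrow> \<tau>)" "x \<in> D \<sigma>" "std S f" "std S x"
  then show "std S (f \<bullet> x)"
    using st[OF ST.st_app[of \<sigma> \<tau>], of "some_env((''f'', \<sigma> \<Rrightarrow> \<tau>) := f, (''x'', \<sigma>) := x)"] L some_env[unfolded L] by simp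
next
  fix c assume "cn_in Base c"
  then have c: "is_tm Full (Cn c) (cty c)" by (simp add: cn_in_mono)
  then show "std S (con S c)"
    using st[OF ST.st_closed[OF c], of some_env] L some_env[unfolded L] by auto
next
  fix \<tau> x y
  assume "star_free \<tau>" "x \<in> D \<tau>" "y \<in> D \<tau>" "std S x" "Eq S \<tau> x y"
  then show "std S y"
    using st[OF ST.st_eq[of \<tau>], of "some_env((''x'', \<tau>) := x, (''y'', \<tau>) := y)"] L some_env[unfolded L] by (simp add: sat_eq)
next
  fix m n
  assume "m \<in> D N" "n \<in> D N" "std S n" "le_in S m n"
  then show "std S m"
    using st[OF ST.st_le, of "some_env((''n'', N) := n, (''m'', N) := m)"] L some_env[unfolded L] by simp
qed

section \<open>The equivalence\<close>

lemma is_fm_le1: "is_tm L t T1 \<Longrightarrow> is_fm L (le1 t)"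
  by (auto simp: le1_def intro!: is_fm_all)

lemma is_fm_MUC: "is_fm L MUC" and is_fm_MPC: "is_fm L MPC" and is_fm_UFAN2: "is_fm L UFAN2"
  by (auto simp: MUC_def uc_mod_def MPC_def is_pc_mod_def UFAN2_def is_bintree_def Lt_def
      intro!: is_fm_all is_fm_ex is_fm_ball is_fm_bex is_fm_le1)

lemma fv_MUC: "fv MUC = {}" and fv_MPC: "fv MPC = {}" and fv_UFAN2: "fv UFAN2 = {}"
  by (auto simp: MUC_def uc_mod_def MPC_def is_pc_mod_def UFAN2_def is_bintree_def le1_def Lt_def Defs.Le_def)

lemma has_ty_mono: "has_ty Base \<Delta> t \<tau> \<Longrightarrow> has_ty Full \<Delta> t \<tau>"
  by (induction t arbitrary: \<tau>) auto

lemma wff_rel_st: "wff Base \<Delta> A \<Longrightarrow> wff Full \<Delta> (rel_st A)"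
  by (induction A arbitrary: \<Delta>) (auto dest: has_ty_mono)

lemma set_fm_rel_st: "set_fm (rel_st A) = set_fm A"
  by (induction A) auto

lemma fv_rel_st: "fv (rel_st A) = fv A"
  by (induction A) auto

lemma is_fm_rel_st: "is_fm Base A \<Longrightarrow> is_fm Full (rel_st A)"
  by (simp add: is_fm_def wff_rel_st set_fm_rel_st cn_in_mono)

theorem theorem6p1:
  shows "RCA0_omega_proves ((UFAN2 \<^bold>\<and> MPC) \<^bold>\<longleftrightarrow> MUC) \<and>
         RCA0_Omega_proves ((rel_st UFAN2 \<^bold>\<and> rel_st MPC) \<^bold>\<longleftrightarrow> rel_st MUC)"
proof
  let ?G = "(UFAN2 \<^bold>\<and> MPC) \<^bold>\<longleftrightarrow> MUC"
  have G: "is_fm Base ?G" "fv ?G = {}"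
    by (simp_all add: is_fm_MUC is_fm_MPC is_fm_UFAN2 fv_MUC fv_MPC fv_UFAN2)
  have models: "sat M e [] ?G" if "model M" for M :: "cn tm struct" and e
    by (rule model.sat_equivalence[OF that])
  show "RCA0_omega_proves ?G"
    unfolding RCA0_omega_proves_def
  proof (rule completeness[OF G])
    fix S :: "cn tm struct"
    assume *: "\<And>\<sigma> \<tau>. Dom S \<sigma> \<inter> Dom S \<tau> \<noteq> {} \<Longrightarrow> \<sigma> = \<tau>"
      "\<And>\<sigma> \<tau> x y. x \<in> Dom S (\<sigma> \<Rrightarrow> \<tau>) \<Longrightarrow> y \<in> Dom S \<sigma> \<Longrightarrow> app S x y \<in> Dom S \<tau>"
      "\<And>c. cn_in Base c \<Longrightarrow> con S c \<in> Dom S (cty c)" "\<And>\<tau>. ty_in Base \<tau> \<Longrightarrow> Dom S \<tau> \<noteq> {}"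
      "\<And>A e. A \<in> RCA0_omega \<Longrightarrow> is_fm Base A \<Longrightarrow> env_in Base S e \<Longrightarrow> sat S e [] A"
    interpret epra_struct S Base
      by unfold_locales (use * in \<open>auto simp: RCA0_omega_def\<close>)
    have e: "some_env v \<in> D (snd v)" if "star_free (snd v)" for v
      using env_inD[OF some_env] that by simp
    \<comment> \<open>For the trivial part the restricted structure is S itself.\<close>
    have "sat (S\<lparr>Dom := \<lambda>\<tau>. {x \<in> D \<tau>. True}\<rparr>) some_env [] ?G"
      by (rule substruct.sat_from_models[OF substruct_UNIV G(1) models]) (use e in auto)
    then have "sat S some_env [] ?G" by (simp del: sat.simps)
    then show "\<exists>e. env_in Base S e \<and> sat S e [] ?G" using some_env by blast
  qed
  have "RCA0_Omega_proves (rel_st ?G)"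
    unfolding RCA0_Omega_proves_def
  proof (rule completeness[OF is_fm_rel_st[OF G(1)]])
    show "fv (rel_st ?G) = {}" unfolding fv_rel_st by (rule G(2))
    fix S :: "cn tm struct"
    assume *: "\<And>\<sigma> \<tau>. Dom S \<sigma> \<inter> Dom S \<tau> \<noteq> {} \<Longrightarrow> \<sigma> = \<tau>"
      "\<And>\<sigma> \<tau> x y. x \<in> Dom S (\<sigma> \<Rrightarrow> \<tau>) \<Longrightarrow> y \<in> Dom S \<sigma> \<Longrightarrow> app S x y \<in> Dom S \<tau>"
      "\<And>c. cn_in Full c \<Longrightarrow> con S c \<in> Dom S (cty c)" "\<And>\<tau>. ty_in Full \<tau> \<Longrightarrow> Dom S \<tau> \<noteq> {}"
      "\<And>A e. A \<in> RCA0_Omega \<Longrightarrow> is_fm Full A \<Longrightarrow> env_in Full S e \<Longrightarrow> sat S e [] A"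
    interpret epra_struct S Full
      by unfold_locales (use * in \<open>auto simp: RCA0_Omega_def\<close>)
    interpret substruct S Full "std S"
      by (rule substruct_std) (use *(5) in \<open>auto simp: RCA0_Omega_def\<close>)
    \<comment> \<open>At types without \<open>Seq\<close> the environment takes standard values, as
      \<open>sat_rel_st\<close> demands; at the others any element of the domain will do.\<close>
    define e where "e v = (if star_free (snd v) then SOME d. d \<in> D (snd v) \<and> std S d else some_env v)" for v
    have e_std: "e v \<in> D (snd v) \<and> std S (e v)" if "star_free (snd v)" for v
      using someI_ex[OF U_nonempty[OF that]] that by (simp add: e_def)
    have "e v \<in> D (snd v)" for v
      using e_std[of v] env_inD[OF some_env, of v] by (cases "star_free (snd v)") (auto simp: e_def)
    then have "env_in Full S e" by (simp add: env_in_def)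
    moreover have "sat S e [] (rel_st ?G)"
    proof (subst sat_rel_st[OF _ _ _ _ e_std refl])
      show "wff Base [] ?G" "\<forall>c\<in>set_fm ?G. cn_in Base c" using G(1) unfolding is_fm_def by blast+
      show "sat (S\<lparr>Dom := \<lambda>\<tau>. {x \<in> D \<tau>. std S x}\<rparr>) e [] ?G"
        by (rule sat_from_models[OF G(1) models e_std])
    qed (simp_all del: sat.simps)
    ultimately show "\<exists>e. env_in Full S e \<and> sat S e [] (rel_st ?G)" by blast
  qed
  then show "RCA0_Omega_proves ((rel_st UFAN2 \<^bold>\<and> rel_st MPC) \<^bold>\<longleftrightarrow> rel_st MUC)" by simp
qed

end
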